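(* Let $m\ge 1$, $n\ge 1$, and let $\vec\lambda=(\lambda^1,\ldots,\lambda^n)$ be a sequence of dominant minuscule weights of $GL_m$. Then the number of affine growth diagrams of type $\vec\lambda$ is equal to the Littlewood--Richardson coefficient $c_{\vec\lambda}=\dim\left(V_{\lambda^1}\otimes\cdots\otimes V_{\lambda^n}\right)^{GL_m}$, where $V_\mu$ denotes the irreducible representation of $GL_m$ of highest weight $\mu$.
   Context: A dominant weight of $GL_m$ is a weakly decreasing sequence of $m$ integers; $\emptyset$ denotes the zero weight $(0,\ldots,0)$. The dual of $\mu=(\mu_1,\ldots,\mu_m)$ is $\mu^*=(-\mu_m,\ldots,-\mu_1)$. The minuscule weights are $\omega_i=(1,\ldots,1,0,\ldots,0)$ ($i$ ones) and $\omega_i^*=(0,\ldots,0,-1,\ldots,-1)$ ($i$ entries $-1$) for $1\le i\le m$. For $v\in\mathbb{Z}^m$, $\mathrm{sort}(v)$ is the rearrangement of the entries of $v$ in weakly decreasing order. The staircase of width $n$ has vertex set $V=\{(i,j)\in\mathbb{Z}^2: i\le j\le i+n\}$ (vertex $(i,j)$ lies on horizontal line $i$ and vertical line $j$; larger $i$ is further south, larger $j$ further east). For $i\in\mathbb{Z}$ and $i+1\le j\le i+n-1$ there is a unit square with NW corner $(i,j)$, NE corner $(i,j+1)$, SW corner $(i+1,j)$, SE corner $(i+1,j+1)$. An affine growth diagram of type $\vec\lambda$ is a map $L$ from $V$ to dominant weights of $GL_m$ such that: $L(i,i)=L(i,i+n)=\emptyset$ for all $i$; $L(i,i+1)=\lambda^r$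 where $r\in\{1,\ldots,n\}$, $r\equiv i \pmod n$; and every unit square satisfies the affine local rule $L(\mathrm{SE})=\mathrm{sort}\big(L(\mathrm{SW})+L(\mathrm{NE})-L(\mathrm{NW})\big)$. *)

theory Defs
  imports
    "Jordan_Normal_Form.VS_Connect"
    "HOL-Number_Theory.Cong"
    "HOL-Library.FuncSet"
begin

section \<open>Weights of the general linear group of rank m\<close>

text \<open>Weights are integer lists of length \<open>m\<close>; the entry \<open>\<mu>\<^sub>i\<close> is \<open>\<mu> ! (i - 1)\<close>.\<close>

definition dominant_weights :: "nat \<Rightarrow> int list set" where
  "dominant_weights m = {\<mu>. length \<mu> = m \<and> sorted_wrt (\<ge>) \<mu>}"

definition zero_weight :: "nat \<Rightarrow> int list" where
  "zero_weight m = replicate m 0"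

definition dual_weight :: "int list \<Rightarrow> int list" where
  "dual_weight \<mu> = rev (map uminus \<mu>)"

definition omega :: "nat \<Rightarrow> nat \<Rightarrow> int list" where
  "omega m i = replicate i 1 @ replicate (m - i) 0"

definition minuscule :: "nat \<Rightarrow> int list \<Rightarrow> bool" where
  "minuscule m \<mu> \<longleftrightarrow> (\<exists>i\<in>{1..m}. \<mu> = omega m i \<or> \<mu> = dual_weight (omega m i))"

definition sort_desc :: "int list \<Rightarrow> int list" where
  "sort_desc v = rev (sort v)"


section \<open>Affine growth diagrams\<close>

definition staircase :: "nat \<Rightarrow> (int \<times> int) set" where
  "staircase n = {(i, j). i \<le> j \<and> j \<le> i + int n}"

text \<open>Diagrams are extensional functions (\<open>undefined\<close> off the staircase), so that
  counting them counts maps on the staircase.\<close>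

definition affine_growth_diagrams ::
    "nat \<Rightarrow> nat \<Rightarrow> (nat \<Rightarrow> int list) \<Rightarrow> (int \<times> int \<Rightarrow> int list) set" where
  "affine_growth_diagrams m n lam =
    {L \<in> staircase n \<rightarrow>\<^sub>E dominant_weights m.
      (\<forall>i. L (i, i) = zero_weight m \<and> L (i, i + int n) = zero_weight m) \<and>
      (\<forall>i. \<forall>r\<in>{1..n}. [int r = i] (mod int n) \<longrightarrow> L (i, i + 1) = lam r) \<and>
      (\<forall>i j. i + 1 \<le> j \<and> j \<le> i + int n - 1 \<longrightarrow>
        L (i + 1, j + 1) =
          sort_desc (map2 (-) (map2 (+) (L (i + 1, j)) (L (i, j + 1))) (L (i, j))))}"


section \<open>Rational representations of the complex general linear group\<close>

definition GL :: "nat \<Rightarrow> complex mat monoid" where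
  "GL d = units_of (ring_mat TYPE(complex) d ())"

text \<open>The coordinate ring of \<open>GL\<close>: the algebra generated by the matrix
  entries and the inverse of the determinant. Only the values on \<open>carrier (GL m)\<close> matter.\<close>

inductive_set regular_functions :: "nat \<Rightarrow> (complex mat \<Rightarrow> complex) set" for m :: nat where
  const: "(\<lambda>g. c) \<in> regular_functions m"
| entry: "i < m \<Longrightarrow> j < m \<Longrightarrow> (\<lambda>g. g $$ (i, j)) \<in> regular_functions m"
| inverse_det: "(\<lambda>g. inverse (det g)) \<in> regular_functions m"
| add: "f \<in> regular_functions m \<Longrightarrow> h \<in> regular_functions m \<Longrightarrow>
    (\<lambda>g. f g + h g) \<in> regular_functions m"
| mult: "f \<in> regular_functions m \<Longrightarrow> h \<in> regular_functions m \<Longrightarrow>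
    (\<lambda>g. f g * h g) \<in> regular_functions m"

text \<open>A pair \<open>(d, \<rho>)\<close> stands for the group \<open>GL m\<close> acting on column vectors of length \<open>d\<close>
  through the matrices \<open>\<rho> g\<close>.\<close>

type_synonym matrix_rep = "nat \<times> (complex mat \<Rightarrow> complex mat)"

definition rational_rep :: "nat \<Rightarrow> matrix_rep \<Rightarrow> bool" where
  "rational_rep m = (\<lambda>(d, \<rho>).
    \<rho> \<in> hom (GL m) (GL d) \<and>
    (\<forall>i<d. \<forall>j<d. \<exists>f\<in>regular_functions m. \<forall>g\<in>carrier (GL m). \<rho> g $$ (i, j) = f g))"

definition irreducible_rep :: "nat \<Rightarrow> matrix_rep \<Rightarrow> bool" where
  "irreducible_rep m = (\<lambda>(d, \<rho>).
    d > 0 \<and>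
    (\<forall>W. VectorSpace.subspace class_ring W (module_vec TYPE(complex) d) \<and>
         (\<forall>g\<in>carrier (GL m). \<forall>w\<in>W. \<rho> g *\<^sub>v w \<in> W) \<longrightarrow>
         W = {0\<^sub>v d} \<or> W = carrier_vec d))"

text \<open>A highest weight vector of weight \<open>\<mu>\<close> is a nonzero vector on which the Borel subgroup
  of upper triangular matrices acts by the character
  \<open>b \<mapsto> b\<^sub>1\<^sub>1^\<mu>\<^sub>1 \<cdots> b\<^sub>m\<^sub>m^\<mu>\<^sub>m\<close>: it has weight \<open>\<mu>\<close> under the diagonal
  torus and is fixed by the unipotent upper triangular matrices.\<close>

definition highest_weight_vector :: "nat \<Rightarrow> matrix_rep \<Rightarrow> int list \<Rightarrow> complex vec \<Rightarrow> bool" where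
  "highest_weight_vector m = (\<lambda>(d, \<rho>) \<mu> v.
    v \<in> carrier_vec d \<and> v \<noteq> 0\<^sub>v d \<and>
    (\<forall>b\<in>carrier (GL m). upper_triangular b \<longrightarrow>
      \<rho> b *\<^sub>v v = (\<Prod>i<m. (b $$ (i, i)) powi (\<mu> ! i)) \<cdot>\<^sub>v v))"

definition irrep_of_highest_weight :: "nat \<Rightarrow> int list \<Rightarrow> matrix_rep \<Rightarrow> bool" where
  "irrep_of_highest_weight m \<mu> V \<longleftrightarrow>
    rational_rep m V \<and> irreducible_rep m V \<and> (\<exists>v. highest_weight_vector m V \<mu> v)"

text \<open>By the theorem of the highest weight, for dominant \<open>\<mu>\<close> such a representation exists
  and is unique up to isomorphism, so the choice of representative is immaterial.\<close>

definition irrep :: "nat \<Rightarrow> int list \<Rightarrow> matrix_rep" where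
  "irrep m \<mu> = (SOME V. irrep_of_highest_weight m \<mu> V)"


section \<open>Tensor products, invariants and the Littlewood--Richardson coefficient\<close>

text \<open>Kronecker product: the matrix of \<open>A \<otimes> B\<close> in the basis
  \<open>e\<^sub>i \<otimes> f\<^sub>j\<close>, ordered lexicographically.\<close>

definition kronecker :: "complex mat \<Rightarrow> complex mat \<Rightarrow> complex mat" where
  "kronecker A B = mat (dim_row A * dim_row B) (dim_col A * dim_col B)
    (\<lambda>(i, j). A $$ (i div dim_row B, j div dim_col B) * B $$ (i mod dim_row B, j mod dim_col B))"

definition trivial_rep :: matrix_rep where
  "trivial_rep = (1, \<lambda>g. 1\<^sub>m 1)"

definition tensor_rep :: "matrix_rep \<Rightarrow> matrix_rep \<Rightarrow> matrix_rep" where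
  "tensor_rep = (\<lambda>(d, \<rho>) (e, \<sigma>). (d * e, \<lambda>g. kronecker (\<rho> g) (\<sigma> g)))"

definition tensor_reps :: "matrix_rep list \<Rightarrow> matrix_rep" where
  "tensor_reps Vs = foldr tensor_rep Vs trivial_rep"

definition invariants :: "nat \<Rightarrow> matrix_rep \<Rightarrow> complex vec set" where
  "invariants m = (\<lambda>(d, \<rho>). {v \<in> carrier_vec d. \<forall>g\<in>carrier (GL m). \<rho> g *\<^sub>v v = v})"

definition dim_invariants :: "nat \<Rightarrow> matrix_rep \<Rightarrow> nat" where
  "dim_invariants m V =
    vectorspace.dim class_ring ((module_vec TYPE(complex) (fst V))\<lparr>carrier := invariants m V\<rparr>)"

definition LR_coefficient :: "nat \<Rightarrow> nat \<Rightarrow> (nat \<Rightarrow> int list) \<Rightarrow> nat" where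
  "LR_coefficient m n lam = dim_invariants m (tensor_reps (map (\<lambda>k. irrep m (lam k)) [1..<Suc n]))"

end

(*
  Both sides count lattice words. A diagram is determined by any one of its rows, which is a closed
  walk in the dominant chamber whose k-th step is a rearrangement of lambda^k; the local rule is
  invertible, and, by periodicity, a bijection between the walks on consecutive rows.

  On the other side every minuscule weight is omega_k - e (1,...,1) for some k and e, so by the
  uniqueness of highest weight representations the tensor product consists of the functions on words
  that alternate within blocks, twisted by det^(-e). Order the words lexicographically. In the leading
  word of an invariant every prefix has dominant weight, because the coefficient function of the prefix
  is a lowest weight vector and thus has antidominant weight. Conversely every lattice word leads an
  invariant, namely the block antisymmetrisation of a product of determinants over the columns of the
  corresponding rectangular tableau. Hence the invariants have a basis indexed by the lattice words,
  that is, by the walks.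
*)
theory Submission
  imports Defs "HOL-Combinatorics.Permutations"
begin

section \<open>Rows of affine growth diagrams\<close>

text \<open>Two features of the definitions shape the argument. A diagram is constrained only by the
  sorting rule and its boundary, so it has to be proved that the steps inside it are minuscule:
  sorting contracts distances, and the zero boundaries on both sides turn contraction into equality.
  And \<open>irrep\<close> is a choice among all rational representations, so a tensor factor
  becomes accessible only through an explicit isomorphism with a twisted exterior power. It is
  obtained as the span of the orbit of a pair of highest weight vectors, with density of the big
  cell in place of Lie algebra arguments.

  Leading words bound the invariants from above without complete reducibility; the input is that a
  lowest weight is antidominant, which follows from one SL_2 identity and a Hermitian form. For the
  lower bound the constructed invariants are triangular for the dominance order on block contents,
  not for the lexicographic order. The two bounds share only the index set of lattice words, so the
  orders need not agree.\<close>

abbreviation vadd :: "int list \<Rightarrow> int list \<Rightarrow> int list" where "vadd \<equiv> map2 (+)"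
abbreviation vsub :: "int list \<Rightarrow> int list \<Rightarrow> int list" where "vsub \<equiv> map2 (-)"

section \<open>Sorting a sum with two-valued increments\<close>

lemma sort_desc_unique:
  assumes "sorted_wrt (\<ge>) x" "mset x = mset v"
  shows "sort_desc v = x"
proof -
  have "sort v = rev x"
    by (rule properties_for_sort) (use assms in \<open>auto simp: sorted_wrt_rev\<close>)
  thus ?thesis by (simp add: sort_desc_def)
qed

lemma sorted_sort_desc: "sorted_wrt (\<ge>) (sort_desc v)"
  unfolding sort_desc_def sorted_wrt_rev by simp

lemma mset_sort_desc [simp]: "mset (sort_desc v) = mset v"
  by (simp add: sort_desc_def)

lemma length_sort_desc [simp]: "length (sort_desc v) = length v"
  by (simp add: sort_desc_def)

lemma mset_eq_sum:
  assumes "mset xs = mset ys"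
  shows "(\<Sum>i<length xs. f (xs ! i)) = (\<Sum>i<length ys. (f (ys ! i) :: 'b :: comm_monoid_add))"
proof -
  have "sum_list (map f xs) = sum_list (map f ys)"
    using assms by (metis mset_map sum_mset_sum_list)
  thus ?thesis by (simp add: sum_list_sum_nth atLeast0LessThan)
qed

text \<open>Sorting the pairs lexicographically also sorts the sums, because entries are integers
  and increments differ by at most 1. Hence sorting \<open>x + d\<close> only permutes the
  increments among positions with equal entry of \<open>x\<close>. Keeping the pairs, and not just
  the increments, is what later makes the local rule invertible.\<close>

lemma sort_desc_two_valued_zip:
  assumes x: "sorted_wrt (\<ge>) x" and len: "length d = length x" and d: "set d \<subseteq> {c, c + 1}"
  shows "mset (zip x (vsub (sort_desc (vadd x d)) x)) = mset (zip x d)"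
proof -
  \<comment> \<open>As \<open>b - c\<close> is 0 or 1, this single integer key encodes the
    lexicographic order on pairs.\<close>
  let ?k = "\<lambda>(a, b). 2 * a + (b - c)"
  define z where "z = rev (sort_key ?k (zip x d))"
  have mz: "mset z = mset (zip x d)" by (simp add: z_def)
  have lz: "length z = length x" using len by (simp add: z_def)
  have setz: "snd p \<in> {c, c + 1}" if "p \<in> set z" for p
    using that d set_zip_rightD[of "fst p" "snd p" x d] by (auto simp: z_def)
  have sz: "sorted_wrt (\<lambda>p q. ?k p \<ge> ?k q) z"
    unfolding z_def sorted_wrt_rev using sorted_sort_key[of ?k "zip x d"]
    by (simp add: sorted_map)
  have "sorted_wrt (\<lambda>p q. fst p \<ge> fst q) z"
  proof (rule sorted_wrt_mono_rel[OF _ sz])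
    fix p q assume "p \<in> set z" "q \<in> set z" "?k p \<ge> ?k q"
    moreover have "snd p = c \<or> snd p = c + 1" "snd q = c \<or> snd q = c + 1"
      using setz calculation by blast+
    ultimately show "fst p \<ge> fst q"
      unfolding case_prod_beta by presburger
  qed
  hence "sorted_wrt (\<ge>) (map fst z)" by (simp add: sorted_wrt_map)
  moreover have "mset (map fst z) = mset x"
    using mz len by (metis map_fst_zip mset_map)
  ultimately have fz: "map fst z = x"
    using x by (metis sort_desc_unique)
  have "sorted_wrt (\<lambda>p q. fst p + snd p \<ge> fst q + snd q) z"
  proof (rule sorted_wrt_mono_rel[OF _ sz])
    fix p q assume "p \<in> set z" "q \<in> set z" "?k p \<ge> ?k q"
    moreover have "snd p = c \<or> snd p = c + 1" "snd q = c \<or> snd q = c + 1"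
      using setz calculation by blast+
    ultimately show "fst p + snd p \<ge> fst q + snd q"
      unfolding case_prod_beta by presburger
  qed
  hence "sorted_wrt (\<ge>) (map (\<lambda>(a, b). a + b) z)" by (simp add: sorted_wrt_map case_prod_beta)
  moreover have "mset (map (\<lambda>(a, b). a + b) z) = mset (vadd x d)"
    using mz by (metis mset_map)
  ultimately have yz: "sort_desc (vadd x d) = map (\<lambda>(a, b). a + b) z"
    by (rule sort_desc_unique)
  have "zip x (vsub (sort_desc (vadd x d)) x) = z"
  proof (rule nth_equalityI)
    fix i assume "i < length (zip x (vsub (sort_desc (vadd x d)) x))"
    hence i: "i < length z" using lz by (simp add: yz)
    have "x ! i = fst (z ! i)" using fz i by (metis nth_map)
    thus "zip x (vsub (sort_desc (vadd x d)) x) ! i = z ! i"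
      using i lz by (simp add: yz case_prod_beta)
  qed (simp add: yz lz)
  thus ?thesis by (simp add: mz)
qed

lemma sort_desc_two_valued:
  assumes x: "sorted_wrt (\<ge>) x" and len: "length d = length x" and d: "set d \<subseteq> {c, c + 1}"
  shows "mset (vsub (sort_desc (vadd x d)) x) = mset d"
proof -
  have "mset (map snd (zip x (vsub (sort_desc (vadd x d)) x))) = mset (map snd (zip x d))"
    using sort_desc_two_valued_zip[OF assms] by (metis mset_map)
  thus ?thesis using len by (simp only: map_snd_zip length_map length_zip length_sort_desc min.idem)
qed

section \<open>Rearrangement inequality, lengths and sums\<close>

lemma rearrangement:
  fixes x y z :: "int list"
  assumes "sorted_wrt (\<ge>) x" "sorted_wrt (\<ge>) y" "mset y = mset z" "length x = length y"
  shows "(\<Sum>i<length x. x ! i * z ! i) \<le> (\<Sum>i<length x. x ! i * y ! i)"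
  using assms
proof (induction x arbitrary: y z)
  case (Cons x0 xs)
  obtain y0 ys where y: "y = y0 # ys" using Cons.prems by (cases y) auto
  obtain z0 zs where z: "z = z0 # zs" using Cons.prems y by (cases z) auto
  have lz: "length zs = length xs" using Cons.prems y z by (metis length_Cons mset_eq_length nat.inject)
  have step: "(\<Sum>i<length xs. xs ! i * w ! i) \<le> (\<Sum>i<length xs. xs ! i * ys ! i)"
    if "mset ys = mset w" for w
    using Cons.IH[of ys w] Cons.prems y that by simp
  show ?case
  proof (cases "z0 = y0")
    case True
    thus ?thesis using step[of zs] Cons.prems y z
      by (simp add: lessThan_Suc_eq_insert_0 sum.reindex del: sum.lessThan_Suc)
  next
    case False
    have "y0 \<in> set z" using Cons.prems(3) y by (metis list.set_intros(1) mset_eq_setD)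
    then obtain p where p: "p < length zs" "zs ! p = y0" using False z by (auto simp: in_set_conv_nth)
    have "z0 \<in> set y" using Cons.prems(3) z by (metis list.set_intros(1) mset_eq_setD)
    hence zy: "z0 \<le> y0" using Cons.prems(2) y by auto
    \<comment> \<open>Tail of \<open>z\<close> after its head has been exchanged with an occurrence
      of the maximum \<open>y0\<close>. The exchange does not lower the pairing with the decreasing
      \<open>x\<close>, and the tails fall to the induction hypothesis.\<close>
    define w where "w = zs[p := z0]"
    have "mset zs = add_mset y0 (mset zs - {#y0#})" using p by (metis in_multiset_in_set insert_DiffM nth_mem)
    moreover from this have "add_mset y0 (mset ys) = add_mset y0 (add_mset z0 (mset zs - {#y0#}))"
      using Cons.prems(3) y z by (metis add_mset_commute mset.simps(2))
    ultimately have "mset w = mset ys" using p by (simp add: w_def mset_update)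
    from step[OF this[symmetric]] have le: "(\<Sum>i<length xs. xs ! i * w ! i) \<le> (\<Sum>i<length xs. xs ! i * ys ! i)" .
    have "(\<Sum>i<length xs. xs ! i * w ! i) = (\<Sum>i<length xs. xs ! i * zs ! i + (if i = p then xs ! p * (z0 - y0) else 0))"
      by (rule sum.cong) (use p lz in \<open>auto simp: w_def nth_list_update algebra_simps\<close>)
    also have "\<dots> = (\<Sum>i<length xs. xs ! i * zs ! i) + xs ! p * (z0 - y0)"
      using p lz by (simp add: sum.distrib)
    finally have eq: "(\<Sum>i<length xs. xs ! i * w ! i) = (\<Sum>i<length xs. xs ! i * zs ! i) + xs ! p * (z0 - y0)" .
    have "xs ! p \<le> x0" using Cons.prems(1) p lz by (auto)
    hence "xs ! p * (y0 - z0) \<le> x0 * (y0 - z0)" using zy by (intro mult_right_mono) auto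
    hence "x0 * z0 + (\<Sum>i<length xs. xs ! i * zs ! i) \<le> x0 * y0 + (\<Sum>i<length xs. xs ! i * ys ! i)"
      using le eq by (simp add: algebra_simps)
    thus ?thesis using y z
      by (simp add: lessThan_Suc_eq_insert_0 sum.reindex del: sum.lessThan_Suc)
  qed
qed simp

definition nrm :: "int list \<Rightarrow> int" where "nrm v = (\<Sum>i<length v. (v ! i)\<^sup>2)"

definition tot :: "int list \<Rightarrow> int" where "tot v = (\<Sum>i<length v. v ! i)"

lemma nrm_mset: "mset x = mset y \<Longrightarrow> nrm x = nrm y"
  unfolding nrm_def by (rule mset_eq_sum)

lemma tot_mset: "mset x = mset y \<Longrightarrow> tot x = tot y"
  unfolding tot_def by (rule mset_eq_sum)

text \<open>Sorting preserves the length of \<open>x + d\<close> and does not lower its pairing with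
  the sorted \<open>x\<close>; expanding the square shows that it moves \<open>x + d\<close> no
  further from \<open>x\<close>.\<close>

lemma nrm_sort_desc_le:
  assumes x: "sorted_wrt (\<ge>) x" and len: "length d = length x"
  shows "nrm (vsub (sort_desc (vadd x d)) x) \<le> nrm d"
proof -
  define y where "y = sort_desc (vadd x d)"
  have ly: "length y = length x" using len by (simp add: y_def)
  have my: "mset y = mset (vadd x d)" by (simp add: y_def)
  have "(\<Sum>i<length x. x ! i * (vadd x d) ! i) \<le> (\<Sum>i<length x. x ! i * y ! i)"
    using rearrangement[OF x, of y "vadd x d"] sorted_sort_desc[of "vadd x d"] my ly by (simp add: y_def)
  hence 1: "(\<Sum>i<length x. x ! i * (x ! i + d ! i)) \<le> (\<Sum>i<length x. x ! i * y ! i)"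
    using len by simp
  have "nrm y = nrm (vadd x d)" by (rule nrm_mset[OF my])
  hence 2: "(\<Sum>i<length x. (y ! i)\<^sup>2) = (\<Sum>i<length x. (x ! i + d ! i)\<^sup>2)"
    using len ly by (simp add: nrm_def)
  have "nrm (vsub y x) = (\<Sum>i<length x. (y ! i)\<^sup>2 + (x ! i)\<^sup>2 - 2 * (x ! i * y ! i))"
    using ly by (simp add: nrm_def power2_diff mult.commute mult.left_commute)
  also have "\<dots> = (\<Sum>i<length x. (y ! i)\<^sup>2) + (\<Sum>i<length x. (x ! i)\<^sup>2) - 2 * (\<Sum>i<length x. x ! i * y ! i)"
    by (simp add: sum.distrib sum_subtractf sum_distrib_left)
  also have "\<dots> \<le> (\<Sum>i<length x. (x ! i + d ! i)\<^sup>2) + (\<Sum>i<length x. (x ! i)\<^sup>2)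
      - 2 * (\<Sum>i<length x. x ! i * (x ! i + d ! i))"
    using 1 2 by simp
  also have "\<dots> = (\<Sum>i<length x. (x ! i + d ! i)\<^sup>2 + (x ! i)\<^sup>2 - 2 * (x ! i * (x ! i + d ! i)))"
    by (simp add: sum.distrib sum_subtractf sum_distrib_left)
  also have "\<dots> = nrm d" unfolding nrm_def len
    by (rule sum.cong) (auto simp: power2_eq_square algebra_simps)
  finally show ?thesis by (simp add: y_def)
qed

lemma tot_sort_desc:
  assumes len: "length d = length x"
  shows "tot (vsub (sort_desc (vadd x d)) x) = tot d"
proof -
  have "tot (sort_desc (vadd x d)) = tot (vadd x d)" by (rule tot_mset) simp
  thus ?thesis using len by (simp add: tot_def sum_subtractf sum.distrib)
qed

text \<open>For \<open>e\<close> with values \<open>c\<close> and \<open>c + 1\<close> the indicator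
  of \<open>x ! i + e ! i = t\<close> is affine in \<open>e ! i\<close> on each level set of
  \<open>x\<close>. So the multiset of \<open>x + e\<close> depends on \<open>e\<close> only through
  its sums over these level sets.\<close>

lemma count_two_valued:
  fixes x e :: "int list"
  assumes "set e \<subseteq> {c, c + 1}" "length e = length x"
  shows "int (count (mset (vadd x e)) t) = (\<Sum>i<length x. (if x ! i = t - c then c + 1 - e ! i else 0)
    + (if x ! i = t - c - 1 then e ! i - c else 0))"
proof -
  have "int (count (mset (vadd x e)) t) = (\<Sum>i<length x. if x ! i + e ! i = t then 1 else 0)"
  proof -
    have "count (mset (vadd x e)) t = length (filter ((=) t) (vadd x e))"
      by (simp only: count_mset count_list_eq_length_filter)
    also have "\<dots> = card {i. i < length x \<and> x ! i + e ! i = t}"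
      unfolding length_filter_conv_card using assms(2)
      by (intro arg_cong[where f=card]) auto
    finally show ?thesis by (simp add: sum.If_cases Int_def)
  qed
  also have "\<dots> = (\<Sum>i<length x. (if x ! i = t - c then c + 1 - e ! i else 0)
    + (if x ! i = t - c - 1 then e ! i - c else 0))"
  proof (rule sum.cong)
    fix i assume "i \<in> {..<length x}"
    hence "e ! i \<in> set e" using assms(2) by simp
    hence "e ! i \<in> {c, c + 1}" using assms(1) by blast
    thus "(if x ! i + e ! i = t then 1 else 0) = (if x ! i = t - c then c + 1 - e ! i else 0)
      + (if x ! i = t - c - 1 then e ! i - c else 0)" by auto
  qed simp
  finally show ?thesis .
qed

text \<open>With two possible values, length and sum fix both multiplicities; the formula is
  \<open>count_two_valued\<close> at the zero vector.\<close>

lemma two_valued_mset: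
  fixes d e :: "int list"
  assumes "set d \<subseteq> {c, c + 1}" "set e \<subseteq> {c, c + 1}" "length d = length e" "tot d = tot e"
  shows "mset d = mset e"
proof (rule multiset_eqI)
  fix t
  have *: "int (count (mset v) t) = (if t = c then int (length v) * (c + 1) - tot v
      else if t = c + 1 then tot v - int (length v) * c else 0)"
    if "set v \<subseteq> {c, c + 1}" for v :: "int list"
  proof -
    have "vadd (replicate (length v) 0) v = v" by (rule nth_equalityI) auto
    hence "int (count (mset v) t) = (\<Sum>i<length v. (if 0 = t - c then c + 1 - v ! i else 0)
        + (if 0 = t - c - 1 then v ! i - c else 0))"
      using count_two_valued[OF that, of "replicate (length v) 0" t] by simp
    thus ?thesis by (auto simp: tot_def sum.distrib sum_subtractf)
  qed
  have "int (count (mset d) t) = int (count (mset e) t)"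
    unfolding *[OF assms(1)] *[OF assms(2)] assms(3,4) ..
  thus "count (mset d) t = count (mset e) t" by (simp only: of_nat_eq_iff)
qed

text \<open>For an integer \<open>v\<close> the product \<open>(v - c) * (v - c - 1)\<close> is
  nonnegative and vanishes exactly at \<open>c\<close> and \<open>c + 1\<close>. Its sum over the
  entries depends only on length, sum and squared norm, so \<open>d\<close> inherits the two values
  of \<open>e\<close>.\<close>

lemma two_valued_by_norm:
  fixes d e :: "int list"
  assumes e: "set e \<subseteq> {c, c + 1}" and len: "length d = length e"
    and tot: "tot d = tot e" and nrm: "nrm d = nrm e"
  shows "mset d = mset e"
proof -
  have *: "(\<Sum>i<length v. (v ! i - c) * (v ! i - c - 1)) =
      nrm v - (2 * c + 1) * tot v + int (length v) * (c * (c + 1))" for v :: "int list"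
  proof -
    have "(\<Sum>i<length v. (v ! i - c) * (v ! i - c - 1)) =
      (\<Sum>i<length v. (v ! i)\<^sup>2 - (2 * c + 1) * (v ! i) + c * (c + 1))"
      by (rule sum.cong) (auto simp: power2_eq_square algebra_simps)
    thus ?thesis by (simp add: nrm_def tot_def sum.distrib sum_subtractf sum_distrib_left)
  qed
  have "(\<Sum>i<length e. (e ! i - c) * (e ! i - c - 1)) = 0"
  proof (rule sum.neutral, safe)
    fix i assume "i < length e"
    hence "e ! i \<in> {c, c + 1}" using e nth_mem by blast
    thus "(e ! i - c) * (e ! i - c - 1) = 0" by auto
  qed
  hence z: "(\<Sum>i<length d. (d ! i - c) * (d ! i - c - 1)) = 0"
    unfolding * using len tot nrm by simp
  have nn: "0 \<le> (d ! i - c) * (d ! i - c - 1)" for i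
    by (cases "d ! i - c \<ge> 1") (auto intro: mult_nonneg_nonneg mult_nonpos_nonpos)
  have "\<forall>i\<in>{..<length d}. (d ! i - c) * (d ! i - c - 1) = 0"
    using z nn by (subst (asm) sum_nonneg_eq_0_iff) auto
  hence "\<forall>i<length d. d ! i = c \<or> d ! i = c + 1"
    by (metis add.commute diff_eq_eq eq_iff_diff_eq_0 lessThan_iff mult_eq_0_iff)
  hence "set d \<subseteq> {c, c + 1}" by (auto simp: in_set_conv_nth)
  thus ?thesis using two_valued_mset[of d c e] e len tot by blast
qed

section \<open>A single unit square\<close>

lemma dominant_length: "x \<in> dominant_weights m \<Longrightarrow> length x = m"
  and dominant_sorted: "x \<in> dominant_weights m \<Longrightarrow> sorted_wrt (\<ge>) x"
  by (auto simp: dominant_weights_def)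

lemma zero_weight_dominant [simp]: "zero_weight m \<in> dominant_weights m"
  by (auto simp: dominant_weights_def zero_weight_def sorted_wrt_iff_nth_less)

text \<open>The last conclusion makes the local rule invertible: within each level set of \<open>SW\<close> the
  vectors \<open>NE - SE\<close> and \<open>NW - SW\<close> are two-valued with the same sum, so they are rearrangements of
  each other there.\<close>

lemma local_rule:
  assumes SW: "SW \<in> dominant_weights m" and NW: "NW \<in> dominant_weights m" and NE: "NE \<in> dominant_weights m"
    and e: "set (vsub NW SW) \<subseteq> {c', c' + 1}" and d: "set (vsub NE NW) \<subseteq> {c, c + 1}"
    and SE: "SE = sort_desc (vsub (vadd SW NE) NW)"
  shows "SE \<in> dominant_weights m" "mset (vsub SE SW) = mset (vsub NE NW)"
    "mset (vsub NE SE) = mset (vsub NW SW)" "NW = sort_desc (vsub (vadd SW NE) SE)"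
proof -
  note len = dominant_length[OF SW] dominant_length[OF NW] dominant_length[OF NE]
  show SEd: "SE \<in> dominant_weights m"
    using len by (simp add: SE dominant_weights_def sorted_sort_desc)
  note len = len dominant_length[OF SEd]
  have SE1: "SE = sort_desc (vadd SW (vsub NE NW))"
    unfolding SE by (rule arg_cong[of _ _ sort_desc], rule nth_equalityI) (use len in auto)
  have SE2: "SE = sort_desc (vadd NE (map uminus (vsub NW SW)))"
    unfolding SE by (rule arg_cong[of _ _ sort_desc], rule nth_equalityI) (use len in auto)
  have z: "mset (zip SW (vsub SE SW)) = mset (zip SW (vsub NE NW))"
    using sort_desc_two_valued_zip[OF dominant_sorted[OF SW] _ d] len unfolding SE1[symmetric] by simp
  show "mset (vsub SE SW) = mset (vsub NE NW)"
    using sort_desc_two_valued[OF dominant_sorted[OF SW] _ d] len unfolding SE1[symmetric] by simp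
  \<comment> \<open>Read from \<open>NE\<close>, the square adds the negated vertical step, whose
    two values are \<open>- c' - 1\<close> and \<open>- c'\<close>.\<close>
  have "mset (vsub SE NE) = mset (map uminus (vsub NW SW))"
    using sort_desc_two_valued[OF dominant_sorted[OF NE], of "map uminus (vsub NW SW)" "- c' - 1"] e len
    unfolding SE2[symmetric] by fastforce
  hence "mset (map uminus (vsub SE NE)) = mset (map uminus (map uminus (vsub NW SW)))"
    by (metis mset_map)
  moreover have "map uminus (vsub SE NE) = vsub NE SE"
    "map uminus (map uminus (vsub NW SW)) = vsub NW SW"
    by (rule nth_equalityI; use len in simp)+
  ultimately show me: "mset (vsub NE SE) = mset (vsub NW SW)" by metis
  have e': "set (vsub NE SE) \<subseteq> {c', c' + 1}" using e mset_eq_setD[OF me] by simp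
  have lev: "(\<Sum>i<m. if SW ! i = s then vsub NE SE ! i else 0) =
      (\<Sum>i<m. if SW ! i = s then vsub NW SW ! i else 0)" for s
  proof -
    have "(\<Sum>i<m. if SW ! i = s then SE ! i - SW ! i else 0) = (\<Sum>i<m. if SW ! i = s then NE ! i - NW ! i else 0)"
      using mset_eq_sum[OF z, of "\<lambda>(a, b). if a = s then b else 0"] len by simp
    moreover have "(\<Sum>i<m. if SW ! i = s then vsub NE SE ! i else 0) - (\<Sum>i<m. if SW ! i = s then vsub NW SW ! i else 0)
      = (\<Sum>i<m. if SW ! i = s then NE ! i - NW ! i else 0) - (\<Sum>i<m. if SW ! i = s then SE ! i - SW ! i else 0)"
      unfolding sum_subtractf[symmetric] using len by (intro sum.cong) auto
    ultimately show ?thesis by simp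
  qed
  have "mset (vadd SW (vsub NE SE)) = mset (vadd SW (vsub NW SW))"
  proof (rule multiset_eqI)
    fix t
    have *: "int (count (mset (vadd SW f)) t) = (\<Sum>i<m. if SW ! i = t - c' then c' + 1 else 0)
        - (\<Sum>i<m. if SW ! i = t - c' then f ! i else 0)
        + (\<Sum>i<m. if SW ! i = t - c' - 1 then f ! i else 0)
        - (\<Sum>i<m. if SW ! i = t - c' - 1 then c' else 0)"
      if "set f \<subseteq> {c', c' + 1}" "length f = m" for f
    proof -
      have "int (count (mset (vadd SW f)) t) = (\<Sum>i<m. ((if SW ! i = t - c' then c' + 1 else 0)
        - (if SW ! i = t - c' then f ! i else 0)) + ((if SW ! i = t - c' - 1 then f ! i else 0)
        - (if SW ! i = t - c' - 1 then c' else 0)))"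
        unfolding count_two_valued[OF that(1) that(2)[folded len(1)]] len(1)
        by (intro sum.cong) auto
      thus ?thesis by (simp only: sum.distrib sum_subtractf)
    qed
    show "count (mset (vadd SW (vsub NE SE))) t = count (mset (vadd SW (vsub NW SW))) t"
      using *[OF e'] *[OF e] len lev by simp
  qed
  moreover have "vadd SW (vsub NE SE) = vsub (vadd SW NE) SE" "vadd SW (vsub NW SW) = NW"
    by (rule nth_equalityI; use len in simp)+
  ultimately show "NW = sort_desc (vsub (vadd SW NE) SE)"
    using sort_desc_unique[OF dominant_sorted[OF NW], of "vsub (vadd SW NE) SE"] by metis
qed


section \<open>Admissible rows and the passage to the row below\<close>

locale growth =
  fixes m n :: nat and lam :: "nat \<Rightarrow> int list"
  assumes n: "n \<ge> 1" and minus: "\<forall>k\<in>{1..n}. minuscule m (lam k)"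
begin

text \<open>Types are numbered from 1, so the index is shifted down before the reduction modulo
  \<open>n\<close> and up again afterwards.\<close>

definition lam_per :: "int \<Rightarrow> int list" where
  "lam_per i = lam (nat ((i - 1) mod int n) + 1)"

lemma lam_per_mod: "lam_per (i + int n) = lam_per i"
proof -
  have "(i + int n - 1) mod int n = (i - 1) mod int n"
    by (metis add_diff_eq diff_add_eq mod_add_self2)
  thus ?thesis by (simp add: lam_per_def)
qed

lemma lam_per_cong:
  assumes "r \<in> {1..n}" "[int r = i] (mod int n)"
  shows "lam_per i = lam r"
proof -
  have "[int r - 1 = i - 1] (mod int n)" using assms(2) by (intro cong_diff) auto
  hence "(i - 1) mod int n = (int r - 1) mod int n" by (simp add: cong_def)
  also have "\<dots> = int r - 1" using assms(1) by (intro mod_pos_pos_trivial) auto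
  finally have "nat ((i - 1) mod int n) + 1 = r" using assms(1) by auto
  thus ?thesis by (simp add: lam_per_def)
qed

lemma lam_per_index:
  obtains r where "r \<in> {1..n}" "[int r = i] (mod int n)" "lam_per i = lam r"
proof -
  define r where "r = nat ((i - 1) mod int n) + 1"
  have b: "0 \<le> (i - 1) mod int n" "(i - 1) mod int n < int n" using n by simp_all
  have r: "r \<in> {1..n}" using b by (auto simp: r_def)
  have "int r = (i - 1) mod int n + 1" using b by (simp add: r_def)
  moreover have "[(i - 1) mod int n + 1 = (i - 1) + 1] (mod int n)"
    by (intro cong_add) (auto simp: cong_def)
  ultimately have "[int r = i] (mod int n)" by simp
  from that[OF r this] lam_per_cong[OF r this] show ?thesis by simp
qed

lemma lam_per_two_valued: obtains c where "set (lam_per i) \<subseteq> {c, c + 1}"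
proof -
  have "minuscule m (lam_per i)" using minus lam_per_index[of i] by metis
  then obtain k where "lam_per i = omega m k \<or> lam_per i = dual_weight (omega m k)"
    by (auto simp: minuscule_def)
  hence "set (lam_per i) \<subseteq> {0, 0 + 1} \<or> set (lam_per i) \<subseteq> {-1, -1 + 1}"
    by (auto simp: omega_def dual_weight_def)
  thus ?thesis using that by blast
qed

lemma lam_per_dominant: "lam_per i \<in> dominant_weights m"
proof -
  have "minuscule m (lam_per i)" using minus lam_per_index[of i] by metis
  then obtain k where "k \<le> m" "lam_per i = omega m k \<or> lam_per i = dual_weight (omega m k)"
    by (auto simp: minuscule_def)
  moreover have "sorted_wrt (\<ge>) (replicate p a)" for p and a :: int
    by (simp add: sorted_wrt_iff_nth_less)
  ultimately show ?thesis
    by (auto simp: dominant_weights_def omega_def dual_weight_def sorted_wrt_append)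
qed

text \<open>\<open>R j\<close> stands for the weight at vertex \<open>(i, i + j)\<close>. Steps are
  prescribed only up to rearrangement; that the rows of a diagram satisfy this is the content of
  \<open>agd_step\<close>.\<close>

definition rows :: "int \<Rightarrow> (nat \<Rightarrow> int list) set" where
  "rows i = {R \<in> {..n} \<rightarrow>\<^sub>E dominant_weights m. R 0 = zero_weight m \<and> R n = zero_weight m \<and>
    (\<forall>j<n. mset (vsub (R (Suc j)) (R j)) = mset (lam_per (i + int j)))}"

lemma rows_periodic: "rows (i + int n) = rows i"
proof -
  have "lam_per (i + int n + int j) = lam_per (i + int j)" for j
    using lam_per_mod[of "i + int j"] by (simp add: algebra_simps)
  thus ?thesis by (simp add: rows_def)
qed

lemma length_zero_weight [simp]: "length (zero_weight m) = m"
  by (simp add: zero_weight_def)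

lemma vsub_zero: "length x = m \<Longrightarrow> vsub x (zero_weight m) = x"
  by (rule nth_equalityI) (auto simp: zero_weight_def)

lemma finite_rows: "finite (rows i)"
proof -
  \<comment> \<open>\<open>P j\<close> collects what can be reached from zero by adding
    \<open>j\<close> rearranged types.\<close>
  define P where "P = (\<lambda>j. rec_nat {zero_weight m}
    (\<lambda>j F. (\<lambda>(x, p). vadd x p) ` (F \<times> {p. mset p = mset (lam_per (i + int j))})) j)"
  have P0: "P 0 = {zero_weight m}" by (simp add: P_def)
  have PS: "P (Suc j) = (\<lambda>(x, p). vadd x p) ` (P j \<times> {p. mset p = mset (lam_per (i + int j))})" for j
    by (simp add: P_def)
  have fin: "finite (P j)" for j
    by (induction j) (simp_all only: P0 PS finite.intros finite_imageI finite_cartesian_product mset_eq_finite)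
  have "rows i \<subseteq> {..n} \<rightarrow>\<^sub>E (\<Union>j\<le>n. P j)"
  proof
    fix R assume R: "R \<in> rows i"
    have "R j \<in> P j" if "j \<le> n" for j
      using that
    proof (induction j)
      case 0
      thus ?case using R by (simp add: P0 rows_def)
    next
      case (Suc j)
      have dom: "R j \<in> dominant_weights m" "R (Suc j) \<in> dominant_weights m"
        using R Suc.prems by (auto simp: rows_def)
      have "R (Suc j) = vadd (R j) (vsub (R (Suc j)) (R j))"
        by (rule nth_equalityI) (use dom[THEN dominant_length] in auto)
      thus ?case unfolding PS using R Suc by (auto simp: rows_def intro!: image_eqI[of _ _ "(R j, _)"])
    qed
    thus "R \<in> {..n} \<rightarrow>\<^sub>E (\<Union>j\<le>n. P j)" using R unfolding rows_def by (auto simp: PiE_iff)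
  qed
  thus ?thesis by (rule finite_subset) (intro finite_PiE finite_UN_I fin finite_atMost)
qed

text \<open>Entry \<open>t\<close> of the new row lies in the column of entry \<open>t + 1\<close>
  of \<open>R\<close>, whence the shift: the square has \<open>NW = R (t + 1)\<close>,
  \<open>NE = R (t + 2)\<close> and \<open>SW = next_row R t\<close>.\<close>

fun next_row :: "(nat \<Rightarrow> int list) \<Rightarrow> nat \<Rightarrow> int list" where
  "next_row R 0 = zero_weight m"
| "next_row R (Suc t) = sort_desc (vsub (vadd (next_row R t) (R (Suc (Suc t)))) (R (Suc t)))"

text \<open>The last entry would need a weight east of the end of \<open>R\<close>, so no square
  produces it; the boundary condition supplies zero.\<close>

definition down :: "(nat \<Rightarrow> int list) \<Rightarrow> nat \<Rightarrow> int list" where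
  "down R = (\<lambda>t\<in>{..n}. if t = n then zero_weight m else next_row R t)"

text \<open>Induction eastwards. The vertical step between the new row and \<open>R\<close> starts
  as \<open>R 1 - 0\<close>, of the type of line \<open>i\<close>; \<open>local_rule\<close> carries
  it through each square while handing the horizontal step of \<open>R\<close> down.\<close>

lemma next_row_steps:
  assumes R: "R \<in> rows i"
  shows "t < n \<Longrightarrow> next_row R t \<in> dominant_weights m \<and>
    mset (vsub (R (Suc t)) (next_row R t)) = mset (lam_per i)"
    "Suc t < n \<Longrightarrow> mset (vsub (next_row R (Suc t)) (next_row R t)) = mset (lam_per (i + 1 + int t)) \<and>
      R (Suc t) = sort_desc (vsub (vadd (next_row R t) (R (Suc (Suc t)))) (next_row R (Suc t)))"
proof -
  have dom: "R t \<in> dominant_weights m" if "t \<le> n" for t using R that by (auto simp: rows_def)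
  have st: "mset (vsub (R (Suc j)) (R j)) = mset (lam_per (i + int j))" if "j < n" for j
    using R that by (auto simp: rows_def)
  have tv: "\<exists>c. set v \<subseteq> {c, c + 1}" if "mset v = mset (lam_per k)" for v k
    using lam_per_two_valued[of k] mset_eq_setD[OF that] by metis
  have key: "next_row R (Suc t) \<in> dominant_weights m \<and>
      mset (vsub (R (Suc (Suc t))) (next_row R (Suc t))) = mset (lam_per i) \<and>
      mset (vsub (next_row R (Suc t)) (next_row R t)) = mset (lam_per (i + 1 + int t)) \<and>
      R (Suc t) = sort_desc (vsub (vadd (next_row R t) (R (Suc (Suc t)))) (next_row R (Suc t)))"
    if IH: "next_row R t \<in> dominant_weights m" "mset (vsub (R (Suc t)) (next_row R t)) = mset (lam_per i)"
      and t: "Suc t < n" for t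
  proof -
    obtain c' where c': "set (vsub (R (Suc t)) (next_row R t)) \<subseteq> {c', c' + 1}" using tv[OF IH(2)] by blast
    obtain c where c: "set (vsub (R (Suc (Suc t))) (R (Suc t))) \<subseteq> {c, c + 1}" using tv[OF st[OF t]] by blast
    have d: "R (Suc t) \<in> dominant_weights m" "R (Suc (Suc t)) \<in> dominant_weights m"
      using t by (auto intro: dom)
    note loc = local_rule[OF IH(1) d c' c next_row.simps(2)]
    have "i + int (Suc t) = i + 1 + int t" by simp
    thus ?thesis using loc IH(2) st[OF t] by metis
  qed
  have main: "next_row R t \<in> dominant_weights m \<and>
    mset (vsub (R (Suc t)) (next_row R t)) = mset (lam_per i)" if "t < n" for t
    using that
  proof (induction t)
    case 0
    have "R 0 = zero_weight m" using R by (simp add: rows_def)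
    thus ?case using st[of 0] 0 by simp
  next
    case (Suc t)
    thus ?case using key[of t] by simp
  qed
  show "t < n \<Longrightarrow> next_row R t \<in> dominant_weights m \<and>
    mset (vsub (R (Suc t)) (next_row R t)) = mset (lam_per i)" by (rule main)
  show "Suc t < n \<Longrightarrow> mset (vsub (next_row R (Suc t)) (next_row R t)) = mset (lam_per (i + 1 + int t)) \<and>
      R (Suc t) = sort_desc (vsub (vadd (next_row R t) (R (Suc (Suc t)))) (next_row R (Suc t)))"
    using key[of t] main[of t] by simp
qed

lemma down_rows:
  assumes R: "R \<in> rows i"
  shows "down R \<in> rows (i + 1)"
proof -
  have z: "R n = zero_weight m" using R by (simp add: rows_def)
  have "mset (vsub (down R (Suc j)) (down R j)) = mset (lam_per (i + 1 + int j))" if j: "j < n" for j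
  proof (cases "Suc j = n")
    \<comment> \<open>As \<open>R n\<close> is zero, the closing step of the new row is the last
      vertical step. It has type \<open>i\<close>, which by periodicity is the type of
      \<open>i + n\<close>.\<close>
    case True
    have "i + 1 + int j = i + int n" using True by simp
    hence "lam_per (i + 1 + int j) = lam_per i" using lam_per_mod[of i] by metis
    thus ?thesis using next_row_steps(1)[OF R j] True z by (simp add: down_def)
  next
    case False
    thus ?thesis using next_row_steps(2)[OF R, of j] j by (simp add: down_def)
  qed
  thus ?thesis using n next_row_steps(1)[OF R]
    by (auto simp: rows_def down_def)
qed

text \<open>The inverted local rule recovers \<open>R\<close> from east to west, starting from the
  known value zero at \<open>n\<close>.\<close>

lemma down_inj: "inj_on down (rows i)"
proof (rule inj_onI)
  fix R R' assume R: "R \<in> rows i" and R': "R' \<in> rows i" and eq: "down R = down R'"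
  have nr: "next_row R t = next_row R' t" if "t < n" for t
    using fun_cong[OF eq, of t] that by (simp add: down_def)
  have "R (n - k) = R' (n - k)" if "k < n" for k
    using that
  proof (induction k)
    case 0
    thus ?case using R R' by (simp add: rows_def)
  next
    case (Suc k)
    define t where "t = n - Suc (Suc k)"
    have t: "Suc (Suc t) = n - k" "Suc t = n - Suc k" "Suc t < n" "t < n" using Suc.prems by (auto simp: t_def)
    have "R (Suc (Suc t)) = R' (Suc (Suc t))" using Suc t by simp
    hence "R (Suc t) = R' (Suc t)"
      using next_row_steps(2)[OF R t(3)] next_row_steps(2)[OF R' t(3)] nr[OF t(3)] nr[OF t(4)] by metis
    thus ?case using t by simp
  qed
  hence *: "R t = R' t" if "0 < t" "t \<le> n" for t using that
    by (metis diff_diff_cancel diff_less zero_less_diff less_le_trans)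
  show "R = R'"
  proof
    fix t show "R t = R' t"
      using * R R' by (cases "t = 0"; cases "t \<le> n") (auto simp: rows_def PiE_iff extensional_def)
  qed
qed

text \<open>Injectivity makes the cardinality of \<open>rows i\<close> weakly increasing in
  \<open>i\<close>, and after \<open>n\<close> steps it returns to its start. So all these
  cardinalities agree, and an injection between finite sets of equal size is onto.\<close>

lemma down_bij: "bij_betw down (rows i) (rows (i + 1))"
proof -
  have step: "card (rows j) \<le> card (rows (j + 1))" for j
    by (rule card_inj_on_le[OF down_inj]) (use down_rows finite_rows in auto)
  have up: "card (rows j) \<le> card (rows (j + int k))" for j k
  proof (induction k)
    case (Suc k)
    show ?case using Suc step[of "j + int k"] by (simp add: algebra_simps)
  qed simp
  have "i + 1 + int (n - 1) = i + int n" using n by simp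
  hence "card (rows (i + 1)) \<le> card (rows i)"
    using up[of "i + 1" "n - 1"] rows_periodic[of i] by simp
  moreover have "card (down ` rows i) = card (rows i)" by (rule card_image[OF down_inj])
  ultimately have "down ` rows i = rows (i + 1)"
    using down_rows by (intro card_seteq) (auto intro: finite_rows)
  thus ?thesis using down_inj by (simp add: bij_betw_def)
qed

section \<open>Diagrams and their rows\<close>

abbreviation "AGD \<equiv> affine_growth_diagrams m n lam"

definition row :: "(int \<times> int \<Rightarrow> int list) \<Rightarrow> int \<Rightarrow> nat \<Rightarrow> int list" where
  "row L i = (\<lambda>t\<in>{..n}. L (i, i + int t))"

context
  fixes L assumes L: "L \<in> AGD"
begin

lemma agd_dominant: "i \<le> j \<Longrightarrow> j \<le> i + int n \<Longrightarrow> L (i, j) \<in> dominant_weights m"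
  using L by (auto simp: affine_growth_diagrams_def staircase_def)

lemma agd_zero: "L (i, i) = zero_weight m" "L (i, i + int n) = zero_weight m"
  using L by (auto simp: affine_growth_diagrams_def)

lemma agd_type: "L (i, i + 1) = lam_per i"
proof -
  obtain r where "r \<in> {1..n}" "[int r = i] (mod int n)" "lam_per i = lam r" by (rule lam_per_index)
  thus ?thesis using L unfolding affine_growth_diagrams_def by simp
qed

lemma agd_rule: "i + 1 \<le> j \<Longrightarrow> j \<le> i + int n - 1 \<Longrightarrow>
    L (i + 1, j + 1) = sort_desc (vsub (vadd (L (i + 1, j)) (L (i, j + 1))) (L (i, j)))"
  using L unfolding affine_growth_diagrams_def by blast

lemma agd_rule':
  assumes "i + 1 \<le> j" "j \<le> i + int n - 1"
  shows "L (i + 1, j + 1) = sort_desc (vadd (L (i + 1, j)) (vsub (L (i, j + 1)) (L (i, j))))"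
    "L (i + 1, j + 1) = sort_desc (vadd (L (i, j + 1)) (vsub (L (i + 1, j)) (L (i, j))))"
proof -
  have d: "L (i + 1, j) \<in> dominant_weights m" "L (i, j + 1) \<in> dominant_weights m" "L (i, j) \<in> dominant_weights m"
    using assms by (auto intro: agd_dominant)
  have "vsub (vadd (L (i + 1, j)) (L (i, j + 1))) (L (i, j)) = vadd (L (i + 1, j)) (vsub (L (i, j + 1)) (L (i, j)))"
    "vsub (vadd (L (i + 1, j)) (L (i, j + 1))) (L (i, j)) = vadd (L (i, j + 1)) (vsub (L (i + 1, j)) (L (i, j)))"
    by (rule nth_equalityI; use d[THEN dominant_length] in simp)+
  with agd_rule[OF assms] show
    "L (i + 1, j + 1) = sort_desc (vadd (L (i + 1, j)) (vsub (L (i, j + 1)) (L (i, j))))"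
    "L (i + 1, j + 1) = sort_desc (vadd (L (i, j + 1)) (vsub (L (i + 1, j)) (L (i, j))))"
    by metis+
qed

text \<open>The rule does not force steps to be minuscule square by square: sorting contracts distances,
  so the length of a horizontal step decreases southwards and that of a vertical step decreases
  eastwards, and the two zero boundaries chain these inequalities into a cycle.\<close>

lemma agd_step:
  assumes "i \<le> j" "j < i + int n"
  shows "mset (vsub (L (i, j + 1)) (L (i, j))) = mset (lam_per j)"
proof -
  let ?h = "\<lambda>i. nrm (vsub (L (i, j + 1)) (L (i, j)))"
  let ?T = "\<lambda>i. tot (vsub (L (i, j + 1)) (L (i, j)))"
  have len: "length (L (i, j)) = m" if "i \<le> j" "j \<le> i + int n" for i j
    using agd_dominant[OF that] by (rule dominant_length)
  have hstep: "?h (i + 1) \<le> ?h i" "?T (i + 1) = ?T i" if "i + 1 \<le> j" "j \<le> i + int n - 1" for i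
    using nrm_sort_desc_le[OF dominant_sorted[OF agd_dominant[of "i + 1" j]], of "vsub (L (i, j + 1)) (L (i, j))"]
      tot_sort_desc[of "vsub (L (i, j + 1)) (L (i, j))" "L (i + 1, j)"] that len
    by (simp_all add: agd_rule'(1)[OF that])
  have hmono: "?h (i + int k) \<le> ?h i \<and> ?T (i + int k) = ?T i" if "i + int k \<le> j" "j \<le> i + int n - 1" for i k
    using that
  proof (induction k)
    case (Suc k)
    have 1: "?h (i + int k) \<le> ?h i" "?T (i + int k) = ?T i" using Suc by auto
    have 2: "?h (i + int k + 1) \<le> ?h (i + int k)" "?T (i + int k + 1) = ?T (i + int k)"
      using Suc.prems by (intro hstep; simp)+
    have eq: "i + int (Suc k) = i + int k + 1" by simp
    show ?case unfolding eq by (rule conjI, rule order.trans[OF 2(1) 1(1)], rule trans[OF 2(2) 1(2)])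
  qed simp
  have h_le: "?h b \<le> ?h a" and T_eq: "?T b = ?T a" if ab: "a \<le> b" "b \<le> j" "j \<le> a + int n - 1" for a b
  proof -
    have b: "b = a + int (nat (b - a))" using ab by simp
    have "?h (a + int (nat (b - a))) \<le> ?h a \<and> ?T (a + int (nat (b - a))) = ?T a"
      by (rule hmono) (use ab in simp_all)
    thus "?h b \<le> ?h a" "?T b = ?T a" using b by metis+
  qed
  have lj: "length (lam_per j) = m" by (rule dominant_length[OF lam_per_dominant])
  have hj: "vsub (L (j, j + 1)) (L (j, j)) = lam_per j"
    using agd_zero(1)[of j] agd_type[of j] vsub_zero[OF lj] by simp
  \<comment> \<open>Line \<open>q\<close> meets column \<open>j\<close> at the right boundary, and
    \<open>q\<close> and \<open>j\<close> have the same type. The strip between lines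
    \<open>q\<close> and \<open>q + 1\<close> links the left boundary to the right one.\<close>
  define q where "q = j - int n"
  have j: "j = q + int n" by (simp add: q_def)
  have nrm0: "nrm (vsub (zero_weight m) x) = nrm x" if "length x = m" for x
    using that by (simp add: nrm_def zero_weight_def)
  \<comment> \<open>At its west end the strip starts with \<open>0 - lam_per q\<close>, and
    eastwards its vertical steps do not grow.\<close>
  have v: "nrm (vsub (L (q + 1, q + 1 + int k)) (L (q, q + 1 + int k))) \<le> nrm (lam_per q)" if "k < n" for k
    using that
  proof (induction k)
    case 0
    show ?case using agd_zero(1)[of "q + 1"] agd_type[of q] nrm0 lam_per_dominant[THEN dominant_length] by simp
  next
    case (Suc k)
    let ?c = "q + 1 + int k"
    have c: "q + 1 \<le> ?c" "?c \<le> q + int n - 1" using Suc.prems by auto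
    have "nrm (vsub (L (q + 1, ?c + 1)) (L (q, ?c + 1))) \<le> nrm (vsub (L (q + 1, ?c)) (L (q, ?c)))"
      using nrm_sort_desc_le[OF dominant_sorted[OF agd_dominant[of q "?c + 1"]], of "vsub (L (q + 1, ?c)) (L (q, ?c))"]
        c len unfolding agd_rule'(2)[OF c] by simp
    also have "\<dots> \<le> nrm (lam_per q)" using Suc by simp
    finally have "nrm (vsub (L (q + 1, ?c + 1)) (L (q, ?c + 1))) \<le> nrm (lam_per q)" .
    moreover have "q + 1 + int (Suc k) = ?c + 1" by simp
    ultimately show ?case by (simp only:)
  qed
  have "q + 1 + int (n - 1) = j" using n j by simp
  hence "nrm (vsub (L (q + 1, j)) (L (q, j))) \<le> nrm (lam_per q)" using v[of "n - 1"] n by simp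
  \<comment> \<open>In this corner \<open>L (q, j)\<close> and \<open>L (q + 1, j + 1)\<close> both
    vanish, so the vertical step at the end of the strip and the horizontal step next to it are both
    \<open>L (q + 1, j)\<close> up to sign.\<close>
  moreover have "L (q, j) = zero_weight m" using agd_zero(2)[of q] j by simp
  moreover have lq: "length (L (q + 1, j)) = m" using len[of "q + 1" j] j n by simp
  ultimately have "nrm (L (q + 1, j)) \<le> nrm (lam_per q)" by (simp add: vsub_zero)
  moreover have "L (q + 1, j + 1) = zero_weight m" using agd_zero(2)[of "q + 1"] j by (simp add: algebra_simps)
  moreover have "lam_per q = lam_per j" using lam_per_mod[of q] j by simp
  ultimately have top: "?h (q + 1) \<le> nrm (lam_per j)" using nrm0[OF lq] by simp
  have qi: "q + 1 \<le> i" "j \<le> q + 1 + int n - 1" "j \<le> i + int n - 1" using assms j by auto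
  have "?h i \<le> ?h (q + 1)" "?h j \<le> ?h i" "?T j = ?T i"
    using h_le[OF qi(1) assms(1) qi(2)] h_le[OF assms(1) order.refl qi(3)] T_eq[OF assms(1) order.refl qi(3)]
    by (simp_all only:)
  \<comment> \<open>The lengths are squeezed:
    \<open>?h j <= ?h i <= ?h (q + 1) <= nrm (lam_per j) = ?h j\<close>.\<close>
  hence "?h i = nrm (lam_per j)" "?T i = tot (lam_per j)" using top hj by auto
  moreover obtain c where "set (lam_per j) \<subseteq> {c, c + 1}" by (rule lam_per_two_valued)
  moreover have "length (vsub (L (i, j + 1)) (L (i, j))) = length (lam_per j)"
    using len[of i j] len[of i "j + 1"] assms lj by simp
  ultimately show ?thesis by (intro two_valued_by_norm[of "lam_per j" c])
qed

lemma row_in_rows: "row L i \<in> rows i"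
proof -
  have "mset (vsub (L (i, i + int (Suc j))) (L (i, i + int j))) = mset (lam_per (i + int j))" if "j < n" for j
    using agd_step[of i "i + int j"] that by (simp add: algebra_simps)
  thus ?thesis using agd_dominant agd_zero by (auto simp: rows_def row_def)
qed

lemma row_Suc: "row L (i + 1) = down (row L i)"
proof
  fix t
  have *: "next_row (row L i) t = L (i + 1, i + 1 + int t)" if "t < n" for t
    using that
  proof (induction t)
    case 0
    thus ?case by (simp add: agd_zero)
  next
    case (Suc t)
    have "i + 1 + int (Suc t) = (i + 1 + int t) + 1" by simp
    thus ?case using Suc agd_rule[of i "i + 1 + int t"] by (simp add: row_def algebra_simps)
  qed
  show "row L (i + 1) t = down (row L i) t"
    using *[of t] agd_zero(2)[of "i + 1"] by (simp add: row_def down_def)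
qed

end

text \<open>\<open>down\<close> propagates equality to the rows below, its injectivity to the rows
  above.\<close>

lemma row_inj: "inj_on (\<lambda>L. row L 1) AGD"
proof (rule inj_onI)
  fix L L' assume L: "L \<in> AGD" and L': "L' \<in> AGD" and eq: "row L 1 = row L' 1"
  have rows_eq: "row L i = row L' i" for i
  proof (induction i rule: int_induct[where k = 1])
    case base
    show ?case by (rule eq)
  next
    case (step1 i)
    thus ?case using row_Suc[OF L, of i] row_Suc[OF L', of i] by simp
  next
    case (step2 i)
    have "down (row L (i - 1)) = down (row L' (i - 1))"
      using row_Suc[OF L, of "i - 1"] row_Suc[OF L', of "i - 1"] step2 by simp
    thus ?case by (rule inj_onD[OF down_inj]) (rule row_in_rows[OF L] row_in_rows[OF L'])+
  qed
  show "L = L'"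
  proof
    fix p :: "int \<times> int"
    obtain i j where p: "p = (i, j)" by (cases p)
    show "L p = L' p"
    proof (cases "p \<in> staircase n")
      case True
      hence "nat (j - i) \<le> n" "i + int (nat (j - i)) = j" by (auto simp: p staircase_def)
      thus ?thesis using fun_cong[OF rows_eq[of i], of "nat (j - i)"] by (simp add: p row_def)
    next
      case False
      have "L \<in> staircase n \<rightarrow>\<^sub>E dominant_weights m" "L' \<in> staircase n \<rightarrow>\<^sub>E dominant_weights m"
        using L L' unfolding affine_growth_diagrams_def by simp_all
      thus ?thesis using False by (metis PiE_arb)
    qed
  qed
qed

lemma row_surj:
  assumes R: "R \<in> rows 1"
  shows "R \<in> (\<lambda>L. row L 1) ` AGD"
proof -
  define U where "U = rec_nat R (\<lambda>k Q. inv_into (rows (- int k)) down Q)"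
  have U0: "U 0 = R" and US: "U (Suc k) = inv_into (rows (- int k)) down (U k)" for k
    by (simp_all add: U_def)
  have Urows: "U k \<in> rows (1 - int k)" for k
  proof (induction k)
    case (Suc k)
    hence "U k \<in> down ` rows (- int k)" using down_bij[of "- int k"] by (simp add: bij_betw_def)
    hence "U (Suc k) \<in> rows (- int k)" unfolding US by (rule inv_into_into)
    moreover have "1 - int (Suc k) = - int k" by simp
    ultimately show ?case by metis
  qed (simp add: U0 R)
  have Udown: "down (U (Suc k)) = U k" for k
    unfolding US using down_bij[of "- int k"] Urows[of k] by (subst f_inv_into_f[of _ _ "rows (- int k)"]) (simp_all add: bij_betw_def)
  have Drows: "(down ^^ k) R \<in> rows (1 + int k)" for k
  proof (induction k)
    case (Suc k)
    thus ?case using down_rows[OF Suc] by (simp add: algebra_simps)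
  qed (simp add: R)
  define r where "r i = (if i \<ge> 1 then (down ^^ nat (i - 1)) R else U (nat (1 - i)))" for i :: int
  have r: "r i \<in> rows i" for i
  proof (cases "i \<ge> 1")
    case True
    have "1 + int (nat (i - 1)) = i" using True by simp
    thus ?thesis using Drows[of "nat (i - 1)"] True unfolding r_def by metis
  next
    case False
    have "1 - int (nat (1 - i)) = i" using False by simp
    thus ?thesis using Urows[of "nat (1 - i)"] False unfolding r_def by metis
  qed
  have rdown: "r (i + 1) = down (r i)" for i
  proof (cases "i \<ge> 1")
    case True
    hence "nat (i + 1 - 1) = Suc (nat (i - 1))" by simp
    thus ?thesis using True by (simp add: r_def del: nat_diff_distrib)
  next
    case False
    hence 1: "nat (1 - i) = Suc (nat (- i))" by simp
    have "r (i + 1) = U (nat (- i))" using False by (cases "i = 0") (auto simp: r_def U0)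
    thus ?thesis using False Udown[of "nat (- i)"] unfolding r_def 1 by simp
  qed
  define L where "L = (\<lambda>(i, j)\<in>staircase n. r i (nat (j - i)))"
  have Lr: "L (i, j) = r i (nat (j - i))" if "i \<le> j" "j \<le> i + int n" for i j
    using that by (simp add: L_def staircase_def)
  have rd: "r i t \<in> dominant_weights m" if "t \<le> n" for i t using r[of i] that by (auto simp: rows_def)
  have "L \<in> AGD"
    unfolding affine_growth_diagrams_def
  proof (intro CollectI conjI allI ballI impI)
    show "L \<in> staircase n \<rightarrow>\<^sub>E dominant_weights m"
      by (auto simp: L_def staircase_def intro!: rd)
    fix i :: int
    show "L (i, i) = zero_weight m" "L (i, i + int n) = zero_weight m"
      using r[of i] by (simp_all add: Lr rows_def)
    fix k assume k: "k \<in> {1..n}" "[int k = i] (mod int n)"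
    have "mset (vsub (r i (Suc 0)) (r i 0)) = mset (lam_per i)" "r i 0 = zero_weight m"
      using r[of i] n by (auto simp: rows_def)
    moreover have d: "r i (Suc 0) \<in> dominant_weights m" using rd n by simp
    ultimately have "mset (r i (Suc 0)) = mset (lam_per i)" by (simp add: vsub_zero dominant_length)
    \<comment> \<open>A step from zero is itself a weight, and two dominant weights with the same
      entries agree; so along the diagonal rearrangement becomes the equality that the type
      condition asks for.\<close>
    hence "r i (Suc 0) = lam_per i"
      using sort_desc_unique[OF dominant_sorted[OF d]] sort_desc_unique[OF dominant_sorted[OF lam_per_dominant]]
      by metis
    thus "L (i, i + 1) = lam k" using n lam_per_cong[OF k] by (simp add: Lr)
  next
    fix i j assume ij: "i + 1 \<le> j \<and> j \<le> i + int n - 1"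
    define t where "t = nat (j - i - 1)"
    have t: "nat (j - i) = Suc t" "nat (j + 1 - i) = Suc (Suc t)" "nat (j - (i + 1)) = t"
      "nat (j + 1 - (i + 1)) = Suc t" "Suc t < n" using ij by (auto simp: t_def)
    have "r (i + 1) (Suc t) = next_row (r i) (Suc t)" "r (i + 1) t = next_row (r i) t"
      unfolding rdown using t(5) by (simp_all add: down_def)
    thus "L (i + 1, j + 1) = sort_desc (vsub (vadd (L (i + 1, j)) (L (i, j + 1))) (L (i, j)))"
      using ij by (simp add: Lr t del: nat_diff_distrib)
  qed
  moreover have "row L 1 = R"
  proof
    fix t show "row L 1 t = R t"
      using R by (cases "t \<le> n") (auto simp: row_def Lr r_def rows_def PiE_iff extensional_def)
  qed
  ultimately show ?thesis by blast
qed

theorem card_affine_growth_diagrams: "finite AGD" "card AGD = card (rows 1)"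
proof -
  have "bij_betw (\<lambda>L. row L 1) AGD (rows 1)"
    unfolding bij_betw_def using row_inj row_surj row_in_rows by blast
  thus "finite AGD" "card AGD = card (rows 1)"
    using bij_betw_finite bij_betw_same_card finite_rows by metis+
qed

end

section \<open>Matrix products in coordinates\<close>

lemma mult_mat_vec_nth:
  assumes "A \<in> carrier_mat r c" "x \<in> carrier_vec c" "i < r"
  shows "(A *\<^sub>v x) $ i = (\<Sum>j<c. A $$ (i, j) * x $ j)"
  using assms by (auto simp: scalar_prod_def atLeast0LessThan intro!: sum.cong)

lemma mult_mat_nth:
  assumes "A \<in> carrier_mat r c" "B \<in> carrier_mat c q" "i < r" "j < q"
  shows "(A * B) $$ (i, j) = (\<Sum>k<c. A $$ (i, k) * B $$ (k, j))"
  using assms by (auto simp: scalar_prod_def atLeast0LessThan intro!: sum.cong)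

lemma mult_mat_vec_zero:
  assumes "(A :: complex mat) \<in> carrier_mat r c"
  shows "A *\<^sub>v 0\<^sub>v c = 0\<^sub>v r"
  by (rule eq_vecI) (use assms in \<open>auto simp: mult_mat_vec_nth\<close>)

lemma eq_mat_on_vecs:
  assumes A: "A \<in> carrier_mat r c" and B: "(B :: complex mat) \<in> carrier_mat r c"
    and eq: "\<And>x. x \<in> carrier_vec c \<Longrightarrow> A *\<^sub>v x = B *\<^sub>v x"
  shows "A = B"
proof (rule eq_matI)
  fix i j assume "i < dim_row B" "j < dim_col B"
  hence ij: "i < r" "j < c" using B by auto
  have "A $$ (i, j) = (A *\<^sub>v unit_vec c j) $ i" "B $$ (i, j) = (B *\<^sub>v unit_vec c j) $ i"
    using ij A B by (auto simp: mult_mat_vec_nth sum.delta if_distrib cong: if_cong)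
  thus "A $$ (i, j) = B $$ (i, j)" using eq by simp
qed (use A B in auto)

section \<open>The general linear group\<close>

lemma carrier_GL: "g \<in> carrier (GL m) \<longleftrightarrow> g \<in> carrier_mat m m \<and> det g \<noteq> 0"
proof
  assume "g \<in> carrier (GL m)"
  hence u: "g \<in> Units (ring_mat TYPE(complex) m ())" by (simp add: GL_def units_of_def)
  thus "g \<in> carrier_mat m m \<and> det g \<noteq> 0"
    using unit_imp_det_non_zero[OF u] by (auto simp: Units_def ring_mat_def)
next
  assume "g \<in> carrier_mat m m \<and> det g \<noteq> 0"
  thus "g \<in> carrier (GL m)" using det_non_zero_imp_unit[of g m "()"] by (simp add: GL_def units_of_def)
qed

lemma mult_GL [simp]: "g \<otimes>\<^bsub>GL m\<^esub> h = g * h"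
  by (simp add: GL_def units_of_def ring_mat_def)

lemma GL_closed: "g \<in> carrier (GL m) \<Longrightarrow> h \<in> carrier (GL m) \<Longrightarrow> g * h \<in> carrier (GL m)"
  by (auto simp: carrier_GL det_mult)

lemma one_in_GL [simp]: "1\<^sub>m m \<in> carrier (GL m)"
  by (simp add: carrier_GL)

lemma GL_carrier_mat: "g \<in> carrier (GL m) \<Longrightarrow> g \<in> carrier_mat m m"
  by (simp add: carrier_GL)

lemma upper_triangular_det:
  assumes "b \<in> carrier_mat m m" "upper_triangular b"
  shows "det b = (\<Prod>i<m. b $$ (i, i))"
  using det_upper_triangular[OF assms(2,1)] assms(1)
  by (simp add: diag_mat_def prod.list_conv_set_nth atLeast0LessThan)

lemma upper_triangular_GL_diag:
  assumes "b \<in> carrier (GL m)" "upper_triangular b" "i < m"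
  shows "b $$ (i, i) \<noteq> 0"
  using assms upper_triangular_det[of b m] by (auto simp: carrier_GL)

definition torus_char :: "nat \<Rightarrow> int list \<Rightarrow> complex mat \<Rightarrow> complex" where
  "torus_char m \<mu> b = (\<Prod>i<m. (b $$ (i, i)) powi (\<mu> ! i))"

lemma torus_char_nonzero:
  assumes "b \<in> carrier (GL m)" "upper_triangular b"
  shows "torus_char m \<mu> b \<noteq> 0"
  using upper_triangular_GL_diag[OF assms] by (auto simp: torus_char_def)

section \<open>Continuity of rational representations\<close>

definition mat_conv :: "nat \<Rightarrow> (nat \<Rightarrow> complex mat) \<Rightarrow> complex mat \<Rightarrow> bool" where
  "mat_conv m G g \<longleftrightarrow> (\<forall>n. G n \<in> carrier_mat m m) \<and> g \<in> carrier_mat m m \<and>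
    (\<forall>i<m. \<forall>j<m. (\<lambda>n. G n $$ (i, j)) \<longlonglongrightarrow> g $$ (i, j))"

lemma mat_conv_det:
  assumes "mat_conv m G g"
  shows "(\<lambda>n. det (G n)) \<longlonglongrightarrow> det g"
proof -
  have perm: "p i < m" if "p permutes {0..<m}" "i < m" for p i
    using permutes_in_image[OF that(1), of i] that(2) by simp
  have "det (G n) = (\<Sum>p\<in>{p. p permutes {0..<m}}. signof p * (\<Prod>i=0..<m. G n $$ (i, p i)))" for n
    using assms by (intro det_def') (auto simp: mat_conv_def)
  moreover have "det g = (\<Sum>p\<in>{p. p permutes {0..<m}}. signof p * (\<Prod>i=0..<m. g $$ (i, p i)))"
    using assms by (intro det_def') (auto simp: mat_conv_def)
  moreover have "(\<lambda>n. \<Sum>p\<in>{p. p permutes {0..<m}}. signof p * (\<Prod>i=0..<m. G n $$ (i, p i)))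
      \<longlonglongrightarrow> (\<Sum>p\<in>{p. p permutes {0..<m}}. signof p * (\<Prod>i=0..<m. g $$ (i, p i)))"
    using assms by (intro tendsto_sum tendsto_mult tendsto_const tendsto_prod)
      (auto simp: mat_conv_def perm)
  ultimately show ?thesis by simp
qed

text \<open>Induction over the generators of the coordinate ring; the nonvanishing of
  \<open>det g\<close> enters at \<open>inverse_det\<close>.\<close>

lemma regular_functions_continuous:
  assumes "f \<in> regular_functions m" "mat_conv m G g" "det g \<noteq> 0"
  shows "(\<lambda>n. f (G n)) \<longlonglongrightarrow> f g"
  using assms(1)
proof induction
  case inverse_det
  show ?case using mat_conv_det[OF assms(2)] assms(3) by (intro tendsto_inverse)
next
  case (entry i j)
  thus ?case using assms(2) by (auto simp: mat_conv_def)
qed (auto intro: tendsto_add tendsto_mult)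

lemma rational_rep_GL:
  assumes "rational_rep m (d, \<rho>)" "g \<in> carrier (GL m)"
  shows "\<rho> g \<in> carrier (GL d)"
  using assms by (auto simp: rational_rep_def hom_def)

lemma rational_rep_carrier:
  assumes "rational_rep m (d, \<rho>)" "g \<in> carrier (GL m)"
  shows "\<rho> g \<in> carrier_mat d d"
  using rational_rep_GL[OF assms] by (rule GL_carrier_mat)

lemma rational_rep_mult:
  assumes "rational_rep m (d, \<rho>)" "g \<in> carrier (GL m)" "h \<in> carrier (GL m)"
  shows "\<rho> (g * h) = \<rho> g * \<rho> h"
  using assms by (auto simp: rational_rep_def hom_def)

text \<open>\<open>hom\<close> asks for multiplicativity only; an invertible idempotent is the
  identity.\<close>

lemma rational_rep_one:
  assumes "rational_rep m (d, \<rho>)"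
  shows "\<rho> (1\<^sub>m m) = 1\<^sub>m d"
proof -
  let ?E = "\<rho> (1\<^sub>m m)"
  have E: "?E \<in> carrier (GL d)" by (rule rational_rep_GL[OF assms]) simp
  then obtain F where F: "F \<in> carrier_mat d d" "F * ?E = 1\<^sub>m d"
    by (auto simp: GL_def units_of_def Units_def ring_mat_def)
  have Ec: "?E \<in> carrier_mat d d" using E by (rule GL_carrier_mat)
  have "?E * ?E = ?E" using rational_rep_mult[OF assms, of "1\<^sub>m m" "1\<^sub>m m"] by simp
  hence "F * (?E * ?E) = 1\<^sub>m d" using F by simp
  thus ?thesis using F Ec by (simp add: assoc_mult_mat[symmetric, OF F(1) Ec Ec])
qed

lemma rational_rep_continuous:
  assumes "rational_rep m (d, \<rho>)" "mat_conv m G g" "\<And>n. G n \<in> carrier (GL m)" "g \<in> carrier (GL m)"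
    and ij: "i < d" "j < d"
  shows "(\<lambda>n. \<rho> (G n) $$ (i, j)) \<longlonglongrightarrow> \<rho> g $$ (i, j)"
proof -
  obtain f where f: "f \<in> regular_functions m" "\<And>g. g \<in> carrier (GL m) \<Longrightarrow> \<rho> g $$ (i, j) = f g"
    using assms(1) ij by (fastforce simp: rational_rep_def)
  have "(\<lambda>n. f (G n)) \<longlonglongrightarrow> f g"
    by (rule regular_functions_continuous[OF f(1) assms(2)]) (use assms(4) in \<open>simp add: carrier_GL\<close>)
  thus ?thesis using f(2) assms(3,4) by simp
qed

lemma rational_rep_continuous_vec:
  assumes "rational_rep m (d, \<rho>)" "mat_conv m G g" "\<And>n. G n \<in> carrier (GL m)" "g \<in> carrier (GL m)"
    and v: "v \<in> carrier_vec d" and i: "i < d"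
  shows "(\<lambda>n. (\<rho> (G n) *\<^sub>v v) $ i) \<longlonglongrightarrow> (\<rho> g *\<^sub>v v) $ i"
proof -
  have c: "\<rho> h \<in> carrier_mat d d" if "h \<in> carrier (GL m)" for h
    by (rule rational_rep_carrier[OF assms(1) that])
  have "(\<lambda>n. \<Sum>j<d. \<rho> (G n) $$ (i, j) * v $ j) \<longlonglongrightarrow> (\<Sum>j<d. \<rho> g $$ (i, j) * v $ j)"
    by (intro tendsto_sum tendsto_mult tendsto_const rational_rep_continuous[OF assms(1-4) i]) simp
  thus ?thesis by (simp add: mult_mat_vec_nth[OF c v i] assms(3,4))
qed

section \<open>Density of the big cell\<close>

definition lower_unitriangular :: "nat \<Rightarrow> complex mat \<Rightarrow> bool" where
  "lower_unitriangular m L \<longleftrightarrow> L \<in> carrier_mat m m \<and> (\<forall>i<m. L $$ (i, i) = 1 \<and> (\<forall>j<m. i < j \<longrightarrow> L $$ (i, j) = 0))"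

text \<open>The factors are index functions, not matrices, so that an induction on \<open>m\<close>
  can shift indices. \<open>R\<close> may be singular.\<close>

definition LU_close ::
  "nat \<Rightarrow> real \<Rightarrow> (nat \<Rightarrow> nat \<Rightarrow> complex) \<Rightarrow> (nat \<Rightarrow> nat \<Rightarrow> complex) \<Rightarrow> (nat \<Rightarrow> nat \<Rightarrow> complex) \<Rightarrow> bool" where
  "LU_close m \<epsilon> g L R \<longleftrightarrow> (\<forall>i<m. L i i = 1 \<and> (\<forall>j<m. i < j \<longrightarrow> L i j = 0)) \<and> (\<forall>i<m. \<forall>j<i. R i j = 0) \<and>
    (\<forall>i<m. \<forall>j<m. cmod ((\<Sum>k<m. L i k * R k j) - g i j) < \<epsilon>)"

lemma LU_closeD:
  assumes "LU_close m \<epsilon> g L R"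
  shows "\<And>i. i < m \<Longrightarrow> L i i = 1" "\<And>i j. i < m \<Longrightarrow> j < m \<Longrightarrow> i < j \<Longrightarrow> L i j = 0"
    "\<And>i j. i < m \<Longrightarrow> j < i \<Longrightarrow> R i j = 0"
    "\<And>i j. i < m \<Longrightarrow> j < m \<Longrightarrow> cmod ((\<Sum>k<m. L i k * R k j) - g i j) < \<epsilon>"
  using assms unfolding LU_close_def by blast+

text \<open>Gaussian elimination without pivoting: a vanishing pivot is replaced by
  \<open>\<epsilon> / 2\<close>, which disturbs a single entry, and the Schur complement is
  approximated by induction.\<close>

lemma LU_approx:
  assumes "\<epsilon> > 0"
  shows "\<exists>L R. LU_close m \<epsilon> g L R"
proof (induction m arbitrary: g)
  case (Suc m)
  define a where "a = (if g 0 0 = 0 then complex_of_real (\<epsilon> / 2) else g 0 0)"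
  have a: "a \<noteq> 0" "cmod (a - g 0 0) < \<epsilon>" using assms by (auto simp: a_def)
  obtain L R where "LU_close m \<epsilon> (\<lambda>i j. g (Suc i) (Suc j) - g (Suc i) 0 * g 0 (Suc j) / a) L R"
    using Suc.IH by blast
  note LR = LU_closeD[OF this]
  define L' where "L' i k = (if k = 0 then (if i = 0 then 1 else g i 0 / a)
    else if i = 0 then 0 else L (i - 1) (k - 1))" for i k
  define R' where "R' k j = (if k = 0 then (if j = 0 then a else g 0 j)
    else if j = 0 then 0 else R (k - 1) (j - 1))" for k j
  have "cmod ((\<Sum>k<Suc m. L' i k * R' k j) - g i j) < \<epsilon>" if "i < Suc m" "j < Suc m" for i j
  proof -
    have "(\<Sum>k<Suc m. L' i k * R' k j) = L' i 0 * R' 0 j + (\<Sum>k<m. L' i (Suc k) * R' (Suc k) j)"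
      by (rule sum.lessThan_Suc_shift)
    moreover have "cmod (L' i 0 * R' 0 j + (\<Sum>k<m. L' i (Suc k) * R' (Suc k) j) - g i j) < \<epsilon>"
    proof (cases i; cases j)
      fix i' j' assume "i = Suc i'" "j = Suc j'"
      thus ?thesis using LR(4)[of i' j'] that a by (simp add: L'_def R'_def algebra_simps)
    qed (use a assms in \<open>auto simp: L'_def R'_def\<close>)
    ultimately show ?thesis by simp
  qed
  moreover have "\<forall>i<Suc m. L' i i = 1 \<and> (\<forall>j<Suc m. i < j \<longrightarrow> L' i j = 0)"
    using LR(1,2) by (auto simp: L'_def)
  moreover have "\<forall>i<Suc m. \<forall>j<i. R' i j = 0"
    using LR(3) by (auto simp: R'_def)
  ultimately have "LU_close (Suc m) \<epsilon> g L' R'" unfolding LU_close_def by blast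
  thus ?case by blast
next
  case 0
  show ?case by (intro exI[of _ "\<lambda>_ _. 0"]) (simp add: LU_close_def)
qed

lemma det_lower_unitriangular:
  assumes "lower_unitriangular m L"
  shows "det L = 1"
proof -
  have "det L = prod_list (diag_mat L)"
    by (rule det_lower_triangular[of m]) (use assms in \<open>auto simp: lower_unitriangular_def\<close>)
  also have "\<dots> = 1"
    using assms by (auto simp: diag_mat_def lower_unitriangular_def prod.list_conv_set_nth)
  finally show ?thesis .
qed

text \<open>The approximations converge, so their determinants converge to \<open>det g\<close>,
  which is not zero. Discarding an initial segment of the sequence therefore makes every upper
  triangular factor invertible.\<close>

lemma big_cell_dense:
  assumes g: "g \<in> carrier (GL m)"
  obtains L R where "\<And>n. lower_unitriangular m (L n)" "\<And>n. upper_triangular (R n)" "\<And>n. R n \<in> carrier (GL m)"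
    "mat_conv m (\<lambda>n. L n * R n) g"
proof -
  have gc: "g \<in> carrier_mat m m" using g by (rule GL_carrier_mat)
  have "\<exists>L R. LU_close m (inverse (real (Suc n))) (\<lambda>i j. g $$ (i, j)) L R" for n
    by (rule LU_approx) simp
  then obtain L R where "\<And>n. LU_close m (inverse (real (Suc n))) (\<lambda>i j. g $$ (i, j)) (L n) (R n)"
    by metis
  note LR = LU_closeD[OF this]
  define L' where "L' n = mat m m (\<lambda>(i, j). L n i j)" for n
  define R' where "R' n = mat m m (\<lambda>(i, j). R n i j)" for n
  have L': "lower_unitriangular m (L' n)" for n using LR(1,2) by (auto simp: lower_unitriangular_def L'_def)
  have R': "upper_triangular (R' n)" for n using LR(3) by (auto simp: upper_triangular_def R'_def)
  have c: "L' n \<in> carrier_mat m m" "R' n \<in> carrier_mat m m" for n by (auto simp: L'_def R'_def)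
  have conv: "mat_conv m (\<lambda>n. L' n * R' n) g"
    unfolding mat_conv_def
  proof (intro conjI allI impI)
    fix i j assume ij: "i < m" "j < m"
    have "(\<lambda>n. (L' n * R' n) $$ (i, j) - g $$ (i, j)) \<longlonglongrightarrow> 0"
    proof (rule tendsto_0_le[where K = 1, OF LIMSEQ_inverse_real_of_nat])
      have "(L' n * R' n) $$ (i, j) = (\<Sum>k<m. L n i k * R n k j)" for n
        using ij by (subst mult_mat_nth[OF c]) (auto simp: L'_def R'_def)
      thus "\<forall>\<^sub>F n in sequentially. norm ((L' n * R' n) $$ (i, j) - g $$ (i, j)) \<le> norm (inverse (real (Suc n))) * 1"
        using LR(4)[OF ij] by (intro always_eventually allI) (simp add: less_imp_le)
    qed
    thus "(\<lambda>n. (L' n * R' n) $$ (i, j)) \<longlonglongrightarrow> g $$ (i, j)" by (rule LIM_zero_cancel)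
  qed (use c gc in \<open>auto intro: mult_carrier_mat\<close>)
  have "\<forall>\<^sub>F n in sequentially. det (L' n * R' n) \<noteq> 0"
    using tendsto_imp_eventually_ne[OF mat_conv_det[OF conv]] g by (simp add: carrier_GL)
  then obtain N where N: "\<And>n. n \<ge> N \<Longrightarrow> det (L' n * R' n) \<noteq> 0" by (auto simp: eventually_sequentially)
  have "det (R' (n + N)) \<noteq> 0" for n
    using N[of "n + N"] det_mult[OF c(1) c(2), of "n + N" "n + N"] by auto
  hence "R' (n + N) \<in> carrier (GL m)" for n using c by (simp add: carrier_GL)
  moreover have "mat_conv m (\<lambda>n. L' (n + N) * R' (n + N)) g"
    using conv LIMSEQ_ignore_initial_segment unfolding mat_conv_def by blast
  ultimately show ?thesis using that[of "\<lambda>n. L' (n + N)" "\<lambda>n. R' (n + N)"] L' R' by blast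
qed

section \<open>Uniqueness of irreducible representations with a given highest weight\<close>

text \<open>For \<open>i > j\<close> the diagonal entries \<open>i\<close> and \<open>j\<close> have
  ratio \<open>1 / (n + 1) ^ (i - j)\<close>, so conjugation by these torus elements contracts every
  lower unitriangular matrix to the identity as \<open>n\<close> grows.\<close>

definition tau :: "nat \<Rightarrow> nat \<Rightarrow> complex mat" where
  "tau m n = mat m m (\<lambda>(i, j). if i = j then of_nat (Suc n) ^ (m - 1 - i) else 0)"

lemma tau_GL: "tau m n \<in> carrier (GL m)" and tau_upper: "upper_triangular (tau m n)"
proof -
  show u: "upper_triangular (tau m n)" by (auto simp: tau_def upper_triangular_def)
  have "det (tau m n) = (\<Prod>i<m. tau m n $$ (i, i))"
    by (rule upper_triangular_det[OF _ u]) (simp add: tau_def)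
  also have "\<dots> \<noteq> 0" using of_nat_neq_0[where 'a = complex, of n] by (auto simp: tau_def simp del: of_nat_Suc)
  finally show "tau m n \<in> carrier (GL m)" by (simp add: carrier_GL tau_def)
qed

text \<open>\<open>C n\<close> is the conjugate of \<open>L\<close> by \<open>tau m n\<close>, given
  by its entries; moving \<open>tau\<close> past \<open>L\<close> takes the place of an explicit
  inverse.\<close>

lemma tau_contracts:
  assumes L: "lower_unitriangular m L"
  obtains C where "\<And>n. C n \<in> carrier (GL m)" "\<And>n. tau m n * L = C n * tau m n" "mat_conv m C (1\<^sub>m m)"
proof -
  define C where "C n = mat m m (\<lambda>(i, j). if i < j then 0 else L $$ (i, j) * (inverse (of_nat (Suc n))) ^ (i - j))" for n
  have Lc: "L \<in> carrier_mat m m" and L1: "\<And>i. i < m \<Longrightarrow> L $$ (i, i) = 1"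
    and L0: "\<And>i j. i < m \<Longrightarrow> j < m \<Longrightarrow> i < j \<Longrightarrow> L $$ (i, j) = 0"
    using L by (auto simp: lower_unitriangular_def)
  have Cc: "C n \<in> carrier_mat m m" for n by (simp add: C_def)
  have Cl: "lower_unitriangular m (C n)" for n
    using L1 by (auto simp: lower_unitriangular_def C_def)
  have Tc: "tau m n \<in> carrier_mat m m" for n by (simp add: tau_def)
  have 1: "tau m n * L = C n * tau m n" for n
  proof (rule eq_matI)
    fix i j assume "i < dim_row (C n * tau m n)" "j < dim_col (C n * tau m n)"
    hence ij: "i < m" "j < m" using Cc[of n] Tc[of n] by auto
    let ?s = "of_nat (Suc n) :: complex"
    have s: "?s \<noteq> 0" by (rule of_nat_neq_0)
    have "(tau m n * L) $$ (i, j) = (\<Sum>k<m. if k = i then ?s ^ (m - 1 - i) * L $$ (i, j) else 0)"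
      unfolding mult_mat_nth[OF Tc Lc ij] using ij by (intro sum.cong) (auto simp: tau_def)
    hence a: "(tau m n * L) $$ (i, j) = ?s ^ (m - 1 - i) * L $$ (i, j)" using ij by simp
    have "(C n * tau m n) $$ (i, j) = (\<Sum>k<m. if k = j then C n $$ (i, j) * ?s ^ (m - 1 - j) else 0)"
      unfolding mult_mat_nth[OF Cc Tc ij] using ij by (intro sum.cong) (auto simp: tau_def)
    hence b: "(C n * tau m n) $$ (i, j) = C n $$ (i, j) * ?s ^ (m - 1 - j)" using ij by simp
    show "(tau m n * L) $$ (i, j) = (C n * tau m n) $$ (i, j)"
    proof (cases "i < j")
      case True
      thus ?thesis using ij a b L0 by (simp add: C_def)
    next
      case False
      hence "m - 1 - j = (i - j) + (m - 1 - i)" using ij by simp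
      hence "?s ^ (m - 1 - j) = ?s ^ (i - j) * ?s ^ (m - 1 - i)" by (simp add: power_add)
      moreover have "inverse ?s ^ (i - j) * ?s ^ (i - j) = 1"
        using s by (simp add: power_mult_distrib[symmetric] del: of_nat_Suc)
      ultimately show ?thesis using False ij a b by (simp add: C_def ac_simps del: of_nat_Suc)
    qed
  qed (use Cc[of n] Tc[of n] Lc in auto)
  have "mat_conv m C (1\<^sub>m m)"
    unfolding mat_conv_def
  proof (intro conjI allI impI)
    fix i j assume ij: "i < m" "j < m"
    show "(\<lambda>n. C n $$ (i, j)) \<longlonglongrightarrow> 1\<^sub>m m $$ (i, j)"
    proof (cases "j < i")
      case True
      have "(\<lambda>n. inverse (of_nat (Suc n)) :: complex) \<longlonglongrightarrow> 0"
        by (rule LIMSEQ_Suc[OF lim_inverse_n])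
      hence "(\<lambda>n. L $$ (i, j) * (inverse (of_nat (Suc n))) ^ (i - j)) \<longlonglongrightarrow> L $$ (i, j) * 0 ^ (i - j)"
        by (intro tendsto_mult tendsto_power tendsto_const)
      moreover have "(0 :: complex) ^ (i - j) = 0" using True by simp
      ultimately show ?thesis using ij True by (simp add: C_def)
    next
      case False
      thus ?thesis using ij L1 by (cases "i = j") (auto simp: C_def)
    qed
  qed (auto simp: Cc)
  moreover have "C n \<in> carrier (GL m)" for n
    using det_lower_unitriangular[OF Cl[of n]] Cc by (simp add: carrier_GL)
  ultimately show ?thesis using that 1 by blast
qed

lemma highest_weight_vectorD:
  assumes "highest_weight_vector m (d, \<rho>) \<mu> v"
  shows "v \<in> carrier_vec d" "v \<noteq> 0\<^sub>v d"
    "\<And>b. b \<in> carrier (GL m) \<Longrightarrow> upper_triangular b \<Longrightarrow> \<rho> b *\<^sub>v v = torus_char m \<mu> b \<cdot>\<^sub>v v"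
  using assms by (auto simp: highest_weight_vector_def torus_char_def)

text \<open>\<open>R\<close> acts on \<open>v\<close> by a scalar, and moving \<open>tau\<close>
  past \<open>L\<close> leaves a factor \<open>C n\<close> tending to 1. So the normalised torus
  action converges on the orbit of the big cell, to a multiple of \<open>v\<close> whose scalar
  depends on \<open>R\<close> and \<open>\<mu>\<close> but not on the representation.\<close>

lemma big_cell_limit:
  assumes rep: "rational_rep m (d, \<rho>)" and hw: "highest_weight_vector m (d, \<rho>) \<mu> v"
    and L: "lower_unitriangular m L" and R: "R \<in> carrier (GL m)" "upper_triangular R" and i: "i < d"
  shows "(\<lambda>n. inverse (torus_char m \<mu> (tau m n)) * (\<rho> (tau m n) *\<^sub>v (\<rho> (L * R) *\<^sub>v v)) $ i)
    \<longlonglongrightarrow> torus_char m \<mu> R * v $ i"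
proof -
  obtain C where C: "\<And>n. C n \<in> carrier (GL m)" "\<And>n. tau m n * L = C n * tau m n" "mat_conv m C (1\<^sub>m m)"
    using tau_contracts[OF L] by metis
  note v = highest_weight_vectorD[OF hw]
  note rc = rational_rep_carrier[OF rep]
  have Lg: "L \<in> carrier (GL m)"
    using L det_lower_unitriangular[OF L] by (simp add: carrier_GL lower_unitriangular_def)
  have "\<rho> (tau m n) *\<^sub>v (\<rho> (L * R) *\<^sub>v v) = (torus_char m \<mu> R * torus_char m \<mu> (tau m n)) \<cdot>\<^sub>v (\<rho> (C n) *\<^sub>v v)" for n
  proof -
    have "\<rho> (tau m n) *\<^sub>v (\<rho> (L * R) *\<^sub>v v) = \<rho> (tau m n) *\<^sub>v (\<rho> L *\<^sub>v (\<rho> R *\<^sub>v v))"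
      using rational_rep_mult[OF rep Lg R(1)] rc[OF Lg] rc[OF R(1)] v(1) by simp
    also have "\<dots> = torus_char m \<mu> R \<cdot>\<^sub>v (\<rho> (tau m n) *\<^sub>v (\<rho> L *\<^sub>v v))"
      using v(1) v(3)[OF R] rc[OF Lg] rc[OF tau_GL[of m n]]
      by (simp add: mult_mat_vec[of _ d d])
    also have "\<rho> (tau m n) *\<^sub>v (\<rho> L *\<^sub>v v) = \<rho> (tau m n * L) *\<^sub>v v"
      using rational_rep_mult[OF rep tau_GL[of m n] Lg] rc[OF Lg] rc[OF tau_GL[of m n]] v(1) by simp
    also have "\<dots> = \<rho> (C n) *\<^sub>v (\<rho> (tau m n) *\<^sub>v v)"
      using rational_rep_mult[OF rep C(1) tau_GL, of n n] rc[OF C(1)[of n]] rc[OF tau_GL[of m n]] v(1) C(2)[of n] by simp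
    also have "\<dots> = torus_char m \<mu> (tau m n) \<cdot>\<^sub>v (\<rho> (C n) *\<^sub>v v)"
      using v(1) v(3)[OF tau_GL tau_upper] rc[OF C(1)[of n]] by (simp add: mult_mat_vec[of _ d d])
    finally show ?thesis by (simp add: smult_smult_assoc)
  qed
  hence "inverse (torus_char m \<mu> (tau m n)) * (\<rho> (tau m n) *\<^sub>v (\<rho> (L * R) *\<^sub>v v)) $ i
      = torus_char m \<mu> R * (\<rho> (C n) *\<^sub>v v) $ i" for n
    using torus_char_nonzero[OF tau_GL tau_upper] rc[OF C(1)[of n]] i by simp
  moreover have "(\<lambda>n. torus_char m \<mu> R * (\<rho> (C n) *\<^sub>v v) $ i) \<longlonglongrightarrow> torus_char m \<mu> R * (\<rho> (1\<^sub>m m) *\<^sub>v v) $ i"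
    by (intro tendsto_mult tendsto_const rational_rep_continuous_vec[OF rep C(3) C(1) one_in_GL v(1) i])
  ultimately show ?thesis using rational_rep_one[OF rep] v(1) by simp
qed

text \<open>A vector outside a subspace of a finite-dimensional space is separated from it by a
  linear functional, found by eliminating the last coordinate. Functionals are continuous, so this
  later shows that limits of sequences stay in a subspace.\<close>

lemma separating_functional:
  fixes X :: "(nat \<Rightarrow> complex) set"
  assumes "x0 \<in> X" and lin: "\<And>x y a b. x \<in> X \<Longrightarrow> y \<in> X \<Longrightarrow> (\<lambda>i. a * x i + b * y i) \<in> X"
    and "\<And>x. x \<in> X \<Longrightarrow> \<exists>i<D. x i \<noteq> z i"
  shows "\<exists>\<psi>. (\<forall>x\<in>X. (\<Sum>i<D. \<psi> i * x i) = 0) \<and> (\<Sum>i<D. \<psi> i * z i) \<noteq> 0"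
  using assms
proof (induction D arbitrary: X x0 z)
  case 0
  thus ?case by auto
next
  case (Suc D)
  note lin = Suc.prems(2)
  show ?case
  proof (cases "\<exists>y\<in>X. y D \<noteq> 0")
    case True
    then obtain y where y: "y \<in> X" "y D \<noteq> 0" by blast
    \<comment> \<open>Subtracting a multiple of \<open>y\<close> clears the last coordinate of
      \<open>z\<close>.\<close>
    define z' where "z' i = z i - z D / y D * y i" for i
    define X' where "X' = {x \<in> X. x D = 0}"
    have "\<exists>\<psi>. (\<forall>x\<in>X'. (\<Sum>i<D. \<psi> i * x i) = 0) \<and> (\<Sum>i<D. \<psi> i * z' i) \<noteq> 0"
    proof (rule Suc.IH)
      show "(\<lambda>i. 0 * y i + 0 * y i) \<in> X'" using lin[OF y(1) y(1), of 0 0] by (simp add: X'_def)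
      show "(\<lambda>i. a * x i + b * w i) \<in> X'" if "x \<in> X'" "w \<in> X'" for x w a b
        using lin that by (simp add: X'_def)
      show "\<exists>i<D. x i \<noteq> z' i" if x: "x \<in> X'" for x
      proof (rule ccontr)
        assume "\<not> ?thesis"
        moreover have "x D = z' D" using x y by (simp add: X'_def z'_def)
        ultimately have eq: "x i = z' i" if "i < Suc D" for i using that less_antisym by blast
        have "(\<lambda>i. 1 * x i + z D / y D * y i) \<in> X" by (rule lin) (use x y in \<open>auto simp: X'_def\<close>)
        from Suc.prems(3)[OF this] eq show False by (auto simp: z'_def)
      qed
    qed
    then obtain \<psi> where \<psi>: "\<And>x. x \<in> X' \<Longrightarrow> (\<Sum>i<D. \<psi> i * x i) = 0" "(\<Sum>i<D. \<psi> i * z' i) \<noteq> 0" by blast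
    \<comment> \<open>Chosen so that \<open>\<phi>\<close> vanishes on \<open>y\<close>.\<close>
    define c where "c = - (\<Sum>i<D. \<psi> i * y i) / y D"
    define \<phi> where "\<phi> = \<psi>(D := c)"
    have \<phi>: "(\<Sum>i<Suc D. \<phi> i * x i) = (\<Sum>i<D. \<psi> i * (x i - x D / y D * y i))" for x
    proof -
      have "(\<Sum>i<D. \<psi> i * (x i - x D / y D * y i)) = (\<Sum>i<D. \<psi> i * x i) - x D / y D * (\<Sum>i<D. \<psi> i * y i)"
        by (simp add: algebra_simps sum_subtractf sum_distrib_left)
      thus ?thesis by (simp add: \<phi>_def c_def)
    qed
    have "(\<Sum>i<Suc D. \<phi> i * x i) = 0" if x: "x \<in> X" for x
    proof -
      have "(\<lambda>i. 1 * x i + (- x D / y D) * y i) \<in> X'"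
        using lin[OF x y(1), of 1 "- x D / y D"] y by (simp add: X'_def)
      from \<psi>(1)[OF this] show ?thesis unfolding \<phi> by simp
    qed
    moreover have "(\<Sum>i<Suc D. \<phi> i * z i) \<noteq> 0" using \<psi>(2) unfolding \<phi> z'_def .
    ultimately show ?thesis by blast
  next
    case False
    show ?thesis
    proof (cases "z D = 0")
      case True
      have "\<exists>\<psi>. (\<forall>x\<in>X. (\<Sum>i<D. \<psi> i * x i) = 0) \<and> (\<Sum>i<D. \<psi> i * z i) \<noteq> 0"
        by (rule Suc.IH[OF Suc.prems(1) lin]) (use Suc.prems(3) False True less_antisym in metis)+
      then obtain \<psi> where "\<forall>x\<in>X. (\<Sum>i<D. \<psi> i * x i) = 0" "(\<Sum>i<D. \<psi> i * z i) \<noteq> 0" by blast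
      thus ?thesis using True False by (intro exI[of _ \<psi>]) auto
    next
      case zD: False
      show ?thesis by (rule exI[of _ "\<lambda>i. if i = D then 1 else 0"]) (use False zD in auto)
    qed
  qed
qed


text \<open>The linear span of the orbit of \<open>(v, v')\<close> in the direct sum of two
  representations. For irreducible representations with highest weight vectors of the same weight it
  turns out to be the graph of an isomorphism.\<close>

inductive_set orbit_graph ::
  "nat \<Rightarrow> (complex mat \<Rightarrow> complex mat) \<Rightarrow> complex vec \<Rightarrow> (complex mat \<Rightarrow> complex mat) \<Rightarrow> complex vec \<Rightarrow> (complex vec \<times> complex vec) set"
  for m \<rho> v \<rho>' v' where
  orbit: "g \<in> carrier (GL m) \<Longrightarrow> (\<rho> g *\<^sub>v v, \<rho>' g *\<^sub>v v') \<in> orbit_graph m \<rho> v \<rho>' v'"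
| comb: "(x, x') \<in> orbit_graph m \<rho> v \<rho>' v' \<Longrightarrow> (y, y') \<in> orbit_graph m \<rho> v \<rho>' v' \<Longrightarrow>
    (a \<cdot>\<^sub>v x + b \<cdot>\<^sub>v y, a \<cdot>\<^sub>v x' + b \<cdot>\<^sub>v y') \<in> orbit_graph m \<rho> v \<rho>' v'"

lemma orbit_graph_swap: "(x, x') \<in> orbit_graph m \<rho> v \<rho>' v' \<Longrightarrow> (x', x) \<in> orbit_graph m \<rho>' v' \<rho> v"
  by (induction rule: orbit_graph.induct) (auto intro: orbit_graph.intros)

lemma irreducible_repD:
  assumes "irreducible_rep m (d, \<rho>)"
    and "W \<subseteq> carrier_vec d" "0\<^sub>v d \<in> W" "\<And>x y. x \<in> W \<Longrightarrow> y \<in> W \<Longrightarrow> x + y \<in> W" "\<And>a x. x \<in> W \<Longrightarrow> a \<cdot>\<^sub>v x \<in> W"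
    and "\<And>g w. g \<in> carrier (GL m) \<Longrightarrow> w \<in> W \<Longrightarrow> \<rho> g *\<^sub>v w \<in> W"
  shows "W = {0\<^sub>v d} \<or> W = carrier_vec d"
proof -
  have "vectorspace class_ring (module_vec TYPE(complex) d)" by (rule vec_vs)
  moreover have "submodule class_ring W (module_vec TYPE(complex) d)"
    by (rule submodule.intro[OF vec_module]) (use assms(2-5) in \<open>auto simp: module_vec_simps class_ring_simps\<close>)
  ultimately have "VectorSpace.subspace class_ring W (module_vec TYPE(complex) d)"
    by (simp add: VectorSpace.subspace_def)
  thus ?thesis using assms(1,6) by (auto simp: irreducible_rep_def)
qed

context
  fixes m d d' :: nat and \<rho> \<rho>' :: "complex mat \<Rightarrow> complex mat" and \<mu> :: "int list" and v v' :: "complex vec"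
  assumes rep: "rational_rep m (d, \<rho>)" and rep': "rational_rep m (d', \<rho>')"
    and irr: "irreducible_rep m (d, \<rho>)" and irr': "irreducible_rep m (d', \<rho>')"
    and hw: "highest_weight_vector m (d, \<rho>) \<mu> v" and hw': "highest_weight_vector m (d', \<rho>') \<mu> v'"
begin

abbreviation "Gr \<equiv> orbit_graph m \<rho> v \<rho>' v'"

lemma orbit_graph_carrier: "(x, x') \<in> Gr \<Longrightarrow> x \<in> carrier_vec d \<and> x' \<in> carrier_vec d'"
proof (induction rule: orbit_graph.induct)
  case (orbit g)
  thus ?case using rational_rep_carrier[OF rep orbit] rational_rep_carrier[OF rep' orbit]
    highest_weight_vectorD(1)[OF hw] highest_weight_vectorD(1)[OF hw'] by auto
qed auto

lemma orbit_graph_stable: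
  assumes h: "h \<in> carrier (GL m)"
  shows "(x, x') \<in> Gr \<Longrightarrow> (\<rho> h *\<^sub>v x, \<rho>' h *\<^sub>v x') \<in> Gr"
proof (induction rule: orbit_graph.induct)
  case (orbit g)
  have "\<rho> h *\<^sub>v (\<rho> g *\<^sub>v v) = \<rho> (h * g) *\<^sub>v v" "\<rho>' h *\<^sub>v (\<rho>' g *\<^sub>v v') = \<rho>' (h * g) *\<^sub>v v'"
    using rational_rep_mult[OF rep h orbit] rational_rep_mult[OF rep' h orbit]
      rational_rep_carrier[OF rep h] rational_rep_carrier[OF rep' h]
      rational_rep_carrier[OF rep orbit] rational_rep_carrier[OF rep' orbit]
      highest_weight_vectorD(1)[OF hw] highest_weight_vectorD(1)[OF hw'] by simp_all
  thus ?case using orbit_graph.orbit[OF GL_closed[OF h orbit], of \<rho> v \<rho>' v'] by simp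
next
  case (comb x x' y y' a b)
  have c: "x \<in> carrier_vec d" "y \<in> carrier_vec d" "x' \<in> carrier_vec d'" "y' \<in> carrier_vec d'"
    using orbit_graph_carrier comb.hyps by auto
  note r = rational_rep_carrier[OF rep h] rational_rep_carrier[OF rep' h]
  have "\<rho> h *\<^sub>v (a \<cdot>\<^sub>v x + b \<cdot>\<^sub>v y) = a \<cdot>\<^sub>v (\<rho> h *\<^sub>v x) + b \<cdot>\<^sub>v (\<rho> h *\<^sub>v y)"
    "\<rho>' h *\<^sub>v (a \<cdot>\<^sub>v x' + b \<cdot>\<^sub>v y') = a \<cdot>\<^sub>v (\<rho>' h *\<^sub>v x') + b \<cdot>\<^sub>v (\<rho>' h *\<^sub>v y')"
    using c r by (simp_all add: mult_add_distrib_mat_vec[OF r(1)] mult_add_distrib_mat_vec[OF r(2)]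
      mult_mat_vec[OF r(1)] mult_mat_vec[OF r(2)])
  thus ?case using orbit_graph.comb[OF comb.IH, of a b] by simp
qed

lemma orbit_graph_start: "(v, v') \<in> Gr"
proof -
  have "(\<rho> (1\<^sub>m m) *\<^sub>v v, \<rho>' (1\<^sub>m m) *\<^sub>v v') \<in> Gr" by (rule orbit_graph.orbit) simp
  thus ?thesis using rational_rep_one[OF rep] rational_rep_one[OF rep']
    highest_weight_vectorD(1)[OF hw] highest_weight_vectorD(1)[OF hw'] by simp
qed

text \<open>One scalar \<open>c\<close> serves both components. It acts as the coefficient of the
  highest weight vector, and sharing it is what keeps \<open>v'\<close> from being paired with
  zero.\<close>

definition joint_limit :: "complex vec \<Rightarrow> complex vec \<Rightarrow> complex \<Rightarrow> bool" where
  "joint_limit x x' c \<longleftrightarrow> x \<in> carrier_vec d \<and> x' \<in> carrier_vec d' \<and>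
    (\<forall>i<d. (\<lambda>n. inverse (torus_char m \<mu> (tau m n)) * (\<rho> (tau m n) *\<^sub>v x) $ i) \<longlonglongrightarrow> c * v $ i) \<and>
    (\<forall>i<d'. (\<lambda>n. inverse (torus_char m \<mu> (tau m n)) * (\<rho>' (tau m n) *\<^sub>v x') $ i) \<longlonglongrightarrow> c * v' $ i)"

lemma joint_limit_comb:
  assumes "joint_limit x x' c" "joint_limit y y' k"
  shows "joint_limit (a \<cdot>\<^sub>v x + b \<cdot>\<^sub>v y) (a \<cdot>\<^sub>v x' + b \<cdot>\<^sub>v y') (a * c + b * k)"
proof -
  have c: "x \<in> carrier_vec d" "y \<in> carrier_vec d" "x' \<in> carrier_vec d'" "y' \<in> carrier_vec d'"
    using assms by (auto simp: joint_limit_def)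
  note r = rational_rep_carrier[OF rep tau_GL] rational_rep_carrier[OF rep' tau_GL]
  define s where "s n = inverse (torus_char m \<mu> (tau m n))" for n
  have "(\<lambda>n. s n * (\<rho> (tau m n) *\<^sub>v (a \<cdot>\<^sub>v x + b \<cdot>\<^sub>v y)) $ i) \<longlonglongrightarrow> (a * c + b * k) * v $ i" if i: "i < d" for i
  proof -
    have eq: "s n * (\<rho> (tau m n) *\<^sub>v (a \<cdot>\<^sub>v x + b \<cdot>\<^sub>v y)) $ i =
        a * (s n * (\<rho> (tau m n) *\<^sub>v x) $ i) + b * (s n * (\<rho> (tau m n) *\<^sub>v y) $ i)" for n
      using c i r(1)[of n] by (simp add: mult_mat_vec_nth[OF r(1)] algebra_simps sum.distrib sum_distrib_left)
    have "(\<lambda>n. a * (s n * (\<rho> (tau m n) *\<^sub>v x) $ i) + b * (s n * (\<rho> (tau m n) *\<^sub>v y) $ i))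
        \<longlonglongrightarrow> a * (c * v $ i) + b * (k * v $ i)"
      using assms i unfolding joint_limit_def s_def by (intro tendsto_add tendsto_mult_left) blast+
    thus ?thesis unfolding eq by (simp add: algebra_simps)
  qed
  moreover have "(\<lambda>n. s n * (\<rho>' (tau m n) *\<^sub>v (a \<cdot>\<^sub>v x' + b \<cdot>\<^sub>v y')) $ i) \<longlonglongrightarrow> (a * c + b * k) * v' $ i" if i: "i < d'" for i
  proof -
    have eq: "s n * (\<rho>' (tau m n) *\<^sub>v (a \<cdot>\<^sub>v x' + b \<cdot>\<^sub>v y')) $ i =
        a * (s n * (\<rho>' (tau m n) *\<^sub>v x') $ i) + b * (s n * (\<rho>' (tau m n) *\<^sub>v y') $ i)" for n
      using c i r(2)[of n] by (simp add: mult_mat_vec_nth[OF r(2)] algebra_simps sum.distrib sum_distrib_left)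
    have "(\<lambda>n. a * (s n * (\<rho>' (tau m n) *\<^sub>v x') $ i) + b * (s n * (\<rho>' (tau m n) *\<^sub>v y') $ i))
        \<longlonglongrightarrow> a * (c * v' $ i) + b * (k * v' $ i)"
      using assms i unfolding joint_limit_def s_def by (intro tendsto_add tendsto_mult_left) blast+
    thus ?thesis unfolding eq by (simp add: algebra_simps)
  qed
  ultimately show ?thesis using c by (simp add: joint_limit_def s_def)
qed

text \<open>The pairs admitting a joint limit form a subspace, hence a closed set; it contains the orbit
  of the big cell and therefore, by density, the whole orbit.\<close>

lemma orbit_joint_limit:
  assumes g: "g \<in> carrier (GL m)"
  shows "\<exists>c. joint_limit (\<rho> g *\<^sub>v v) (\<rho>' g *\<^sub>v v') c"
proof (rule ccontr)
  assume neg: "\<not> ?thesis"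
  \<comment> \<open>Concatenation of the two components, so that
    \<open>separating_functional\<close> applies to the direct sum.\<close>
  define F where "F x x' = (\<lambda>i. if i < d then x $ i else if i < d + d' then x' $ (i - d) else 0 :: complex)" for x x' :: "complex vec"
  define X where "X = {F x x' | x x'. \<exists>c. joint_limit x x' c}"
  have F_comb: "(\<lambda>i. a * F x x' i + b * F y y' i) = F (a \<cdot>\<^sub>v x + b \<cdot>\<^sub>v y) (a \<cdot>\<^sub>v x' + b \<cdot>\<^sub>v y')"
    if "x \<in> carrier_vec d" "y \<in> carrier_vec d" "x' \<in> carrier_vec d'" "y' \<in> carrier_vec d'" for x x' y y' a b
    using that by (auto simp: F_def fun_eq_iff)
  obtain L R where LR: "\<And>n. lower_unitriangular m (L n)" "\<And>n. upper_triangular (R n)" "\<And>n. R n \<in> carrier (GL m)"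
    and conv: "mat_conv m (\<lambda>n. L n * R n) g"
    using big_cell_dense[OF g] by blast
  have Lg: "L n \<in> carrier (GL m)" for n
    using LR(1)[of n] det_lower_unitriangular[OF LR(1)[of n]] by (simp add: carrier_GL lower_unitriangular_def)
  have LRg: "L n * R n \<in> carrier (GL m)" for n by (rule GL_closed[OF Lg LR(3)])
  note vc = highest_weight_vectorD(1)[OF hw] highest_weight_vectorD(1)[OF hw']
  have gc: "\<rho> h *\<^sub>v v \<in> carrier_vec d" "\<rho>' h *\<^sub>v v' \<in> carrier_vec d'" if "h \<in> carrier (GL m)" for h
    using rational_rep_carrier[OF rep that] rational_rep_carrier[OF rep' that] vc by auto
  have inX: "F (\<rho> (L n * R n) *\<^sub>v v) (\<rho>' (L n * R n) *\<^sub>v v') \<in> X" for n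
    unfolding X_def joint_limit_def
    using gc[OF LRg] big_cell_limit[OF rep hw LR(1) LR(3) LR(2)] big_cell_limit[OF rep' hw' LR(1) LR(3) LR(2)] by blast
  have "\<exists>\<psi>. (\<forall>x\<in>X. (\<Sum>i<d + d'. \<psi> i * x i) = 0) \<and> (\<Sum>i<d + d'. \<psi> i * F (\<rho> g *\<^sub>v v) (\<rho>' g *\<^sub>v v') i) \<noteq> 0"
  proof (rule separating_functional[OF inX])
    fix p q a b assume "p \<in> X" "q \<in> X"
    then obtain x x' c y y' k where *: "p = F x x'" "joint_limit x x' c" "q = F y y'" "joint_limit y y' k"
      by (auto simp: X_def)
    hence "(\<lambda>i. a * p i + b * q i) = F (a \<cdot>\<^sub>v x + b \<cdot>\<^sub>v y) (a \<cdot>\<^sub>v x' + b \<cdot>\<^sub>v y')"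
      by (simp only: *, intro F_comb) (auto simp: joint_limit_def)
    thus "(\<lambda>i. a * p i + b * q i) \<in> X"
      using joint_limit_comb[OF *(2,4), of a b] unfolding X_def by blast
  next
    fix p assume "p \<in> X"
    then obtain x x' c where *: "p = F x x'" "joint_limit x x' c" by (auto simp: X_def)
    show "\<exists>i<d + d'. p i \<noteq> F (\<rho> g *\<^sub>v v) (\<rho>' g *\<^sub>v v') i"
    proof (rule ccontr)
      assume "\<not> ?thesis"
      hence eq: "F x x' i = F (\<rho> g *\<^sub>v v) (\<rho>' g *\<^sub>v v') i" if "i < d + d'" for i using that * by blast
      have c: "x \<in> carrier_vec d" "x' \<in> carrier_vec d'" using *(2) by (auto simp: joint_limit_def)
      have "x = \<rho> g *\<^sub>v v"
      proof (rule eq_vecI)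
        fix i assume "i < dim_vec (\<rho> g *\<^sub>v v)"
        hence "i < d" using gc(1)[OF g] carrier_vecD by metis
        thus "x $ i = (\<rho> g *\<^sub>v v) $ i" using eq[of i] by (simp add: F_def)
      qed (use c(1) gc(1)[OF g] carrier_vecD in metis)
      moreover have "x' = \<rho>' g *\<^sub>v v'"
      proof (rule eq_vecI)
        fix i assume "i < dim_vec (\<rho>' g *\<^sub>v v')"
        hence "i < d'" using gc(2)[OF g] carrier_vecD by metis
        thus "x' $ i = (\<rho>' g *\<^sub>v v') $ i" using eq[of "d + i"] by (simp add: F_def)
      qed (use c(2) gc(2)[OF g] carrier_vecD in metis)
      ultimately show False using neg * by blast
    qed
  qed
  then obtain \<psi> where \<psi>: "\<And>x. x \<in> X \<Longrightarrow> (\<Sum>i<d + d'. \<psi> i * x i) = 0"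
    "(\<Sum>i<d + d'. \<psi> i * F (\<rho> g *\<^sub>v v) (\<rho>' g *\<^sub>v v') i) \<noteq> 0" by blast
  have "(\<lambda>n. F (\<rho> (L n * R n) *\<^sub>v v) (\<rho>' (L n * R n) *\<^sub>v v') i) \<longlonglongrightarrow> F (\<rho> g *\<^sub>v v) (\<rho>' g *\<^sub>v v') i" for i
    using rational_rep_continuous_vec[OF rep conv LRg g vc(1)]
      rational_rep_continuous_vec[OF rep' conv LRg g vc(2)] by (auto simp: F_def)
  hence "(\<lambda>n. \<Sum>i<d + d'. \<psi> i * F (\<rho> (L n * R n) *\<^sub>v v) (\<rho>' (L n * R n) *\<^sub>v v') i)
      \<longlonglongrightarrow> (\<Sum>i<d + d'. \<psi> i * F (\<rho> g *\<^sub>v v) (\<rho>' g *\<^sub>v v') i)"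
    by (intro tendsto_sum tendsto_mult tendsto_const)
  hence "(\<lambda>n. 0) \<longlonglongrightarrow> (\<Sum>i<d + d'. \<psi> i * F (\<rho> g *\<^sub>v v) (\<rho>' g *\<^sub>v v') i)"
    using \<psi>(1)[OF inX] by simp
  hence "(\<Sum>i<d + d'. \<psi> i * F (\<rho> g *\<^sub>v v) (\<rho>' g *\<^sub>v v') i) = 0" by (simp add: LIMSEQ_const_iff)
  thus False using \<psi>(2) by blast
qed

lemma orbit_graph_joint_limit: "(x, x') \<in> Gr \<Longrightarrow> \<exists>c. joint_limit x x' c"
  by (induction rule: orbit_graph.induct) (use orbit_joint_limit joint_limit_comb in blast)+

text \<open>The partners of zero form an invariant subspace of an irreducible representation. It is
  not the whole space: if \<open>v'\<close> were a partner of zero, the joint limit would force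
  \<open>c = 0\<close> in the first component and \<open>c = 1\<close> in the second.\<close>

lemma orbit_graph_zero_imp:
  assumes "(0\<^sub>v d, x') \<in> Gr"
  shows "x' = 0\<^sub>v d'"
proof -
  define W where "W = {x'. (0\<^sub>v d, x') \<in> Gr}"
  have z: "a \<cdot>\<^sub>v 0\<^sub>v d + b \<cdot>\<^sub>v 0\<^sub>v d = (0\<^sub>v d :: complex vec)" for a b by auto
  have Wc: "W \<subseteq> carrier_vec d'" using orbit_graph_carrier by (auto simp: W_def)
  have comb: "a \<cdot>\<^sub>v x + b \<cdot>\<^sub>v y \<in> W" if "x \<in> W" "y \<in> W" for x y a b
    using orbit_graph.comb[of "0\<^sub>v d" x m \<rho> v \<rho>' v' "0\<^sub>v d" y a b] that z by (simp add: W_def)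
  have "W = {0\<^sub>v d'} \<or> W = carrier_vec d'"
  proof (rule irreducible_repD[OF irr' Wc])
    have "0 \<cdot>\<^sub>v x' + 0 \<cdot>\<^sub>v x' \<in> W" by (rule comb) (use assms in \<open>auto simp: W_def\<close>)
    moreover have "x' \<in> carrier_vec d'" using assms orbit_graph_carrier by blast
    moreover from this have "0 \<cdot>\<^sub>v x' + 0 \<cdot>\<^sub>v x' = 0\<^sub>v d'" by (intro eq_vecI) auto
    ultimately show "0\<^sub>v d' \<in> W" by simp
    show "x + y \<in> W" if "x \<in> W" "y \<in> W" for x y
      using comb[OF that, of 1 1] by simp
    show "a \<cdot>\<^sub>v x \<in> W" if "x \<in> W" for x a
    proof -
      have "x \<in> carrier_vec d'" using that Wc by blast
      hence "a \<cdot>\<^sub>v x + 0 \<cdot>\<^sub>v x = a \<cdot>\<^sub>v x" by (intro eq_vecI) auto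
      thus ?thesis using comb[OF that that, of a 0] by simp
    qed
    show "\<rho>' g *\<^sub>v w \<in> W" if "g \<in> carrier (GL m)" "w \<in> W" for g w
    proof -
      have "\<rho> g *\<^sub>v 0\<^sub>v d = 0\<^sub>v d" using mult_mat_vec_zero[OF rational_rep_carrier[OF rep that(1)]] .
      thus ?thesis using orbit_graph_stable[OF that(1), of "0\<^sub>v d" w] that(2) by (simp add: W_def)
    qed
  qed
  moreover have "v' \<notin> W"
  proof
    assume "v' \<in> W"
    then obtain c where c: "joint_limit (0\<^sub>v d) v' c" using orbit_graph_joint_limit by (auto simp: W_def)
    have tz: "\<rho> (tau m n) *\<^sub>v 0\<^sub>v d = 0\<^sub>v d" for n by (rule mult_mat_vec_zero[OF rational_rep_carrier[OF rep tau_GL]])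
    obtain i where i: "i < d" "v $ i \<noteq> 0"
      using highest_weight_vectorD(1,2)[OF hw] by (metis carrier_vecD eq_vecI index_zero_vec)
    have "(\<lambda>n. 0) \<longlonglongrightarrow> c * v $ i" using c i by (simp add: joint_limit_def tz)
    hence c0: "c = 0" using i by (simp add: LIMSEQ_const_iff)
    obtain j where j: "j < d'" "v' $ j \<noteq> 0"
      using highest_weight_vectorD(1,2)[OF hw'] by (metis carrier_vecD eq_vecI index_zero_vec)
    have eq: "inverse (torus_char m \<mu> (tau m n)) * (\<rho>' (tau m n) *\<^sub>v v') $ j = v' $ j" for n
      using highest_weight_vectorD(1,3)[OF hw'] tau_GL[of m n] tau_upper[of m n] j
        torus_char_nonzero[OF tau_GL tau_upper, of m \<mu> n] by simp
    have "(\<lambda>n. inverse (torus_char m \<mu> (tau m n)) * (\<rho>' (tau m n) *\<^sub>v v') $ j) \<longlonglongrightarrow> c * v' $ j"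
      using c j unfolding joint_limit_def by blast
    hence "(\<lambda>n. v' $ j) \<longlonglongrightarrow> c * v' $ j" unfolding eq .
    thus False using c0 j by (simp add: LIMSEQ_const_iff)
  qed
  ultimately have "W = {0\<^sub>v d'}" using highest_weight_vectorD(1)[OF hw'] by blast
  thus ?thesis using assms by (auto simp: W_def)
qed

lemma orbit_graph_unique:
  assumes "(x, y) \<in> Gr" "(x, z) \<in> Gr"
  shows "y = z"
proof -
  have c: "x \<in> carrier_vec d" "y \<in> carrier_vec d'" "z \<in> carrier_vec d'" using assms orbit_graph_carrier by auto
  have "1 \<cdot>\<^sub>v x + (-1) \<cdot>\<^sub>v x = 0\<^sub>v d" using c by auto
  hence "(0\<^sub>v d, 1 \<cdot>\<^sub>v y + (-1) \<cdot>\<^sub>v z) \<in> Gr" using orbit_graph.comb[OF assms, of 1 "-1"] by simp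
  hence 0: "1 \<cdot>\<^sub>v y + (-1) \<cdot>\<^sub>v z = 0\<^sub>v d'" by (rule orbit_graph_zero_imp)
  show ?thesis
  proof (rule eq_vecI)
    fix i assume "i < dim_vec z"
    hence i: "i < d'" using c by simp
    have "(1 \<cdot>\<^sub>v y + (-1) \<cdot>\<^sub>v z) $ i = 0" using 0 i by simp
    thus "y $ i = z $ i" using i c by simp
  qed (use c in auto)
qed

text \<open>The vectors that have a partner form an invariant subspace containing the nonzero
  \<open>v\<close>, so irreducibility makes it everything.\<close>

lemma orbit_graph_total:
  assumes "x \<in> carrier_vec d"
  shows "\<exists>x'. (x, x') \<in> Gr"
proof -
  define W where "W = {x. \<exists>x'. (x, x') \<in> Gr}"
  have Wc: "W \<subseteq> carrier_vec d" using orbit_graph_carrier by (auto simp: W_def)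
  have comb: "a \<cdot>\<^sub>v x + b \<cdot>\<^sub>v y \<in> W" if "x \<in> W" "y \<in> W" for x y a b
    using orbit_graph.comb that unfolding W_def by blast
  have v: "v \<in> W" using orbit_graph_start by (auto simp: W_def)
  have "W = {0\<^sub>v d} \<or> W = carrier_vec d"
  proof (rule irreducible_repD[OF irr Wc])
    have "0 \<cdot>\<^sub>v v + 0 \<cdot>\<^sub>v v = 0\<^sub>v d" using highest_weight_vectorD(1)[OF hw] by (intro eq_vecI) auto
    thus "0\<^sub>v d \<in> W" using comb[OF v v, of 0 0] by simp
    show "x + y \<in> W" if "x \<in> W" "y \<in> W" for x y
      using comb[OF that, of 1 1] by simp
    show "a \<cdot>\<^sub>v x \<in> W" if "x \<in> W" for x a
    proof -
      have "x \<in> carrier_vec d" using that Wc by blast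
      hence "a \<cdot>\<^sub>v x + 0 \<cdot>\<^sub>v x = a \<cdot>\<^sub>v x" by (intro eq_vecI) auto
      thus ?thesis using comb[OF that that, of a 0] by simp
    qed
    show "\<rho> g *\<^sub>v w \<in> W" if "g \<in> carrier (GL m)" "w \<in> W" for g w
      using orbit_graph_stable[OF that(1)] that(2) unfolding W_def by blast
  qed
  thus ?thesis using v highest_weight_vectorD(2)[OF hw] assms by (auto simp: W_def)
qed

lemma orbit_graph_matrix:
  "\<exists>P\<in>carrier_mat d' d. \<forall>x\<in>carrier_vec d. (x, P *\<^sub>v x) \<in> Gr"
proof -
  have "\<forall>j. \<exists>x'. (unit_vec d j, x') \<in> Gr" using orbit_graph_total by auto
  then obtain f where f: "\<And>j. (unit_vec d j, f j) \<in> Gr" by metis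
  define P where "P = mat d' d (\<lambda>(i, j). f j $ i)"
  have Pc: "P \<in> carrier_mat d' d" by (simp add: P_def)
  have fc: "f j \<in> carrier_vec d'" for j using orbit_graph_carrier f by blast
  have "(x, P *\<^sub>v x) \<in> Gr" if x: "x \<in> carrier_vec d" for x
  proof -
    have "(vec d (\<lambda>i. if i < k then x $ i else 0), vec d' (\<lambda>i. \<Sum>j<k. f j $ i * x $ j)) \<in> Gr" if "k \<le> d" for k
      using that
    proof (induction k)
      case 0
      have "0 \<cdot>\<^sub>v v + 0 \<cdot>\<^sub>v v = vec d (\<lambda>i. 0)" "0 \<cdot>\<^sub>v v' + 0 \<cdot>\<^sub>v v' = vec d' (\<lambda>i. 0)"
        using highest_weight_vectorD(1)[OF hw] highest_weight_vectorD(1)[OF hw'] by auto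
      thus ?case using orbit_graph.comb[OF orbit_graph_start orbit_graph_start, of 0 0] by simp
    next
      case (Suc k)
      have "1 \<cdot>\<^sub>v vec d (\<lambda>i. if i < k then x $ i else 0) + x $ k \<cdot>\<^sub>v unit_vec d k
          = vec d (\<lambda>i. if i < Suc k then x $ i else 0)"
        by (rule eq_vecI) (auto simp: unit_vec_def less_Suc_eq)
      moreover have "1 \<cdot>\<^sub>v vec d' (\<lambda>i. \<Sum>j<k. f j $ i * x $ j) + x $ k \<cdot>\<^sub>v f k = vec d' (\<lambda>i. \<Sum>j<Suc k. f j $ i * x $ j)"
        by (rule eq_vecI) (use fc[of k] in auto)
      moreover have "(vec d (\<lambda>i. if i < k then x $ i else 0), vec d' (\<lambda>i. \<Sum>j<k. f j $ i * x $ j)) \<in> Gr"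
        using Suc by simp
      ultimately show ?case using orbit_graph.comb[OF _ f[of k],
        of "vec d (\<lambda>i. if i < k then x $ i else 0)" "vec d' (\<lambda>i. \<Sum>j<k. f j $ i * x $ j)" 1 "x $ k"] by simp
    qed
    from this[of d] have "(vec d (\<lambda>i. if i < d then x $ i else 0), vec d' (\<lambda>i. \<Sum>j<d. f j $ i * x $ j)) \<in> Gr" by simp
    moreover have "vec d (\<lambda>i. if i < d then x $ i else 0) = x" using x by auto
    moreover have "vec d' (\<lambda>i. \<Sum>j<d. f j $ i * x $ j) = P *\<^sub>v x"
    proof (rule eq_vecI)
      fix i assume "i < dim_vec (P *\<^sub>v x)"
      hence i: "i < d'" using Pc by simp
      show "vec d' (\<lambda>i. \<Sum>j<d. f j $ i * x $ j) $ i = (P *\<^sub>v x) $ i"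
        unfolding mult_mat_vec_nth[OF Pc x i] using i by (simp add: P_def)
    qed (use Pc in auto)
    ultimately show ?thesis by simp
  qed
  thus ?thesis using Pc by blast
qed

end

text \<open>The graphs built in the two directions are swaps of each other, so the matrices they
  define are mutually inverse; stability of the graph under the group is the intertwining
  property.\<close>

theorem irreducible_rep_unique:
  assumes rep: "rational_rep m (d, \<rho>)" and rep': "rational_rep m (d', \<rho>')"
    and irr: "irreducible_rep m (d, \<rho>)" and irr': "irreducible_rep m (d', \<rho>')"
    and hw: "highest_weight_vector m (d, \<rho>) \<mu> v" and hw': "highest_weight_vector m (d', \<rho>') \<mu> v'"
  obtains P Q where "P \<in> carrier_mat d' d" "Q \<in> carrier_mat d d'" "P * Q = 1\<^sub>m d'" "Q * P = 1\<^sub>m d"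
    "\<And>g. g \<in> carrier (GL m) \<Longrightarrow> P * \<rho> g = \<rho>' g * P"
proof -
  note A = rep rep' irr irr' hw hw' and A' = rep' rep irr' irr hw' hw
  obtain P where P: "P \<in> carrier_mat d' d" "\<And>x. x \<in> carrier_vec d \<Longrightarrow> (x, P *\<^sub>v x) \<in> orbit_graph m \<rho> v \<rho>' v'"
    using orbit_graph_matrix[OF A] by blast
  obtain Q where Q: "Q \<in> carrier_mat d d'" "\<And>x. x \<in> carrier_vec d' \<Longrightarrow> (x, Q *\<^sub>v x) \<in> orbit_graph m \<rho>' v' \<rho> v"
    using orbit_graph_matrix[OF A'] by blast
  have "P * Q = 1\<^sub>m d'"
  proof (rule eq_mat_on_vecs)
    fix y :: "complex vec" assume y: "y \<in> carrier_vec d'"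
    hence Qy: "Q *\<^sub>v y \<in> carrier_vec d" using Q(1) by auto
    have "P *\<^sub>v (Q *\<^sub>v y) = y"
      by (rule orbit_graph_unique[OF A P(2)[OF Qy] orbit_graph_swap[OF Q(2)[OF y]]])
    thus "(P * Q) *\<^sub>v y = 1\<^sub>m d' *\<^sub>v y" using P(1) Q(1) y by simp
  qed (use P(1) Q(1) in auto)
  moreover have "Q * P = 1\<^sub>m d"
  proof (rule eq_mat_on_vecs)
    fix y :: "complex vec" assume y: "y \<in> carrier_vec d"
    hence Py: "P *\<^sub>v y \<in> carrier_vec d'" using P(1) by auto
    have "Q *\<^sub>v (P *\<^sub>v y) = y"
      by (rule orbit_graph_unique[OF A' Q(2)[OF Py] orbit_graph_swap[OF P(2)[OF y]]])
    thus "(Q * P) *\<^sub>v y = 1\<^sub>m d *\<^sub>v y" using P(1) Q(1) y by simp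
  qed (use P(1) Q(1) in auto)
  moreover have "P * \<rho> g = \<rho>' g * P" if g: "g \<in> carrier (GL m)" for g
  proof (rule eq_mat_on_vecs)
    note r = rational_rep_carrier[OF rep g] rational_rep_carrier[OF rep' g]
    show "P * \<rho> g \<in> carrier_mat d' d" "\<rho>' g * P \<in> carrier_mat d' d" using P(1) r by auto
    fix x :: "complex vec" assume x: "x \<in> carrier_vec d"
    hence gx: "\<rho> g *\<^sub>v x \<in> carrier_vec d" using r by auto
    have "P *\<^sub>v (\<rho> g *\<^sub>v x) = \<rho>' g *\<^sub>v (P *\<^sub>v x)"
      by (rule orbit_graph_unique[OF A P(2)[OF gx] orbit_graph_stable[OF A g P(2)[OF x]]])
    thus "(P * \<rho> g) *\<^sub>v x = (\<rho>' g * P) *\<^sub>v x" using P(1) r x by simp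
  qed
  ultimately show ?thesis using that P(1) Q(1) by blast
qed

section \<open>Tensor powers as functions on words\<close>

definition words :: "nat \<Rightarrow> nat \<Rightarrow> nat list set" where
  "words m K = {x. length x = K \<and> set x \<subseteq> {..<m}}"

text \<open>Matrix entry, in row \<open>x\<close> and column \<open>y\<close>, of the tensor power
  of \<open>g\<close> in the basis of words.\<close>

definition wact :: "complex mat \<Rightarrow> nat list \<Rightarrow> nat list \<Rightarrow> complex" where
  "wact g x y = (\<Prod>r<length x. g $$ (x ! r, y ! r))"

text \<open>The words need not increase: a repeated letter in \<open>x\<close> gives 0 and a
  permutation of \<open>x\<close> a sign, so as a function of \<open>x\<close> this is an
  alternating tensor.\<close>

definition minor :: "complex mat \<Rightarrow> nat list \<Rightarrow> nat list \<Rightarrow> complex" where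
  "minor g x y = det (mat (length x) (length x) (\<lambda>(r, s). g $$ (x ! r, y ! s)))"

lemma finite_words [simp]: "finite (words m K)"
proof -
  have "words m K = {x. set x \<subseteq> {..<m} \<and> length x = K}" by (auto simp: words_def)
  thus ?thesis by (simp add: finite_lists_length_eq)
qed

lemma words_length: "x \<in> words m K \<Longrightarrow> length x = K"
  and words_nth: "x \<in> words m K \<Longrightarrow> r < K \<Longrightarrow> x ! r < m"
  by (auto simp: words_def dest: nth_mem)

lemma wordsI: "length x = K \<Longrightarrow> (\<And>r. r < K \<Longrightarrow> x ! r < m) \<Longrightarrow> x \<in> words m K"
  by (auto simp: words_def in_set_conv_nth)

lemma words_0 [simp]: "words m 0 = {[]}"
  by (auto simp: words_def)

lemma words_append: "x \<in> words m k \<Longrightarrow> y \<in> words m l \<Longrightarrow> x @ y \<in> words m (k + l)"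
  by (auto simp: words_def)

lemma words_take: "x \<in> words m (k + l) \<Longrightarrow> take k x \<in> words m k"
  and words_drop: "x \<in> words m (k + l) \<Longrightarrow> drop k x \<in> words m l"
  by (auto simp: words_def dest: in_set_takeD in_set_dropD)

lemma sum_words_append:
  "(\<Sum>x\<in>words m (k + l). f x) = (\<Sum>y\<in>words m k. \<Sum>z\<in>words m l. (f (y @ z) :: complex))"
proof -
  have "(\<Sum>y\<in>words m k. \<Sum>z\<in>words m l. f (y @ z)) = (\<Sum>(y, z)\<in>words m k \<times> words m l. f (y @ z))"
    by (simp add: sum.cartesian_product)
  also have "\<dots> = (\<Sum>x\<in>words m (k + l). f x)"
    by (rule sum.reindex_bij_witness[of _ "\<lambda>x. (take k x, drop k x)" "\<lambda>(y, z). y @ z"])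
      (auto simp: words_append words_length intro: words_take words_drop)
  finally show ?thesis ..
qed

lemma sum_words_Suc:
  "(\<Sum>x\<in>words m (Suc K). f x) = (\<Sum>a<m. \<Sum>z\<in>words m K. (f (a # z) :: complex))"
proof -
  have "(\<Sum>a<m. \<Sum>z\<in>words m K. f (a # z)) = (\<Sum>(a, z)\<in>{..<m} \<times> words m K. f (a # z))"
    by (simp add: sum.cartesian_product)
  also have "\<dots> = (\<Sum>x\<in>words m (Suc K). f x)"
    by (rule sum.reindex_bij_witness[of _ "\<lambda>x. (hd x, tl x)" "\<lambda>(a, z). a # z"])
      (auto simp: words_def length_Suc_conv)
  finally show ?thesis ..
qed

lemma sum_words_prod:
  "(\<Sum>y\<in>words m K. \<Prod>r<K. F r (y ! r)) = (\<Prod>r<K. \<Sum>a<m. (F r a :: complex))"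
proof (induction K arbitrary: F)
  case (Suc K)
  have "(\<Sum>y\<in>words m (Suc K). \<Prod>r<Suc K. F r (y ! r)) = (\<Sum>a<m. \<Sum>z\<in>words m K. F 0 a * (\<Prod>r<K. F (Suc r) (z ! r)))"
    unfolding sum_words_Suc prod.lessThan_Suc_shift by simp
  also have "\<dots> = (\<Sum>a<m. F 0 a) * (\<Sum>z\<in>words m K. \<Prod>r<K. F (Suc r) (z ! r))"
    by (simp add: sum_product)
  finally have eq: "(\<Sum>y\<in>words m (Suc K). \<Prod>r<Suc K. F r (y ! r)) = \<dots>" .
  show ?case by (subst eq, subst Suc.IH, subst prod.lessThan_Suc_shift) (rule refl)
qed simp

lemma wact_append:
  assumes "length x = length y"
  shows "wact g (x @ x') (y @ y') = wact g x y * wact g x' y'"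
  using assms
proof (induction x y rule: list_induct2)
  case (Cons a x b y)
  thus ?case by (simp add: wact_def prod.lessThan_Suc_shift mult.assoc del: prod.lessThan_Suc)
qed (simp add: wact_def)

lemma wact_mult:
  assumes g: "g \<in> carrier_mat m m" and h: "h \<in> carrier_mat m m"
    and x: "x \<in> words m K" and z: "z \<in> words m K"
  shows "wact (g * h) x z = (\<Sum>y\<in>words m K. wact g x y * wact h y z)"
proof -
  have "(\<Sum>y\<in>words m K. wact g x y * wact h y z) =
      (\<Sum>y\<in>words m K. \<Prod>r<K. g $$ (x ! r, y ! r) * h $$ (y ! r, z ! r))"
    using x by (intro sum.cong) (auto simp: wact_def words_length prod.distrib)
  also have "\<dots> = (\<Prod>r<K. \<Sum>a<m. g $$ (x ! r, a) * h $$ (a, z ! r))"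
    by (rule sum_words_prod)
  also have "\<dots> = (\<Prod>r<K. (g * h) $$ (x ! r, z ! r))"
    by (intro prod.cong refl mult_mat_nth[OF g h, symmetric]) (auto simp: words_nth[OF x] words_nth[OF z])
  finally show ?thesis using x by (simp add: wact_def words_length)
qed

lemma minor_expand:
  assumes "length x = k"
  shows "minor g x y = (\<Sum>p\<in>{p. p permutes {0..<k}}. signof p * (\<Prod>r<k. g $$ (x ! r, y ! p r)))"
proof -
  have "minor g x y = (\<Sum>p\<in>{p. p permutes {0..<k}}. signof p *
      (\<Prod>r=0..<k. mat k k (\<lambda>(r, s). g $$ (x ! r, y ! s)) $$ (r, p r)))"
    unfolding minor_def assms by (rule det_def') simp
  also have "\<dots> = (\<Sum>p\<in>{p. p permutes {0..<k}}. signof p * (\<Prod>r<k. g $$ (x ! r, y ! p r)))"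
  proof (intro sum.cong refl arg_cong2[where f = "(*)"])
    fix p assume "p \<in> {p. p permutes {0..<k}}"
    hence p: "p r < k" if "r < k" for r using permutes_in_image[of p "{0..<k}" r] that by simp
    show "(\<Prod>r=0..<k. mat k k (\<lambda>(r, s). g $$ (x ! r, y ! s)) $$ (r, p r)) = (\<Prod>r<k. g $$ (x ! r, y ! p r))"
      unfolding atLeast0LessThan by (intro prod.cong) (auto simp: p)
  qed
  finally show ?thesis .
qed

text \<open>By the Leibniz formula the minor is a signed sum of pure tensors in \<open>y\<close>,
  and on a pure tensor \<open>g\<close> acts factor by factor.\<close>

lemma wact_minor:
  assumes g: "g \<in> carrier_mat m m" and h: "h \<in> carrier_mat m m"
    and x: "x \<in> words m k" and J: "J \<in> words m k"
  shows "(\<Sum>y\<in>words m k. wact g x y * minor h y J) = minor (g * h) x J"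
proof -
  let ?P = "{p. p permutes {0..<k}}"
  have pk: "p r < k" if "p \<in> ?P" "r < k" for p r
    using permutes_in_image[of p "{0..<k}" r] that by simp
  have "(\<Sum>y\<in>words m k. wact g x y * minor h y J) =
      (\<Sum>y\<in>words m k. \<Sum>p\<in>?P. signof p * (\<Prod>r<k. g $$ (x ! r, y ! r) * h $$ (y ! r, J ! p r)))"
  proof (rule sum.cong)
    fix y assume "y \<in> words m k"
    thus "wact g x y * minor h y J = (\<Sum>p\<in>?P. signof p * (\<Prod>r<k. g $$ (x ! r, y ! r) * h $$ (y ! r, J ! p r)))"
      using x by (simp add: minor_expand[of y k] words_length wact_def sum_distrib_left prod.distrib ac_simps)
  qed simp
  also have "\<dots> = (\<Sum>p\<in>?P. signof p * (\<Sum>y\<in>words m k. \<Prod>r<k. g $$ (x ! r, y ! r) * h $$ (y ! r, J ! p r)))"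
    by (subst sum.swap) (simp add: sum_distrib_left)
  also have "\<dots> = (\<Sum>p\<in>?P. signof p * (\<Prod>r<k. (g * h) $$ (x ! r, J ! p r)))"
  proof (intro sum.cong refl arg_cong2[where f = "(*)"])
    fix p assume p: "p \<in> ?P"
    have "(\<Sum>y\<in>words m k. \<Prod>r<k. g $$ (x ! r, y ! r) * h $$ (y ! r, J ! p r)) =
        (\<Prod>r<k. \<Sum>a<m. g $$ (x ! r, a) * h $$ (a, J ! p r))"
      by (rule sum_words_prod)
    also have "\<dots> = (\<Prod>r<k. (g * h) $$ (x ! r, J ! p r))"
      by (intro prod.cong refl mult_mat_nth[OF g h, symmetric])
        (auto simp: words_nth[OF x] words_nth[OF J] pk[OF p])
    finally show "(\<Sum>y\<in>words m k. \<Prod>r<k. g $$ (x ! r, y ! r) * h $$ (y ! r, J ! p r)) =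
        (\<Prod>r<k. (g * h) $$ (x ! r, J ! p r))" .
  qed
  also have "\<dots> = minor (g * h) x J" using x by (simp add: minor_expand[of x k] words_length)
  finally show ?thesis .
qed

section \<open>Block-alternating functions\<close>

definition swap :: "nat \<Rightarrow> nat \<Rightarrow> 'a list \<Rightarrow> 'a list" where
  "swap r s x = x[r := x ! s, s := x ! r]"

fun block_of :: "nat list \<Rightarrow> nat \<Rightarrow> nat" where
  "block_of [] r = 0"
| "block_of (k # ks) r = (if r < k then 0 else Suc (block_of ks (r - k)))"

definition block_alt :: "nat \<Rightarrow> nat list \<Rightarrow> (nat list \<Rightarrow> complex) \<Rightarrow> bool" where
  "block_alt m ks F \<longleftrightarrow> (\<forall>x\<in>words m (sum_list ks). \<forall>r s. r < s \<longrightarrow> s < sum_list ks \<longrightarrow>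
    block_of ks r = block_of ks s \<longrightarrow> F (swap r s x) = - F x)"

definition block_inc :: "nat list \<Rightarrow> nat list \<Rightarrow> bool" where
  "block_inc ks x \<longleftrightarrow> (\<forall>r s. r < s \<longrightarrow> s < sum_list ks \<longrightarrow> block_of ks r = block_of ks s \<longrightarrow> x ! r < x ! s)"

lemma swap_words: "x \<in> words m K \<Longrightarrow> r < K \<Longrightarrow> s < K \<Longrightarrow> swap r s x \<in> words m K"
  by (rule wordsI) (auto simp: swap_def nth_list_update words_def subset_iff)

text \<open>Exchanging two letters of a block changes the sign of \<open>F\<close>. Equal letters
  would force \<open>F x = 0\<close>, and two letters in the wrong order would exchange into a
  smaller word of the support.\<close>

lemma lex_min_block_inc:
  assumes F: "block_alt m ks F" and x: "x \<in> words m (sum_list ks)" "F x \<noteq> 0"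
    and min: "\<And>y. y \<in> words m (sum_list ks) \<Longrightarrow> (y, x) \<in> lexn less_than (sum_list ks) \<Longrightarrow> F y = 0"
  shows "block_inc ks x"
  unfolding block_inc_def
proof (intro allI impI)
  fix r s assume rs: "r < s" "s < sum_list ks" "block_of ks r = block_of ks s"
  note len = words_length[OF x(1)]
  have Fs: "F (swap r s x) = - F x" using F x rs unfolding block_alt_def by blast
  show "x ! r < x ! s"
  proof (rule ccontr)
    assume "\<not> x ! r < x ! s"
    then consider "x ! r = x ! s" | "x ! s < x ! r" by linarith
    thus False
    proof cases
      case 1
      have "swap r s x = x" using 1 by (metis list_update_id swap_def)
      thus False using Fs x(2) by simp
    next
      case 2
      have r: "r < length x" using rs len by simp
      have "swap r s x = take r x @ (x ! s) # drop (Suc r) (swap r s x)"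
        using rs r len id_take_nth_drop[of r "swap r s x"] by (simp add: swap_def)
      moreover have "x = take r x @ x ! r # drop (Suc r) x" using r by (rule id_take_nth_drop)
      ultimately have "(swap r s x, x) \<in> lexn less_than (sum_list ks)"
        using 2 len unfolding lexn_conv by (fastforce simp: swap_def)
      moreover have "swap r s x \<in> words m (sum_list ks)" using rs x by (intro swap_words) auto
      ultimately show False using min Fs x(2) by auto
    qed
  qed
qed

lemma ex_lex_min:
  assumes "x \<in> words m K" "F x \<noteq> (0 :: complex)"
  obtains y where "y \<in> words m K" "F y \<noteq> 0"
    "\<And>z. z \<in> words m K \<Longrightarrow> (z, y) \<in> lexn less_than K \<Longrightarrow> F z = 0"
proof -
  have "wf (lexn less_than K)" by (rule wf_lexn) simp
  then obtain y where "y \<in> {x \<in> words m K. F x \<noteq> 0}"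
    "\<And>z. (z, y) \<in> lexn less_than K \<Longrightarrow> z \<notin> {x \<in> words m K. F x \<noteq> 0}"
    using assms by (elim wfE_min[where Q = "{x \<in> words m K. F x \<noteq> 0}"]) auto
  thus ?thesis using that by auto
qed

text \<open>A least word of the support would increase within every block.\<close>

lemma block_alt_zero:
  assumes "block_alt m ks F" "\<And>x. x \<in> words m (sum_list ks) \<Longrightarrow> block_inc ks x \<Longrightarrow> F x = 0"
    and "x \<in> words m (sum_list ks)"
  shows "F x = 0"
proof (rule ccontr)
  assume "F x \<noteq> 0"
  from ex_lex_min[of x m "sum_list ks" F, OF assms(3) this]
  obtain y where "y \<in> words m (sum_list ks)" "F y \<noteq> 0"
    "\<And>z. z \<in> words m (sum_list ks) \<Longrightarrow> (z, y) \<in> lexn less_than (sum_list ks) \<Longrightarrow> F z = 0" by blast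
  thus False using lex_min_block_inc[OF assms(1)] assms(2) by blast
qed

lemma block_alt_lin:
  assumes "\<And>i. i \<in> S \<Longrightarrow> block_alt m ks (F i)"
  shows "block_alt m ks (\<lambda>x. \<Sum>i\<in>S. F i x * c i)"
  using assms by (auto simp: block_alt_def sum_negf)

lemma block_alt_minus:
  assumes "block_alt m ks F" "block_alt m ks G"
  shows "block_alt m ks (\<lambda>x. F x - G x)"
  using assms by (auto simp: block_alt_def)

section \<open>One block: minors as a basis of the alternating functions\<close>

lemma block_alt_singleton:
  "block_alt m [k] F \<longleftrightarrow> (\<forall>x\<in>words m k. \<forall>r s. r < s \<longrightarrow> s < k \<longrightarrow> F (swap r s x) = - F x)"
  by (auto simp: block_alt_def)

lemma block_inc_singleton: "length x = k \<Longrightarrow> block_inc [k] x \<longleftrightarrow> sorted_wrt (<) x"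
  by (auto simp: block_inc_def sorted_wrt_iff_nth_less)

lemma minor_swap:
  assumes "length x = k" "r < s" "s < k"
  shows "minor g (swap r s x) J = - minor g x J"
proof -
  let ?A = "mat k k (\<lambda>(r, s). g $$ (x ! r, J ! s))"
  let ?t = "Transposition.transpose r s"
  have p: "?t permutes {0..<k}" using assms by (intro permutes_swap_id) auto
  have tk: "?t i < k" if "i < k" for i using permutes_in_image[OF p, of i] that by simp
  have "minor g (swap r s x) J = det (mat k k (\<lambda>(i, j). ?A $$ (?t i, j)))"
    unfolding minor_def using assms tk
    by (intro arg_cong[where f = det] eq_matI)
      (auto simp: swap_def nth_list_update Transposition.transpose_def)
  also have "\<dots> = signof ?t * det ?A" by (rule det_permute_rows[OF _ p]) simp
  also have "signof ?t = (-1 :: complex)" using assms by (simp add: sign_swap_id)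
  finally show ?thesis using assms by (simp add: minor_def)
qed

lemma minor_block_alt: "block_alt m [k] (\<lambda>x. minor g x J)"
  unfolding block_alt_singleton using minor_swap words_length by blast

definition incs :: "nat \<Rightarrow> nat \<Rightarrow> nat list list" where
  "incs m k = filter (sorted_wrt (<)) (List.n_lists k [0..<m])"

lemma set_incs: "set (incs m k) = {x \<in> words m k. sorted_wrt (<) x}"
  by (auto simp: incs_def set_n_lists words_def)

lemma distinct_incs: "distinct (incs m k)"
  by (simp add: incs_def distinct_n_lists)

lemma minor_zero_row:
  assumes "r < length x" "\<And>s. s < length x \<Longrightarrow> g $$ (x ! r, y ! s) = 0"
  shows "minor g x y = 0"
  unfolding minor_expand[OF refl]
proof (rule sum.neutral, safe)
  fix p assume p: "p permutes {0..<length x}"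
  have "p r < length x" using permutes_in_image[OF p, of r] assms(1) by simp
  hence "(\<Prod>r<length x. g $$ (x ! r, y ! p r)) = 0"
    using assms by (intro prod_zero) auto
  thus "signof p * (\<Prod>r<length x. g $$ (x ! r, y ! p r)) = 0" by simp
qed

text \<open>Distinct increasing words have distinct letter sets, so some letter of \<open>I\<close>
  is missing from \<open>J\<close> and gives a zero row.\<close>

lemma minor_one:
  assumes "I \<in> set (incs m k)" "J \<in> set (incs m k)"
  shows "minor (1\<^sub>m m) I J = (if I = J then 1 else 0)"
proof -
  have I: "I \<in> words m k" "sorted_wrt (<) I" and J: "J \<in> words m k" "sorted_wrt (<) J"
    using assms by (auto simp: set_incs)
  have dI: "distinct I" "sorted I" and dJ: "distinct J" "sorted J"
    using I J by (auto simp: strict_sorted_iff)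
  show ?thesis
  proof (cases "I = J")
    case True
    have "mat k k (\<lambda>(r, s). (1\<^sub>m m :: complex mat) $$ (I ! r, I ! s)) = 1\<^sub>m k"
      using words_nth[OF I(1)] words_length[OF I(1)] dI by (intro eq_matI) (auto simp: nth_eq_iff_index_eq)
    thus ?thesis using True words_length[OF I(1)] by (simp add: minor_def)
  next
    case False
    have "\<not> set I \<subseteq> set J"
    proof
      assume "set I \<subseteq> set J"
      moreover have "card (set I) = card (set J)"
        using dI dJ words_length[OF I(1)] words_length[OF J(1)] by (simp add: distinct_card)
      ultimately have "set I = set J" by (intro card_subset_eq) auto
      thus False using False dI dJ sorted_distinct_set_unique by blast
    qed
    then obtain r where r: "r < k" "I ! r \<notin> set J" using words_length[OF I(1)] by (auto simp: in_set_conv_nth subset_iff)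
    have "minor (1\<^sub>m m) I J = 0"
    proof (rule minor_zero_row)
      show "r < length I" using r words_length[OF I(1)] by simp
      fix s assume "s < length I"
      hence s: "s < k" using words_length[OF I(1)] by simp
      hence "I ! r \<noteq> J ! s" using r words_length[OF J(1)] by auto
      thus "1\<^sub>m m $$ (I ! r, J ! s) = 0" using r s words_nth[OF I(1)] words_nth[OF J(1)] by simp
    qed
    thus ?thesis using False by simp
  qed
qed

text \<open>The minors of the identity are the basis dual to evaluation at increasing words: both
  sides alternate and agree on increasing words, hence everywhere by
  \<open>block_alt_zero\<close>.\<close>

lemma alt_expand:
  assumes F: "block_alt m [k] F" and x: "x \<in> words m k"
  shows "F x = (\<Sum>I\<in>set (incs m k). minor (1\<^sub>m m) x I * F I)"
proof -
  let ?G = "\<lambda>x. F x - (\<Sum>I\<in>set (incs m k). minor (1\<^sub>m m) x I * F I)"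
  have "?G x = 0"
  proof (rule block_alt_zero[of m "[k]"])
    show "block_alt m [k] ?G"
      by (intro block_alt_minus F block_alt_lin minor_block_alt)
    fix y assume "y \<in> words m (sum_list [k])" "block_inc [k] y"
    hence y: "y \<in> set (incs m k)" by (simp add: set_incs block_inc_singleton words_length)
    have "(\<Sum>I\<in>set (incs m k). minor (1\<^sub>m m) y I * F I) = (\<Sum>I\<in>set (incs m k). if I = y then F y else 0)"
      by (rule sum.cong) (auto simp: minor_one[OF y])
    thus "?G y = 0" using y by simp
  qed (use x in simp)
  thus ?thesis by simp
qed

text \<open>Expand \<open>minor h\<close> by \<open>alt_expand\<close> and let \<open>g\<close> act
  on both sides of the expansion; \<open>wact_minor\<close> evaluates them.\<close>

lemma Cauchy_Binet:
  assumes g: "g \<in> carrier_mat m m" and h: "h \<in> carrier_mat m m"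
    and I: "I \<in> words m k" and J: "J \<in> words m k"
  shows "minor (g * h) I J = (\<Sum>L\<in>set (incs m k). minor g I L * minor h L J)"
proof -
  have L: "L \<in> words m k" if "L \<in> set (incs m k)" for L using that by (simp add: set_incs)
  have "minor (g * h) I J = (\<Sum>y\<in>words m k. wact g I y * minor h y J)"
    by (rule wact_minor[OF assms, symmetric])
  also have "\<dots> = (\<Sum>y\<in>words m k. \<Sum>L\<in>set (incs m k). wact g I y * minor (1\<^sub>m m) y L * minor h L J)"
  proof (rule sum.cong)
    fix y assume "y \<in> words m k"
    from alt_expand[OF minor_block_alt[of m k h J] this]
    have "minor h y J = (\<Sum>L\<in>set (incs m k). minor (1\<^sub>m m) y L * minor h L J)" .
    thus "wact g I y * minor h y J = (\<Sum>L\<in>set (incs m k). wact g I y * minor (1\<^sub>m m) y L * minor h L J)"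
      by (simp add: sum_distrib_left mult.assoc)
  qed simp
  also have "\<dots> = (\<Sum>L\<in>set (incs m k). (\<Sum>y\<in>words m k. wact g I y * minor (1\<^sub>m m) y L) * minor h L J)"
    by (subst sum.swap) (simp add: sum_distrib_right)
  also have "\<dots> = (\<Sum>L\<in>set (incs m k). minor g I L * minor h L J)"
    using g I L by (intro sum.cong) (auto simp: wact_minor[OF g one_carrier_mat])
  finally show ?thesis .
qed

section \<open>Exterior powers twisted by a power of the determinant\<close>

text \<open>The compound matrix of \<open>g\<close>, that is, its exterior power in the basis of
  increasing words, twisted by a power of the determinant.\<close>

definition ext_rep :: "nat \<Rightarrow> nat \<Rightarrow> nat \<Rightarrow> matrix_rep" where
  "ext_rep m k e = (length (incs m k), \<lambda>g. mat (length (incs m k)) (length (incs m k))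
    (\<lambda>(i, j). inverse (det g) ^ e * minor g (incs m k ! i) (incs m k ! j)))"

lemma GL_inverse:
  assumes "g \<in> carrier (GL m)"
  obtains h where "h \<in> carrier (GL m)" "g * h = 1\<^sub>m m"
proof -
  have "g \<in> Units (ring_mat TYPE(complex) m ())" using assms by (simp add: GL_def units_of_def)
  then obtain h where h: "h \<in> carrier_mat m m" "g * h = 1\<^sub>m m"
    by (auto simp: Units_def ring_mat_def)
  have "det g * det h = 1" using det_mult[of g m h] assms h by (simp add: carrier_GL)
  hence "det h \<noteq> 0" by auto
  thus ?thesis using that h by (simp add: carrier_GL)
qed

lemma incs_nth: "i < length (incs m k) \<Longrightarrow> incs m k ! i \<in> set (incs m k)"
  by simp

lemma incs_words: "I \<in> set (incs m k) \<Longrightarrow> I \<in> words m k"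
  by (simp add: set_incs)

lemma incs_eq: "i < length (incs m k) \<Longrightarrow> j < length (incs m k) \<Longrightarrow> incs m k ! i = incs m k ! j \<longleftrightarrow> i = j"
  using distinct_incs by (simp add: nth_eq_iff_index_eq)

lemma sum_incs: "(\<Sum>I\<in>set (incs m k). f I) = (\<Sum>i<length (incs m k). f (incs m k ! i))"
  by (rule sum.reindex_bij_betw[OF bij_betw_nth, symmetric]) (auto simp: distinct_incs)

lemma regular_sum: "finite S \<Longrightarrow> (\<And>i. i \<in> S \<Longrightarrow> f i \<in> regular_functions m) \<Longrightarrow> (\<lambda>g. \<Sum>i\<in>S. f i g) \<in> regular_functions m"
  by (induction S rule: finite_induct) (auto intro: regular_functions.intros)

lemma regular_prod: "finite S \<Longrightarrow> (\<And>i. i \<in> S \<Longrightarrow> f i \<in> regular_functions m) \<Longrightarrow> (\<lambda>g. \<Prod>i\<in>S. f i g) \<in> regular_functions m"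
  by (induction S rule: finite_induct) (auto intro: regular_functions.intros)

lemma regular_minor:
  assumes "I \<in> words m k" "J \<in> words m k"
  shows "(\<lambda>g. minor g I J) \<in> regular_functions m"
proof -
  have "J ! p r < m" if "p permutes {0..<k}" "r < k" for p r
    using permutes_in_image[OF that(1), of r] that(2) words_nth[OF assms(2)] by simp
  thus ?thesis
    unfolding minor_expand[OF words_length[OF assms(1)]]
    by (intro regular_sum regular_functions.mult regular_prod regular_functions.const regular_functions.entry)
      (auto simp: finite_permutations words_nth[OF assms(1)])
qed

lemma regular_power: "f \<in> regular_functions m \<Longrightarrow> (\<lambda>g. f g ^ e) \<in> regular_functions m"
  by (induction e) (auto intro: regular_functions.intros)

lemma ext_rep_mult:
  assumes g: "g \<in> carrier (GL m)" and h: "h \<in> carrier (GL m)"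
  shows "snd (ext_rep m k e) (g * h) = snd (ext_rep m k e) g * snd (ext_rep m k e) h"
proof (rule eq_matI)
  let ?d = "length (incs m k)"
  let ?R = "snd (ext_rep m k e)"
  have R: "?R x \<in> carrier_mat ?d ?d" for x by (simp add: ext_rep_def)
  note gc = GL_carrier_mat[OF g] GL_carrier_mat[OF h]
  fix i j assume "i < dim_row (?R g * ?R h)" "j < dim_col (?R g * ?R h)"
  hence ij: "i < ?d" "j < ?d" using R[of g] R[of h] by auto
  have "?R (g * h) $$ (i, j) = inverse (det g) ^ e * inverse (det h) ^ e *
      (\<Sum>l<?d. minor g (incs m k ! i) (incs m k ! l) * minor h (incs m k ! l) (incs m k ! j))"
    using ij Cauchy_Binet[OF gc incs_words incs_words, OF incs_nth incs_nth, OF ij]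
    by (simp add: ext_rep_def det_mult[OF gc] power_mult_distrib sum_incs)
  also have "\<dots> = (?R g * ?R h) $$ (i, j)"
    unfolding mult_mat_nth[OF R R ij] using ij by (simp add: ext_rep_def sum_distrib_left ac_simps)
  finally show "?R (g * h) $$ (i, j) = (?R g * ?R h) $$ (i, j)" .
qed (simp_all add: ext_rep_def)

lemma ext_rep_one: "snd (ext_rep m k e) (1\<^sub>m m) = 1\<^sub>m (length (incs m k))"
  by (rule eq_matI) (auto simp: ext_rep_def minor_one[OF incs_nth incs_nth] incs_eq)

text \<open>Invertibility of the matrices comes from representing an inverse of \<open>g\<close>;
  their entries are products of minors with powers of the inverse determinant.\<close>

lemma ext_rep_rational: "rational_rep m (ext_rep m k e)"
proof -
  let ?d = "length (incs m k)"
  let ?R = "snd (ext_rep m k e)"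
  have R: "?R x \<in> carrier_mat ?d ?d" for x by (simp add: ext_rep_def)
  have "?R g \<in> carrier (GL ?d)" if g: "g \<in> carrier (GL m)" for g
  proof -
    obtain h where h: "h \<in> carrier (GL m)" "g * h = 1\<^sub>m m" using GL_inverse[OF g] by blast
    have "?R g * ?R h = 1\<^sub>m ?d" using ext_rep_mult[OF g h(1)] ext_rep_one h(2) by metis
    hence "det (?R g) * det (?R h) = 1" using det_mult[OF R R, of g h] by (metis det_one)
    hence "det (?R g) \<noteq> 0" by auto
    thus ?thesis using R by (simp add: carrier_GL)
  qed
  hence "?R \<in> hom (GL m) (GL ?d)" using ext_rep_mult by (auto simp: hom_def)
  moreover have "\<exists>f\<in>regular_functions m. \<forall>g\<in>carrier (GL m). ?R g $$ (i, j) = f g" if "i < ?d" "j < ?d" for i j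
  proof (intro bexI ballI)
    show "?R g $$ (i, j) = inverse (det g) ^ e * minor g (incs m k ! i) (incs m k ! j)" for g
      using that by (simp add: ext_rep_def)
    show "(\<lambda>g. inverse (det g) ^ e * minor g (incs m k ! i) (incs m k ! j)) \<in> regular_functions m"
      by (intro regular_functions.mult regular_power regular_functions.inverse_det
        regular_minor[where k = k] incs_words incs_nth that)
  qed
  ultimately show ?thesis by (simp add: rational_rep_def ext_rep_def)
qed

lemma upt_in_incs: "k \<le> m \<Longrightarrow> [0..<k] \<in> set (incs m k)"
  by (auto simp: set_incs words_def)

lemma minor_diagonal:
  assumes x: "x \<in> words m k" and J: "J \<in> words m k"
  shows "minor (mat m m (\<lambda>(i, j). if i = j then c i else 0)) x J = (\<Prod>r<k. c (x ! r)) * minor (1\<^sub>m m) x J"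
proof -
  have "J ! p r < m" if "p permutes {0..<k}" "r < k" for p r
    using permutes_in_image[OF that(1), of r] that(2) words_nth[OF J] by simp
  hence "(\<Prod>r<k. mat m m (\<lambda>(i, j). if i = j then c i else 0) $$ (x ! r, J ! p r)) =
      (\<Prod>r<k. c (x ! r)) * (\<Prod>r<k. 1\<^sub>m m $$ (x ! r, J ! p r))" if "p permutes {0..<k}" for p
    unfolding prod.distrib[symmetric] using that words_nth[OF x] by (intro prod.cong) auto
  thus ?thesis
    unfolding minor_expand[OF words_length[OF x]] by (simp add: sum_distrib_left ac_simps)
qed

text \<open>Any scalar with distinct powers would do; 2 lets a single torus element measure how
  often the letter \<open>a\<close> occurs.\<close>

definition dilation :: "nat \<Rightarrow> nat \<Rightarrow> complex mat" where
  "dilation m a = mat m m (\<lambda>(i, j). if i = j then (if i = a then 2 else 1) else 0)"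

lemma det_dilation:
  assumes "a < m"
  shows "det (dilation m a) = 2"
proof -
  have "det (dilation m a) = (\<Prod>i<m. dilation m a $$ (i, i))"
    by (rule upper_triangular_det) (auto simp: dilation_def upper_triangular_def)
  also have "\<dots> = (\<Prod>i<m. if i = a then 2 else 1)" by (rule prod.cong) (auto simp: dilation_def)
  finally show ?thesis using assms by (simp add: prod.delta)
qed

lemma dilation_GL: "a < m \<Longrightarrow> dilation m a \<in> carrier (GL m)"
  by (simp add: carrier_GL det_dilation) (simp add: dilation_def)

lemma minor_dilation:
  assumes "I \<in> set (incs m k)" "J \<in> set (incs m k)"
  shows "minor (dilation m a) I J = (if I = J then if a \<in> set I then 2 else 1 else 0)"
proof -
  have I: "distinct I" "length I = k" using assms(1) by (auto simp: set_incs strict_sorted_iff words_length)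
  have "(\<Prod>r<k. if I ! r = a then 2 else 1) = (\<Prod>b\<in>set I. if b = a then 2 else (1 :: complex))"
    by (rule prod.reindex_bij_betw[OF bij_betw_nth]) (use I in auto)
  also have "\<dots> = (if a \<in> set I then 2 else 1)" by (simp add: prod.delta)
  finally show ?thesis
    using minor_diagonal[OF incs_words incs_words, OF assms, of "\<lambda>i. if i = a then 2 else 1"] minor_one[OF assms]
    by (auto simp: dilation_def)
qed

lemma vec_span_units:
  assumes sub: "\<And>x y. x \<in> W \<Longrightarrow> y \<in> W \<Longrightarrow> x + y \<in> W" "\<And>a x. x \<in> W \<Longrightarrow> a \<cdot>\<^sub>v x \<in> W"
    and z: "0\<^sub>v d \<in> W" and u: "\<And>i. i < d \<Longrightarrow> (unit_vec d i :: complex vec) \<in> W" and x: "x \<in> carrier_vec d"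
  shows "x \<in> W"
proof -
  have "vec d (\<lambda>i. if i < k then x $ i else 0) \<in> W" if "k \<le> d" for k
    using that
  proof (induction k)
    case 0
    have "vec d (\<lambda>i. 0) = (0\<^sub>v d :: complex vec)" by auto
    thus ?case using z by simp
  next
    case (Suc k)
    have "vec d (\<lambda>i. if i < k then x $ i else 0) + x $ k \<cdot>\<^sub>v unit_vec d k = vec d (\<lambda>i. if i < Suc k then x $ i else 0)"
      by (rule eq_vecI) (auto simp: unit_vec_def less_Suc_eq)
    moreover have "vec d (\<lambda>i. if i < k then x $ i else 0) + x $ k \<cdot>\<^sub>v unit_vec d k \<in> W"
      using Suc by (intro sub u) auto
    ultimately show ?case by simp
  qed
  from this[of d] have "vec d (\<lambda>i. if i < d then x $ i else 0) \<in> W" by simp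
  moreover have "vec d (\<lambda>i. if i < d then x $ i else 0) = x" using x by auto
  ultimately show ?thesis by simp
qed

lemma subspace_vecD:
  assumes "VectorSpace.subspace class_ring W (module_vec TYPE(complex) d)"
  shows "W \<subseteq> carrier_vec d" "0\<^sub>v d \<in> W" "\<And>x y. x \<in> W \<Longrightarrow> y \<in> W \<Longrightarrow> x + y \<in> W"
    "\<And>a x. x \<in> W \<Longrightarrow> a \<cdot>\<^sub>v x \<in> W"
proof -
  have s: "submodule class_ring W (module_vec TYPE(complex) d)"
    using assms by (simp add: VectorSpace.subspace_def)
  show "W \<subseteq> carrier_vec d" "0\<^sub>v d \<in> W" "\<And>x y. x \<in> W \<Longrightarrow> y \<in> W \<Longrightarrow> x + y \<in> W"
    "\<And>a x. x \<in> W \<Longrightarrow> a \<cdot>\<^sub>v x \<in> W"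
    using submodule.subset[OF s] submodule.zero_closed[OF s] submodule.m_closed[OF s] submodule.smult_closed[OF s]
    by (simp_all add: module_vec_simps class_ring_simps)
qed

lemma extend_to_permutation:
  assumes I: "I \<in> set (incs m k)" and J: "J \<in> set (incs m k)"
  obtains p where "p permutes {0..<m}" "\<And>r. r < k \<Longrightarrow> p (I ! r) = J ! r"
proof -
  have I': "distinct I" "length I = k" "set I \<subseteq> {0..<m}" and J': "distinct J" "length J = k" "set J \<subseteq> {0..<m}"
    using I J by (auto simp: set_incs strict_sorted_iff words_def)
  have bI: "bij_betw ((!) I) {..<k} (set I)" and bJ: "bij_betw ((!) J) {..<k} (set J)"
    using I' J' by (auto intro!: bij_betw_nth)
  define f where "f = (!) J \<circ> inv_into {..<k} ((!) I)"
  have bf: "bij_betw f (set I) (set J)"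
    unfolding f_def by (rule bij_betw_trans[OF bij_betw_inv_into[OF bI] bJ])
  have fI: "f (I ! r) = J ! r" if "r < k" for r
    using bij_betw_inv_into_left[OF bI, of r] that by (simp add: f_def)
  have "card ({0..<m} - set I) = card ({0..<m} - set J)"
    using I' J' by (simp add: card_Diff_subset distinct_card)
  then obtain h where h: "bij_betw h ({0..<m} - set I) ({0..<m} - set J)"
    using finite_same_card_bij[of "{0..<m} - set I" "{0..<m} - set J"] by auto
  define p where "p a = (if a \<in> set I then f a else if a < m then h a else a)" for a
  have "bij_betw p (set I) (set J)" by (rule bij_betw_cong[THEN iffD1, OF _ bf]) (simp add: p_def)
  moreover have "bij_betw p ({0..<m} - set I) ({0..<m} - set J)"
    by (rule bij_betw_cong[THEN iffD1, OF _ h]) (simp add: p_def)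
  ultimately have "bij_betw p (set I \<union> ({0..<m} - set I)) (set J \<union> ({0..<m} - set J))"
    by (rule bij_betw_combine) auto
  hence "bij_betw p {0..<m} {0..<m}" using I'(3) J'(3) by (simp add: Un_absorb1)
  hence "p permutes {0..<m}" by (rule bij_imp_permutes) (use I'(3) in \<open>auto simp: p_def\<close>)
  thus ?thesis using that fI I' by (simp add: p_def)
qed

text \<open>A permutation matrix sending \<open>I ! r\<close> to \<open>J ! r\<close> for every
  \<open>r\<close> restricts to the identity on these rows and columns.\<close>

lemma ext_rep_transitive:
  assumes I: "I \<in> set (incs m k)" and J: "J \<in> set (incs m k)"
  obtains g where "g \<in> carrier (GL m)" "minor g J I = 1"
proof -
  obtain p where p: "p permutes {0..<m}" and pI: "\<And>r. r < k \<Longrightarrow> p (I ! r) = J ! r"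
    using extend_to_permutation[OF I J] by blast
  define q where "q = inv_into UNIV p"
  have q: "q permutes {0..<m}" unfolding q_def by (rule permutes_inv[OF p])
  have qJ: "q (J ! r) = I ! r" if "r < k" for r
    using pI[OF that] permutes_inverses(2)[OF p] by (metis q_def)
  define g where "g = mat m m (\<lambda>(a, b). (1\<^sub>m m :: complex mat) $$ (q a, b))"
  have "det g = signof q * det (1\<^sub>m m :: complex mat)"
    unfolding g_def by (rule det_permute_rows[OF one_carrier_mat q])
  hence "det g \<noteq> 0" by (simp add: sign_def)
  hence g: "g \<in> carrier (GL m)" by (simp add: carrier_GL g_def)
  have w: "length J = k" "length I = k" using I J by (auto dest!: incs_words simp: words_length)
  have d: "distinct I" using I by (auto simp: set_incs strict_sorted_iff)
  have "mat k k (\<lambda>(r, s). g $$ (J ! r, I ! s)) = 1\<^sub>m k"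
    using d w words_nth[OF incs_words[OF I]] words_nth[OF incs_words[OF J]]
    by (intro eq_matI) (auto simp: g_def qJ nth_eq_iff_index_eq)
  hence "minor g J I = 1" using w by (simp add: minor_def)
  thus ?thesis using that g by blast
qed

text \<open>Diagonal matrices isolate a coordinate of a nonzero vector in an invariant subspace. The
  elements of \<open>ext_rep_transitive\<close> then make any other prescribed coordinate nonzero,
  which is isolated in turn.\<close>

lemma ext_rep_irreducible:
  assumes "k \<le> m"
  shows "irreducible_rep m (ext_rep m k e)"
proof -
  define d where "d = length (incs m k)"
  define Is where "Is i = incs m k ! i" for i
  define R where "R = snd (ext_rep m k e)"
  have ext: "ext_rep m k e = (d, R)" by (simp add: d_def R_def ext_rep_def)
  have Rnth: "R g $$ (i, j) = inverse (det g) ^ e * minor g (Is i) (Is j)" if "i < d" "j < d" for g i j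
    using that by (simp add: R_def ext_rep_def d_def Is_def)
  have Rc: "R g \<in> carrier_mat d d" for g by (simp add: R_def ext_rep_def d_def)
  have Isin: "Is i \<in> set (incs m k)" if "i < d" for i using that by (simp add: Is_def d_def)
  have Is_eq: "Is i = Is j \<longleftrightarrow> i = j" if "i < d" "j < d" for i j
    using incs_eq that by (simp add: Is_def d_def)
  have "d > 0" using upt_in_incs[OF assms] unfolding d_def by (metis length_pos_if_in_set)
  moreover have "W = {0\<^sub>v d} \<or> W = carrier_vec d"
    if W: "VectorSpace.subspace class_ring W (module_vec TYPE(complex) d)"
      and st: "\<forall>g\<in>carrier (GL m). \<forall>w\<in>W. R g *\<^sub>v w \<in> W" for W
  proof (cases "W = {0\<^sub>v d}")
    case False
    note Ws = subspace_vecD[OF W]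
    have unit: "unit_vec d i0 \<in> W" if w: "w \<in> W" "w $ i0 \<noteq> 0" and i0: "i0 < d" for w i0
    proof -
      \<comment> \<open>After \<open>t\<close> rounds only coordinates whose word agrees with
        \<open>Is i0\<close> on the letters below \<open>t\<close> survive.\<close>
      have "\<exists>w\<in>W. w $ i0 \<noteq> 0 \<and> (\<forall>i<d. w $ i \<noteq> 0 \<longrightarrow> (\<forall>a<t. a \<in> set (Is i) \<longleftrightarrow> a \<in> set (Is i0)))" if "t \<le> m" for t
        using that
      proof (induction t)
        case 0
        show ?case using w by auto
      next
        case (Suc t)
        then obtain w where w: "w \<in> W" "w $ i0 \<noteq> 0"
          and ws: "\<And>i a. i < d \<Longrightarrow> w $ i \<noteq> 0 \<Longrightarrow> a < t \<Longrightarrow> a \<in> set (Is i) \<longleftrightarrow> a \<in> set (Is i0)" by auto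
        define u where "u = R (dilation m t) *\<^sub>v w"
        have t: "t < m" using Suc.prems by simp
        have wc: "w \<in> carrier_vec d" using w Ws by blast
        have uW: "u \<in> W" unfolding u_def using st dilation_GL[OF t] w(1) by blast
        have uc: "u \<in> carrier_vec d" using uW Ws by blast
        have u: "2 ^ e * u $ i = (if t \<in> set (Is i) then 2 else 1) * w $ i" if i: "i < d" for i
        proof -
          have "u $ i = (\<Sum>j<d. R (dilation m t) $$ (i, j) * w $ j)"
            unfolding u_def by (rule mult_mat_vec_nth[OF Rc wc i])
          also have "\<dots> = (\<Sum>j<d. if j = i then inverse 2 ^ e * (if t \<in> set (Is i) then 2 else 1) * w $ i else 0)"
            using i by (intro sum.cong) (auto simp: Rnth det_dilation[OF t] minor_dilation[OF Isin Isin] Is_eq)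
          finally have "u $ i = inverse 2 ^ e * (if t \<in> set (Is i) then 2 else 1) * w $ i" using i by simp
          moreover have "(2 :: complex) ^ e * inverse 2 ^ e = 1" by (simp add: power_mult_distrib[symmetric])
          ultimately show ?thesis by (metis (no_types, lifting) mult.assoc mult_1)
        qed
        \<comment> \<open>Up to the twist \<open>2 ^ e\<close>, the dilation has eigenvalue 2 on
          words containing \<open>t\<close> and 1 on the others; either combination annihilates the
          unwanted eigenspace and fixes the other one.\<close>
        define w' where "w' = (if t \<in> set (Is i0) then 2 ^ e \<cdot>\<^sub>v u + (-1) \<cdot>\<^sub>v w else 2 \<cdot>\<^sub>v w + (- (2 ^ e)) \<cdot>\<^sub>v u)"
        have "w' \<in> W" using uW w Ws by (auto simp: w'_def)
        moreover have w'i: "w' $ i = (if t \<in> set (Is i) \<longleftrightarrow> t \<in> set (Is i0) then w $ i else 0)" if i: "i < d" for i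
          using u[OF i] uc wc i by (auto simp: w'_def)
        have "w' $ i0 \<noteq> 0" using w'i[OF i0] w by simp
        moreover have "a \<in> set (Is i) \<longleftrightarrow> a \<in> set (Is i0)" if "i < d" "w' $ i \<noteq> 0" "a < Suc t" for i a
          using w'i[OF that(1)] ws[OF that(1), of a] that by (cases "a = t") (auto split: if_splits)
        ultimately show ?case by blast
      qed
      from this[of m] obtain w where w: "w \<in> W" "w $ i0 \<noteq> 0"
        and ws: "\<And>i a. i < d \<Longrightarrow> w $ i \<noteq> 0 \<Longrightarrow> a < m \<Longrightarrow> a \<in> set (Is i) \<longleftrightarrow> a \<in> set (Is i0)" by auto
      have wc: "w \<in> carrier_vec d" using w Ws by blast
      have "w $ i = 0" if i: "i < d" "i \<noteq> i0" for i
      proof (rule ccontr)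
        assume "w $ i \<noteq> 0"
        from ws[OF i(1) this] have "set (Is i) = set (Is i0)"
          using incs_words[OF Isin[OF i(1)]] incs_words[OF Isin[OF i0]] unfolding words_def by blast
        hence "Is i = Is i0" using Isin[OF i(1)] Isin[OF i0] sorted_distinct_set_unique
          unfolding set_incs strict_sorted_iff by blast
        thus False using Is_eq i i0 by blast
      qed
      hence "inverse (w $ i0) \<cdot>\<^sub>v w = unit_vec d i0"
        using wc w i0 by (intro eq_vecI) (auto simp: unit_vec_def)
      thus ?thesis using Ws(4)[OF w(1)] by metis
    qed
    obtain w where w: "w \<in> W" "w \<noteq> 0\<^sub>v d" using False Ws(2) by blast
    have "w \<in> carrier_vec d" using w Ws by blast
    then obtain i0 where i0: "i0 < d" "w $ i0 \<noteq> 0" using w(2) by (metis carrier_vecD eq_vecI index_zero_vec)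
    have "unit_vec d j \<in> W" if j: "j < d" for j
    proof -
      obtain g where g: "g \<in> carrier (GL m)" "minor g (Is j) (Is i0) = 1"
        using ext_rep_transitive[OF Isin[OF i0(1)] Isin[OF j]] by blast
      have "(R g *\<^sub>v unit_vec d i0) $ j = R g $$ (j, i0)"
        using i0 by (simp add: mult_mat_vec_nth[OF Rc unit_vec_carrier j] if_distrib cong: if_cong)
      also have "\<dots> \<noteq> 0" using g i0 j by (simp add: Rnth carrier_GL)
      finally show ?thesis using unit[OF _ _ j] st g(1) unit[OF w(1) i0(2,1)] by blast
    qed
    hence "carrier_vec d \<subseteq> W" using vec_span_units[OF Ws(3,4,2)] by blast
    thus ?thesis using Ws(1) by blast
  qed simp
  ultimately show ?thesis unfolding ext irreducible_rep_def by simp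
qed

text \<open>Any other increasing word has a letter at least \<open>k\<close>, whose row in the upper
  triangular \<open>b\<close> vanishes in the columns below \<open>k\<close>.\<close>

lemma minor_upt_upper_triangular:
  assumes b: "b \<in> carrier_mat m m" "upper_triangular b" and k: "k \<le> m" and J: "J \<in> set (incs m k)"
  shows "minor b J [0..<k] = (if J = [0..<k] then (\<Prod>r<k. b $$ (r, r)) else 0)"
proof (cases "J = [0..<k]")
  case True
  let ?B = "mat k k (\<lambda>(r, s). b $$ (r, s))"
  have "mat k k (\<lambda>(r, s). b $$ ([0..<k] ! r, [0..<k] ! s)) = ?B" by (rule eq_matI) auto
  hence "minor b J [0..<k] = det ?B" using True by (simp add: minor_def)
  also have "\<dots> = (\<Prod>r<k. ?B $$ (r, r))"
    by (rule upper_triangular_det) (use b k in \<open>auto simp: upper_triangular_def\<close>)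
  finally show ?thesis using True by simp
next
  case False
  have J': "length J = k" "distinct J" "sorted J" "J \<in> words m k"
    using J by (auto simp: set_incs strict_sorted_iff words_length)
  have "\<not> set J \<subseteq> set [0..<k]"
  proof
    assume "set J \<subseteq> set [0..<k]"
    moreover have "card (set J) = card (set [0..<k])" using J' by (simp add: distinct_card)
    ultimately have "set J = set [0..<k]" by (intro card_subset_eq) auto
    thus False using False J' sorted_distinct_set_unique[of J "[0..<k]"] by simp
  qed
  then obtain r where r: "r < k" "J ! r \<ge> k" using J'(1) by (auto simp: in_set_conv_nth subset_iff)
  have "minor b J [0..<k] = 0"
  proof (rule minor_zero_row)
    show "r < length J" using r J' by simp
    fix s assume "s < length J"
    hence "s < k" using J' by simp
    thus "b $$ (J ! r, [0..<k] ! s) = 0"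
      using r b words_nth[OF J'(4) r(1)] by (auto simp: upper_triangular_def)
  qed
  thus ?thesis using False by simp
qed

text \<open>The vector is the wedge of the first \<open>k\<close> basis vectors; the twist lowers
  every entry of its weight by \<open>e\<close>.\<close>

lemma ext_rep_highest_weight:
  assumes "k \<le> m"
  shows "\<exists>v. highest_weight_vector m (ext_rep m k e) (map (\<lambda>a. a - int e) (omega m k)) v"
proof -
  define d where "d = length (incs m k)"
  define R where "R = snd (ext_rep m k e)"
  have ext: "ext_rep m k e = (d, R)" by (simp add: d_def R_def ext_rep_def)
  have Rc: "R g \<in> carrier_mat d d" for g by (simp add: R_def ext_rep_def d_def)
  obtain i0 where i0: "i0 < d" "incs m k ! i0 = [0..<k]"
    using upt_in_incs[OF assms] by (auto simp: in_set_conv_nth d_def)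
  define \<mu> where "\<mu> = map (\<lambda>a. a - int e) (omega m k)"
  have \<mu>: "\<mu> ! i = (if i < k then 1 else 0) - int e" if "i < m" for i
    using that assms by (auto simp: \<mu>_def omega_def nth_append)
  have "R b *\<^sub>v unit_vec d i0 = (\<Prod>i<m. b $$ (i, i) powi (\<mu> ! i)) \<cdot>\<^sub>v unit_vec d i0"
    if b: "b \<in> carrier (GL m)" "upper_triangular b" for b
  proof (rule eq_vecI)
    note bc = GL_carrier_mat[OF b(1)]
    have "(\<Prod>i<m. b $$ (i, i) powi (\<mu> ! i)) = (\<Prod>i<m. (if i < k then b $$ (i, i) else 1) * inverse (b $$ (i, i)) ^ e)"
      using upper_triangular_GL_diag[OF b]
      by (intro prod.cong) (auto simp: \<mu> power_int_diff power_int_minus field_simps)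
    also have "\<dots> = (\<Prod>i<m. if i < k then b $$ (i, i) else 1) * inverse (det b) ^ e"
      by (simp add: prod.distrib upper_triangular_det[OF bc b(2)] prod_power_distrib flip: prod_inversef)
    also have "(\<Prod>i<m. if i < k then b $$ (i, i) else 1) = (\<Prod>i<k. b $$ (i, i))"
      using assms by (intro prod.mono_neutral_cong_right) auto
    finally have chi: "(\<Prod>i<m. b $$ (i, i) powi (\<mu> ! i)) = (\<Prod>i<k. b $$ (i, i)) * inverse (det b) ^ e" .
    fix j assume "j < dim_vec ((\<Prod>i<m. b $$ (i, i) powi (\<mu> ! i)) \<cdot>\<^sub>v unit_vec d i0)"
    hence j: "j < d" by simp
    have "(R b *\<^sub>v unit_vec d i0) $ j = R b $$ (j, i0)"
      using i0 by (simp add: mult_mat_vec_nth[OF Rc unit_vec_carrier j] if_distrib cong: if_cong)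
    also have "\<dots> = inverse (det b) ^ e * minor b (incs m k ! j) [0..<k]"
      using i0 j by (simp add: R_def ext_rep_def d_def)
    also have "minor b (incs m k ! j) [0..<k] = (if j = i0 then (\<Prod>r<k. b $$ (r, r)) else 0)"
      using minor_upt_upper_triangular[OF bc b(2) assms, of "incs m k ! j"] i0 j incs_eq[of j m k i0] by (simp add: d_def)
    finally show "(R b *\<^sub>v unit_vec d i0) $ j = ((\<Prod>i<m. b $$ (i, i) powi (\<mu> ! i)) \<cdot>\<^sub>v unit_vec d i0) $ j"
      using i0 j by (simp add: chi unit_vec_def)
  qed (use Rc[of b] in simp)
  moreover have "unit_vec d i0 \<noteq> (0\<^sub>v d :: complex vec)"
  proof
    assume "unit_vec d i0 = (0\<^sub>v d :: complex vec)"
    hence "(unit_vec d i0 :: complex vec) $ i0 = 0\<^sub>v d $ i0" by simp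
    thus False using i0 by simp
  qed
  ultimately have "highest_weight_vector m (d, R) \<mu> (unit_vec d i0)"
    by (simp add: highest_weight_vector_def)
  thus ?thesis unfolding ext \<mu>_def by blast
qed

section \<open>Realising tensor products of exterior powers on words\<close>

text \<open>\<open>word_model m ks e V A B\<close>: the matrix \<open>A\<close> identifies \<open>V\<close> with the block-alternating
  functions on words, the group acting on the latter by \<open>wact\<close> twisted by the \<open>e\<close>-th inverse
  power of the determinant; \<open>B\<close> is an inverse of \<open>A\<close> on block-alternating functions.\<close>

definition word_model ::
  "nat \<Rightarrow> nat list \<Rightarrow> nat \<Rightarrow> matrix_rep \<Rightarrow> (nat list \<Rightarrow> nat \<Rightarrow> complex) \<Rightarrow> (nat \<Rightarrow> nat list \<Rightarrow> complex) \<Rightarrow> bool" where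
  "word_model m ks e V A B \<longleftrightarrow>
    (\<forall>i<fst V. block_alt m ks (\<lambda>x. A x i)) \<and>
    (\<forall>i<fst V. \<forall>j<fst V. (\<Sum>x\<in>words m (sum_list ks). B i x * A x j) = (if i = j then 1 else 0)) \<and>
    (\<forall>F. block_alt m ks F \<longrightarrow> (\<forall>x\<in>words m (sum_list ks).
      (\<Sum>i<fst V. A x i * (\<Sum>y\<in>words m (sum_list ks). B i y * F y)) = F x)) \<and>
    (\<forall>g\<in>carrier (GL m). snd V g \<in> carrier_mat (fst V) (fst V) \<and> (\<forall>x\<in>words m (sum_list ks). \<forall>j<fst V.
      (\<Sum>y\<in>words m (sum_list ks). wact g x y * A y j) = det g ^ e * (\<Sum>i<fst V. A x i * snd V g $$ (i, j))))"

lemma word_modelD: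
  assumes "word_model m ks e (d, \<rho>) A B"
  shows "\<And>i. i < d \<Longrightarrow> block_alt m ks (\<lambda>x. A x i)"
    "\<And>i j. i < d \<Longrightarrow> j < d \<Longrightarrow> (\<Sum>x\<in>words m (sum_list ks). B i x * A x j) = (if i = j then 1 else 0)"
    "\<And>F x. block_alt m ks F \<Longrightarrow> x \<in> words m (sum_list ks) \<Longrightarrow>
      (\<Sum>i<d. A x i * (\<Sum>y\<in>words m (sum_list ks). B i y * F y)) = F x"
    "\<And>g. g \<in> carrier (GL m) \<Longrightarrow> \<rho> g \<in> carrier_mat d d"
    "\<And>g x j. g \<in> carrier (GL m) \<Longrightarrow> x \<in> words m (sum_list ks) \<Longrightarrow> j < d \<Longrightarrow>
      (\<Sum>y\<in>words m (sum_list ks). wact g x y * A y j) = det g ^ e * (\<Sum>i<d. A x i * \<rho> g $$ (i, j))"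
  using assms by (auto simp: word_model_def)

lemma word_modelI:
  assumes "\<And>i. i < d \<Longrightarrow> block_alt m ks (\<lambda>x. A x i)"
    "\<And>i j. i < d \<Longrightarrow> j < d \<Longrightarrow> (\<Sum>x\<in>words m (sum_list ks). B i x * A x j) = (if i = j then 1 else 0)"
    "\<And>F x. block_alt m ks F \<Longrightarrow> x \<in> words m (sum_list ks) \<Longrightarrow>
      (\<Sum>i<d. A x i * (\<Sum>y\<in>words m (sum_list ks). B i y * F y)) = F x"
    "\<And>g. g \<in> carrier (GL m) \<Longrightarrow> \<rho> g \<in> carrier_mat d d"
    "\<And>g x j. g \<in> carrier (GL m) \<Longrightarrow> x \<in> words m (sum_list ks) \<Longrightarrow> j < d \<Longrightarrow>
      (\<Sum>y\<in>words m (sum_list ks). wact g x y * A y j) = det g ^ e * (\<Sum>i<d. A x i * \<rho> g $$ (i, j))"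
  shows "word_model m ks e (d, \<rho>) A B"
  using assms by (auto simp: word_model_def)

text \<open>The basis functions are the minors of the identity, \<open>B\<close> is evaluation at
  increasing words, and equivariance is Cauchy-Binet.\<close>

lemma word_model_ext_rep:
  "word_model m [k] e (ext_rep m k e) (\<lambda>x i. minor (1\<^sub>m m) x (incs m k ! i)) (\<lambda>i x. if x = incs m k ! i then 1 else 0)"
proof -
  define d where "d = length (incs m k)"
  define R where "R = snd (ext_rep m k e)"
  have ext: "ext_rep m k e = (d, R)" by (simp add: d_def R_def ext_rep_def)
  have w: "incs m k ! i \<in> words m k" if "i < d" for i
    by (rule incs_words[OF incs_nth]) (use that in \<open>simp add: d_def\<close>)
  have del: "(\<Sum>x\<in>words m k. (if x = incs m k ! i then 1 else 0) * F x) = F (incs m k ! i)"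
    if "i < d" for i and F :: "nat list \<Rightarrow> complex"
    using w[OF that] by (simp add: if_distrib[of "\<lambda>c. c * _"] cong: if_cong)
  show ?thesis unfolding ext
  proof (rule word_modelI)
    fix i j assume ij: "i < d" "j < d"
    show "(\<Sum>x\<in>words m (sum_list [k]). (if x = incs m k ! i then 1 else 0) * minor (1\<^sub>m m) x (incs m k ! j))
        = (if i = j then 1 else 0)"
      using ij del[OF ij(1)] by (simp add: minor_one[OF incs_nth incs_nth] incs_eq d_def)
  next
    fix F x assume F: "block_alt m [k] F" and x: "x \<in> words m (sum_list [k])"
    show "(\<Sum>i<d. minor (1\<^sub>m m) x (incs m k ! i) *
        (\<Sum>y\<in>words m (sum_list [k]). (if y = incs m k ! i then 1 else 0) * F y)) = F x"
      using alt_expand[OF F, of x] x del by (simp add: sum_incs d_def)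
  next
    show "R g \<in> carrier_mat d d" for g by (simp add: R_def ext_rep_def d_def)
  next
    fix g x j assume g: "g \<in> carrier (GL m)" and x: "x \<in> words m (sum_list [k])" and j: "j < d"
    hence x: "x \<in> words m k" by simp
    note gc = GL_carrier_mat[OF g]
    have "(\<Sum>y\<in>words m k. wact g x y * minor (1\<^sub>m m) y (incs m k ! j)) = minor (1\<^sub>m m * g) x (incs m k ! j)"
      using wact_minor[OF gc one_carrier_mat x w[OF j]] gc by simp
    also have "\<dots> = (\<Sum>i<d. minor (1\<^sub>m m) x (incs m k ! i) * minor g (incs m k ! i) (incs m k ! j))"
      unfolding Cauchy_Binet[OF one_carrier_mat gc x w[OF j]] sum_incs d_def ..
    also have "\<dots> = (\<Sum>i<d. det g ^ e * (minor (1\<^sub>m m) x (incs m k ! i) * R g $$ (i, j)))"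
    proof (rule sum.cong)
      have "det g ^ e * inverse (det g) ^ e = 1"
        using g by (simp add: power_mult_distrib[symmetric] carrier_GL)
      hence "det g ^ e * (a * (inverse (det g) ^ e * b)) = a * b" for a b
        by (metis (no_types, lifting) mult.assoc mult.left_commute mult_1)
      thus "minor (1\<^sub>m m) x (incs m k ! i) * minor g (incs m k ! i) (incs m k ! j) =
          det g ^ e * (minor (1\<^sub>m m) x (incs m k ! i) * R g $$ (i, j))" if "i \<in> {..<d}" for i
        using that j by (simp add: R_def ext_rep_def d_def)
    qed simp
    finally show "(\<Sum>y\<in>words m (sum_list [k]). wact g x y * minor (1\<^sub>m m) y (incs m k ! j)) =
        det g ^ e * (\<Sum>i<d. minor (1\<^sub>m m) x (incs m k ! i) * R g $$ (i, j))"
      by (simp add: sum_distrib_left)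
  qed (rule minor_block_alt)
qed

lemma word_model_transport:
  assumes M: "word_model m ks e (d', \<rho>') A B"
    and P: "P \<in> carrier_mat d' d" and Q: "Q \<in> carrier_mat d d'" and PQ: "P * Q = 1\<^sub>m d'" and QP: "Q * P = 1\<^sub>m d"
    and rc: "\<And>g. g \<in> carrier (GL m) \<Longrightarrow> \<rho> g \<in> carrier_mat d d"
    and int: "\<And>g. g \<in> carrier (GL m) \<Longrightarrow> P * \<rho> g = \<rho>' g * P"
  shows "word_model m ks e (d, \<rho>) (\<lambda>x j. \<Sum>i<d'. A x i * P $$ (i, j)) (\<lambda>i x. \<Sum>j<d'. Q $$ (i, j) * B j x)"
proof (rule word_modelI)
  note M = word_modelD[OF M]
  show "block_alt m ks (\<lambda>x. \<Sum>i<d'. A x i * P $$ (i, j))" for j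
    using M(1) by (intro block_alt_lin) simp
  fix i j assume ij: "i < d" "j < d"
  have "(\<Sum>x\<in>words m (sum_list ks). (\<Sum>k<d'. Q $$ (i, k) * B k x) * (\<Sum>l<d'. A x l * P $$ (l, j)))
      = (\<Sum>k<d'. \<Sum>l<d'. Q $$ (i, k) * P $$ (l, j) * (\<Sum>x\<in>words m (sum_list ks). B k x * A x l))"
    by (simp add: sum_product sum_distrib_left ac_simps sum.swap[of _ "words m (sum_list ks)"])
  also have "\<dots> = (\<Sum>k<d'. \<Sum>l<d'. if l = k then Q $$ (i, k) * P $$ (k, j) else 0)"
    by (intro sum.cong) (auto simp: M(2))
  also have "\<dots> = (Q * P) $$ (i, j)" unfolding mult_mat_nth[OF Q P ij] by simp
  finally show "(\<Sum>x\<in>words m (sum_list ks). (\<Sum>k<d'. Q $$ (i, k) * B k x) * (\<Sum>l<d'. A x l * P $$ (l, j)))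
      = (if i = j then 1 else 0)" using ij QP by simp
next
  note M = word_modelD[OF M]
  fix F x assume F: "block_alt m ks F" and x: "x \<in> words m (sum_list ks)"
  define b where "b k = (\<Sum>y\<in>words m (sum_list ks). B k y * F y)" for k
  have 1: "(\<Sum>y\<in>words m (sum_list ks). (\<Sum>k<d'. Q $$ (i, k) * B k y) * F y) = (\<Sum>k<d'. Q $$ (i, k) * b k)" for i
    by (simp add: b_def sum_distrib_left sum_distrib_right ac_simps sum.swap[of _ "words m (sum_list ks)"])
  have "(\<Sum>j<d. (\<Sum>l<d'. A x l * P $$ (l, j)) * (\<Sum>k<d'. Q $$ (j, k) * b k)) =
      (\<Sum>l<d'. \<Sum>k<d'. A x l * b k * (\<Sum>j<d. P $$ (l, j) * Q $$ (j, k)))"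
    by (simp add: sum_product sum_distrib_left ac_simps sum.swap[of _ "{..<d}"])
  also have "\<dots> = (\<Sum>l<d'. \<Sum>k<d'. if k = l then A x l * b l else 0)"
    using PQ by (intro sum.cong) (auto simp: mult_mat_nth[OF P Q, symmetric])
  also have "\<dots> = F x" using M(3)[OF F x] by (simp add: b_def)
  finally show "(\<Sum>i<d. (\<Sum>l<d'. A x l * P $$ (l, i)) *
      (\<Sum>y\<in>words m (sum_list ks). (\<Sum>k<d'. Q $$ (i, k) * B k y) * F y)) = F x" by (simp add: 1)
next
  note M = word_modelD[OF M]
  fix g x j assume g: "g \<in> carrier (GL m)" and x: "x \<in> words m (sum_list ks)" and j: "j < d"
  have "(\<Sum>y\<in>words m (sum_list ks). wact g x y * (\<Sum>i<d'. A y i * P $$ (i, j))) =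
      (\<Sum>i<d'. (\<Sum>y\<in>words m (sum_list ks). wact g x y * A y i) * P $$ (i, j))"
    by (simp add: sum_distrib_left sum_distrib_right ac_simps sum.swap[of _ "words m (sum_list ks)"])
  also have "\<dots> = det g ^ e * (\<Sum>l<d'. A x l * (\<Sum>i<d'. \<rho>' g $$ (l, i) * P $$ (i, j)))"
    by (simp add: M(5)[OF g x] sum_distrib_left sum_distrib_right mult.assoc) (subst sum.swap, simp)
  also have "\<dots> = det g ^ e * (\<Sum>l<d'. A x l * (\<Sum>i<d. P $$ (l, i) * \<rho> g $$ (i, j)))"
  proof -
    have "(\<Sum>i<d'. \<rho>' g $$ (l, i) * P $$ (i, j)) = (\<Sum>i<d. P $$ (l, i) * \<rho> g $$ (i, j))" if l: "l < d'" for l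
      using mult_mat_nth[OF M(4)[OF g] P l j] mult_mat_nth[OF P rc[OF g] l j] int[OF g] by simp
    thus ?thesis by simp
  qed
  also have "\<dots> = det g ^ e * (\<Sum>i<d. (\<Sum>l<d'. A x l * P $$ (l, i)) * \<rho> g $$ (i, j))"
    by (simp add: sum_distrib_left sum_distrib_right mult.assoc) (subst sum.swap, simp)
  finally show "(\<Sum>y\<in>words m (sum_list ks). wact g x y * (\<Sum>i<d'. A y i * P $$ (i, j))) =
      det g ^ e * (\<Sum>i<d. (\<Sum>l<d'. A x l * P $$ (l, i)) * \<rho> g $$ (i, j))" .
qed (rule rc)

text \<open>Decodes the lexicographic index of \<open>kronecker\<close> into a pair of
  indices.\<close>

lemma sum_div_mod:
  fixes a b :: nat
  shows "(\<Sum>i<a * b. f (i div b) (i mod b)) = (\<Sum>u<a. \<Sum>v<b. (f u v :: complex))"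
proof -
  have "(\<Sum>u<a. \<Sum>v<b. f u v) = (\<Sum>(u, v)\<in>{..<a} \<times> {..<b}. f u v)"
    by (simp add: sum.cartesian_product)
  also have "\<dots> = (\<Sum>i<a * b. f (i div b) (i mod b))"
  proof (rule sum.reindex_bij_witness[of _ "\<lambda>i. (i div b, i mod b)" "\<lambda>(u, v). u * b + v"])
    fix p assume "p \<in> {..<a} \<times> {..<b}"
    then obtain u v where p: "p = (u, v)" "u < a" "v < b" by auto
    have "u * b + v < Suc u * b" using p by simp
    also have "\<dots> \<le> a * b" using p by (intro mult_right_mono) auto
    finally show "(case p of (u, v) \<Rightarrow> u * b + v) \<in> {..<a * b}" using p by simp
  qed (auto simp: less_mult_imp_div_less intro!: mod_less_divisor Nat.gr0I)
  finally show ?thesis ..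
qed

lemma block_of_Cons_less: "r < k \<Longrightarrow> block_of (k # ks) r = 0"
  and block_of_Cons_add: "block_of (k # ks) (k + r) = Suc (block_of ks r)"
  by auto

lemma swap_append1: "r < length x \<Longrightarrow> s < length x \<Longrightarrow> swap r s (x @ z) = swap r s x @ z"
  and swap_append2: "swap (length x + r) (length x + s) (x @ z) = x @ swap r s z"
  by (auto simp: swap_def nth_append list_update_append)

text \<open>No exchange mixes blocks, so alternation can be tested with either the first block or
  the remaining letters frozen. This opens the way to an induction over the tensor factors.\<close>

lemma block_alt_Cons:
  "block_alt m (k # ks) F \<longleftrightarrow>
    (\<forall>z\<in>words m (sum_list ks). block_alt m [k] (\<lambda>y. F (y @ z))) \<and>
    (\<forall>y\<in>words m k. block_alt m ks (\<lambda>z. F (y @ z)))" (is "?L \<longleftrightarrow> ?R")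
proof
  assume L: ?L
  have "F (swap r s y @ z) = - F (y @ z)"
    if "z \<in> words m (sum_list ks)" "y \<in> words m k" "r < s" "s < k" for y z r s
  proof -
    have "F (swap r s (y @ z)) = - F (y @ z)"
      using L words_append[OF that(2,1)] that(3,4) unfolding block_alt_def by (simp add: block_of_Cons_less)
    thus ?thesis using that words_length[OF that(2)] by (simp add: swap_append1)
  qed
  moreover have "F (y @ swap r s z) = - F (y @ z)"
    if "z \<in> words m (sum_list ks)" "y \<in> words m k" "r < s" "s < sum_list ks" "block_of ks r = block_of ks s" for y z r s
  proof -
    have "block_of (k # ks) (k + r) = block_of (k # ks) (k + s)" "k + s < sum_list (k # ks)" "k + r < k + s"
      using that by (simp_all add: block_of_Cons_add)
    moreover have "y @ z \<in> words m (sum_list (k # ks))" using words_append[OF that(2,1)] by simp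
    ultimately have "F (swap (k + r) (k + s) (y @ z)) = - F (y @ z)"
      using L unfolding block_alt_def by blast
    thus ?thesis using swap_append2[of y r s z] words_length[OF that(2)] by simp
  qed
  ultimately show ?R unfolding block_alt_def[of m ks] block_alt_singleton by blast
next
  assume R: ?R
  show ?L
    unfolding block_alt_def
  proof (intro ballI allI impI)
    fix x r s assume x: "x \<in> words m (sum_list (k # ks))" and rs: "r < s" "s < sum_list (k # ks)"
      "block_of (k # ks) r = block_of (k # ks) s"
    define y z where "y = take k x" and "z = drop k x"
    have yz: "x = y @ z" "y \<in> words m k" "z \<in> words m (sum_list ks)"
      using x words_take[of x m k "sum_list ks"] words_drop[of x m k "sum_list ks"] by (simp_all add: y_def z_def)
    note ly = words_length[OF yz(2)]
    show "F (swap r s x) = - F x"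
    proof (cases "s < k")
      case True
      thus ?thesis using R yz rs ly unfolding block_alt_singleton by (simp add: swap_append1)
    next
      case False
      hence "\<not> r < k" using rs(3) by auto
      define r' s' where "r' = r - k" and "s' = s - k"
      have "r = length y + r'" "s = length y + s'" using False \<open>\<not> r < k\<close> ly by (simp_all add: r'_def s'_def)
      moreover have "block_of ks r' = block_of ks s'" "r' < s'" "s' < sum_list ks"
        using rs False \<open>\<not> r < k\<close> by (auto simp: r'_def s'_def)
      ultimately show ?thesis using R yz(2,3) unfolding yz(1) block_alt_def[of m ks] by (simp add: swap_append2)
    qed
  qed
qed

lemmas block_alt_ConsI = block_alt_Cons[THEN iffD2]
lemmas block_alt_ConsD = block_alt_Cons[THEN iffD1, THEN conjunct1, rule_format]
  block_alt_Cons[THEN iffD1, THEN conjunct2, rule_format]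

lemma block_alt_smult: "block_alt m ks F \<Longrightarrow> block_alt m ks (\<lambda>x. c * F x)"
  "block_alt m ks F \<Longrightarrow> block_alt m ks (\<lambda>x. F x * c)"
  by (auto simp: block_alt_def)

lemma block_alt_cong:
  assumes "block_alt m ks F" "\<And>x. x \<in> words m (sum_list ks) \<Longrightarrow> F x = G x"
  shows "block_alt m ks G"
  unfolding block_alt_def
proof (intro ballI allI impI)
  fix x r s assume *: "x \<in> words m (sum_list ks)" "r < s" "s < sum_list ks" "block_of ks r = block_of ks s"
  hence "swap r s x \<in> words m (sum_list ks)" by (intro swap_words) auto
  thus "G (swap r s x) = - G x" using assms * unfolding block_alt_def by metis
qed

text \<open>The first block of a word carries the first factor, the remaining letters the second. To
  recover \<open>F\<close>, the model of the second factor is applied with the first block fixed,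
  then the model of the first.\<close>

lemma word_model_tensor:
  assumes M1: "word_model m [k] e1 (d1, \<rho>1) A1 B1" and M2: "word_model m ks e2 (d2, \<rho>2) A2 B2"
  shows "word_model m (k # ks) (e1 + e2) (tensor_rep (d1, \<rho>1) (d2, \<rho>2))
    (\<lambda>x i. A1 (take k x) (i div d2) * A2 (drop k x) (i mod d2))
    (\<lambda>i x. B1 (i div d2) (take k x) * B2 (i mod d2) (drop k x))"
proof -
  note M1 = word_modelD[OF M1, simplified] and M2 = word_modelD[OF M2]
  define A where "A = (\<lambda>x i. A1 (take k x) (i div d2) * A2 (drop k x) (i mod d2))"
  define B where "B = (\<lambda>i x. B1 (i div d2) (take k x) * B2 (i mod d2) (drop k x))"
  let ?W1 = "words m k" and ?W2 = "words m (sum_list ks)"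
  have A: "A (y @ z) i = A1 y (i div d2) * A2 z (i mod d2)" if "y \<in> ?W1" for y z i
    using words_length[OF that] by (simp add: A_def)
  have B: "B i (y @ z) = B1 (i div d2) y * B2 (i mod d2) z" if "y \<in> ?W1" for y z i
    using words_length[OF that] by (simp add: B_def)
  have idx: "i div d2 < d1" "i mod d2 < d2" if "i < d1 * d2" for i
    using that less_mult_imp_div_less[OF that] by (auto intro!: mod_less_divisor Nat.gr0I)
  have split: "x \<in> words m (sum_list (k # ks)) \<Longrightarrow> \<exists>y z. x = y @ z \<and> y \<in> ?W1 \<and> z \<in> ?W2" for x
    using words_take[of x m k "sum_list ks"] words_drop[of x m k "sum_list ks"]
    by (metis append_take_drop_id sum_list.Cons)
  have "word_model m (k # ks) (e1 + e2) (d1 * d2, \<lambda>g. kronecker (\<rho>1 g) (\<rho>2 g)) A B"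
  proof (rule word_modelI)
    fix i assume i: "i < d1 * d2"
    show "block_alt m (k # ks) (\<lambda>x. A x i)"
    proof (rule block_alt_ConsI, intro conjI ballI)
      show "block_alt m [k] (\<lambda>y. A (y @ z) i)" if "z \<in> ?W2" for z
        by (rule block_alt_cong[OF block_alt_smult(2)[OF M1(1)[OF idx(1)[OF i]], of "A2 z (i mod d2)"]]) (simp add: A)
      show "block_alt m ks (\<lambda>z. A (y @ z) i)" if "y \<in> ?W1" for y
        by (rule block_alt_cong[OF block_alt_smult(1)[OF M2(1)[OF idx(2)[OF i]], of "A1 y (i div d2)"]]) (simp add: A that)
    qed
    fix j assume j: "j < d1 * d2"
    have "(\<Sum>x\<in>words m (sum_list (k # ks)). B i x * A x j) =
        (\<Sum>y\<in>?W1. \<Sum>z\<in>?W2. (B1 (i div d2) y * A1 y (j div d2)) * (B2 (i mod d2) z * A2 z (j mod d2)))"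
      unfolding sum_list.Cons sum_words_append by (intro sum.cong) (auto simp: A B)
    also have "\<dots> = (\<Sum>y\<in>?W1. B1 (i div d2) y * A1 y (j div d2)) * (\<Sum>z\<in>?W2. B2 (i mod d2) z * A2 z (j mod d2))"
      by (simp add: sum_product)
    also have "\<dots> = (if i = j then 1 else 0)"
      using M1(2)[OF idx(1)[OF i] idx(1)[OF j]] M2(2)[OF idx(2)[OF i] idx(2)[OF j]]
      by (auto simp: sum_product) (metis div_mult_mod_eq)
    finally show "(\<Sum>x\<in>words m (sum_list (k # ks)). B i x * A x j) = (if i = j then 1 else 0)" .
  next
    fix F x assume F: "block_alt m (k # ks) F" and x: "x \<in> words m (sum_list (k # ks))"
    obtain y0 z0 where x: "x = y0 @ z0" and y0: "y0 \<in> ?W1" and z0: "z0 \<in> ?W2" using split[OF x] by blast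
    define b where "b u v = (\<Sum>y\<in>?W1. \<Sum>z\<in>?W2. B1 u y * (B2 v z * F (y @ z)))" for u v
    have "(\<Sum>i<d1 * d2. A x i * (\<Sum>y\<in>words m (sum_list (k # ks)). B i y * F y)) =
        (\<Sum>i<d1 * d2. A1 y0 (i div d2) * A2 z0 (i mod d2) * b (i div d2) (i mod d2))"
    proof -
      have "(\<Sum>y\<in>words m (sum_list (k # ks)). B i y * F y) = b (i div d2) (i mod d2)" for i
        unfolding sum_list.Cons sum_words_append b_def by (intro sum.cong refl) (simp add: B mult.assoc)
      thus ?thesis by (simp add: A x y0)
    qed
    also have "\<dots> = (\<Sum>u<d1. \<Sum>v<d2. A1 y0 u * A2 z0 v * b u v)"
      by (rule sum_div_mod)
    also have "\<dots> = (\<Sum>u<d1. A1 y0 u * (\<Sum>v<d2. A2 z0 v * b u v))"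
      by (simp add: sum_distrib_left mult.assoc)
    also have "\<dots> = (\<Sum>u<d1. A1 y0 u * (\<Sum>y\<in>?W1. B1 u y * F (y @ z0)))"
    proof (intro sum.cong refl arg_cong2[where f = "(*)"])
      fix u
      have "(\<Sum>v<d2. A2 z0 v * b u v) = (\<Sum>v<d2. \<Sum>y\<in>?W1. B1 u y * (A2 z0 v * (\<Sum>z\<in>?W2. B2 v z * F (y @ z))))"
        by (simp add: b_def sum_distrib_left ac_simps)
      also have "\<dots> = (\<Sum>y\<in>?W1. B1 u y * (\<Sum>v<d2. A2 z0 v * (\<Sum>z\<in>?W2. B2 v z * F (y @ z))))"
        by (subst sum.swap) (simp add: sum_distrib_left)
      also have "\<dots> = (\<Sum>y\<in>?W1. B1 u y * F (y @ z0))"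
        by (intro sum.cong) (auto simp: M2(3)[OF block_alt_ConsD(2)[OF F] z0])
      finally show "(\<Sum>v<d2. A2 z0 v * b u v) = (\<Sum>y\<in>?W1. B1 u y * F (y @ z0))" .
    qed
    also have "\<dots> = F x"
      unfolding x by (rule M1(3)[OF block_alt_ConsD(1)[OF F z0] y0])
    finally show "(\<Sum>i<d1 * d2. A x i * (\<Sum>y\<in>words m (sum_list (k # ks)). B i y * F y)) = F x" .
  next
    show "kronecker (\<rho>1 g) (\<rho>2 g) \<in> carrier_mat (d1 * d2) (d1 * d2)" if "g \<in> carrier (GL m)" for g
      using M1(4)[OF that] M2(4)[OF that] by (auto simp: kronecker_def)
  next
    fix g x j assume g: "g \<in> carrier (GL m)" and x: "x \<in> words m (sum_list (k # ks))" and j: "j < d1 * d2"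
    obtain y0 z0 where x: "x = y0 @ z0" and y0: "y0 \<in> ?W1" and z0: "z0 \<in> ?W2" using split[OF x] by blast
    let ?u = "j div d2" and ?v = "j mod d2"
    have "(\<Sum>y\<in>words m (sum_list (k # ks)). wact g x y * A y j) =
        (\<Sum>y\<in>?W1. \<Sum>z\<in>?W2. (wact g y0 y * A1 y ?u) * (wact g z0 z * A2 z ?v))"
      unfolding sum_list.Cons sum_words_append
      by (intro sum.cong) (auto simp: A x wact_append words_length[OF y0] words_length)
    also have "\<dots> = (\<Sum>y\<in>?W1. wact g y0 y * A1 y ?u) * (\<Sum>z\<in>?W2. wact g z0 z * A2 z ?v)"
      by (simp add: sum_product)
    also have "\<dots> = det g ^ (e1 + e2) * ((\<Sum>p<d1. A1 y0 p * \<rho>1 g $$ (p, ?u)) * (\<Sum>q<d2. A2 z0 q * \<rho>2 g $$ (q, ?v)))"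
      using M1(5)[OF g y0 idx(1)[OF j]] M2(5)[OF g z0 idx(2)[OF j]] by (simp add: power_add)
    also have "(\<Sum>p<d1. A1 y0 p * \<rho>1 g $$ (p, ?u)) * (\<Sum>q<d2. A2 z0 q * \<rho>2 g $$ (q, ?v)) =
        (\<Sum>p<d1. \<Sum>q<d2. A1 y0 p * A2 z0 q * (\<rho>1 g $$ (p, ?u) * \<rho>2 g $$ (q, ?v)))"
      by (simp add: sum_product ac_simps)
    also have "\<dots> = (\<Sum>i<d1 * d2. A1 y0 (i div d2) * A2 z0 (i mod d2) * (\<rho>1 g $$ (i div d2, ?u) * \<rho>2 g $$ (i mod d2, ?v)))"
      by (rule sum_div_mod[symmetric])
    also have "\<dots> = (\<Sum>i<d1 * d2. A x i * kronecker (\<rho>1 g) (\<rho>2 g) $$ (i, j))"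
      using M1(4)[OF g] M2(4)[OF g] j by (intro sum.cong) (auto simp: kronecker_def A x y0)
    finally show "(\<Sum>y\<in>words m (sum_list (k # ks)). wact g x y * A y j) =
        det g ^ (e1 + e2) * (\<Sum>i<d1 * d2. A x i * kronecker (\<rho>1 g) (\<rho>2 g) $$ (i, j))" .
  qed
  thus ?thesis by (simp add: tensor_rep_def A_def B_def)
qed

lemma word_model_trivial: "word_model m [] 0 trivial_rep (\<lambda>_ _. 1) (\<lambda>_ _. 1)"
  unfolding trivial_rep_def by (rule word_modelI) (auto simp: block_alt_def wact_def)

text \<open>\<open>ext_rep\<close> shows that the choice in \<open>irrep\<close> is made from a
  nonempty collection; the chosen representation is isomorphic to it, and the model is transported
  along the isomorphism.\<close>

lemma word_model_irrep:
  assumes k: "k \<le> m"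
  shows "\<exists>A B. word_model m [k] e (irrep m (map (\<lambda>a. a - int e) (omega m k))) A B"
proof -
  define \<mu> where "\<mu> = map (\<lambda>a. a - int e) (omega m k)"
  obtain d' \<rho>' where ext: "ext_rep m k e = (d', \<rho>')" by (cases "ext_rep m k e")
  obtain v' where v': "highest_weight_vector m (d', \<rho>') \<mu> v'"
    using ext_rep_highest_weight[OF k, of e] by (auto simp: \<mu>_def ext)
  have rep': "rational_rep m (d', \<rho>')" and irr': "irreducible_rep m (d', \<rho>')"
    using ext_rep_rational[of m k e] ext_rep_irreducible[OF k, of e] by (simp_all add: ext)
  have "irrep_of_highest_weight m \<mu> (d', \<rho>')"
    using rep' irr' v' by (auto simp: irrep_of_highest_weight_def)
  hence irr: "irrep_of_highest_weight m \<mu> (irrep m \<mu>)" unfolding irrep_def by (rule someI)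
  obtain d \<rho> where V: "irrep m \<mu> = (d, \<rho>)" by (cases "irrep m \<mu>")
  obtain v where v: "rational_rep m (d, \<rho>)" "irreducible_rep m (d, \<rho>)" "highest_weight_vector m (d, \<rho>) \<mu> v"
    using irr by (auto simp: irrep_of_highest_weight_def V)
  obtain P Q where PQ: "P \<in> carrier_mat d' d" "Q \<in> carrier_mat d d'" "P * Q = 1\<^sub>m d'" "Q * P = 1\<^sub>m d"
    "\<And>g. g \<in> carrier (GL m) \<Longrightarrow> P * \<rho> g = \<rho>' g * P"
    using irreducible_rep_unique[OF v(1) rep' v(2) irr' v(3) v'] by blast
  from word_model_transport[OF word_model_ext_rep[of m k e, unfolded ext] PQ(1-4) rational_rep_carrier[OF v(1)] PQ(5)]
  show ?thesis unfolding \<mu>_def[symmetric] V by blast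
qed

lemma word_model_tensor_reps:
  assumes "\<forall>p\<in>set ps. fst p \<le> m"
  shows "\<exists>A B. word_model m (map fst ps) (sum_list (map snd ps))
    (tensor_reps (map (\<lambda>(k, e). irrep m (map (\<lambda>a. a - int e) (omega m k))) ps)) A B"
  using assms
proof (induction ps)
  case Nil
  show ?case using word_model_trivial by (auto simp: tensor_reps_def)
next
  case (Cons p ps)
  obtain k e where p: "p = (k, e)" by (cases p)
  define V where "V = irrep m (map (\<lambda>a. a - int e) (omega m k))"
  define W where "W = tensor_reps (map (\<lambda>(k, e). irrep m (map (\<lambda>a. a - int e) (omega m k))) ps)"
  obtain d1 \<rho>1 where V': "V = (d1, \<rho>1)" by (cases V)
  obtain d2 \<rho>2 where W': "W = (d2, \<rho>2)" by (cases W)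
  obtain A1 B1 where 1: "word_model m [k] e V A1 B1"
    using word_model_irrep[of k m e] Cons.prems by (auto simp: p V_def)
  obtain A2 B2 where 2: "word_model m (map fst ps) (sum_list (map snd ps)) W A2 B2"
    using Cons by (auto simp: W_def)
  have "tensor_reps (map (\<lambda>(k, e). irrep m (map (\<lambda>a. a - int e) (omega m k))) (p # ps)) = tensor_rep V W"
    by (simp add: tensor_reps_def V_def W_def p)
  thus ?case using word_model_tensor[OF 1[unfolded V'] 2[unfolded W']] by (auto simp: p V' W')
qed

section \<open>Leading words of invariants\<close>

text \<open>Clearing the twists turns invariance into semi-invariance; \<open>N\<close> is the total
  exponent of the inverse determinant in the tensor product.\<close>

definition inv_fun :: "nat \<Rightarrow> nat list \<Rightarrow> nat \<Rightarrow> (nat list \<Rightarrow> complex) \<Rightarrow> bool" where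
  "inv_fun m ks N F \<longleftrightarrow> block_alt m ks F \<and> (\<forall>g\<in>carrier (GL m). \<forall>x\<in>words m (sum_list ks).
    (\<Sum>y\<in>words m (sum_list ks). wact g x y * F y) = det g ^ N * F x)"

definition ct :: "nat list \<Rightarrow> nat \<Rightarrow> nat \<Rightarrow> nat" where
  "ct x t a = card {r. r < t \<and> x ! r = a}"

text \<open>The counts \<open>ct x t\<close> form a growing chain of partitions, one box per letter,
  ending in the rectangle with \<open>m\<close> rows of length \<open>N\<close>.\<close>

definition lattice_block_word :: "nat \<Rightarrow> nat list \<Rightarrow> nat \<Rightarrow> nat list \<Rightarrow> bool" where
  "lattice_block_word m ks N x \<longleftrightarrow> x \<in> words m (sum_list ks) \<and> block_inc ks x \<and>
    (\<forall>a<m. ct x (sum_list ks) a = N) \<and>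
    (\<forall>t\<le>sum_list ks. \<forall>a. Suc a < m \<longrightarrow> ct x t (Suc a) \<le> ct x t a)"

lemma ct_append:
  assumes "length x = t"
  shows "ct (x @ z) (t + l) a = ct x t a + ct z l a"
proof -
  have "{r. r < t + l \<and> (x @ z) ! r = a} = {r. r < t \<and> x ! r = a} \<union> (+) t ` {r. r < l \<and> z ! r = a}"
  proof (intro equalityI subsetI)
    fix r assume r: "r \<in> {r. r < t + l \<and> (x @ z) ! r = a}"
    show "r \<in> {r. r < t \<and> x ! r = a} \<union> (+) t ` {r. r < l \<and> z ! r = a}"
    proof (cases "r < t")
      case False
      hence "r = t + (r - t)" by simp
      thus ?thesis using r assms False by (intro UnI2 image_eqI[of _ _ "r - t"]) (auto simp: nth_append)
    qed (use r assms in \<open>auto simp: nth_append\<close>)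
  qed (use assms in \<open>auto simp: nth_append\<close>)
  moreover have "card ({r. r < t \<and> x ! r = a} \<union> (+) t ` {r. r < l \<and> z ! r = a}) =
      card {r. r < t \<and> x ! r = a} + card ((+) t ` {r. r < l \<and> z ! r = a})"
    by (rule card_Un_disjoint) auto
  moreover have "card ((+) t ` {r. r < l \<and> z ! r = a}) = card {r. r < l \<and> z ! r = a}"
    by (rule card_image) simp
  ultimately show ?thesis by (simp add: ct_def)
qed

lemma ct_take: "t \<le> length x \<Longrightarrow> ct (take t x) t a = ct x t a"
  unfolding ct_def by (intro arg_cong[where f = card]) auto

definition diag_mat_of :: "nat \<Rightarrow> (nat \<Rightarrow> complex) \<Rightarrow> complex mat" where
  "diag_mat_of m c = mat m m (\<lambda>(i, j). if i = j then c i else 0)"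

lemma wact_diag:
  assumes x: "x \<in> words m K" and y: "y \<in> words m K"
  shows "wact (diag_mat_of m c) x y = (if x = y then \<Prod>r<K. c (x ! r) else 0)"
proof (cases "x = y")
  case True
  thus ?thesis using words_nth[OF x] words_length[OF x] by (auto simp: wact_def diag_mat_of_def intro!: prod.cong)
next
  case False
  then obtain r where r: "r < K" "x ! r \<noteq> y ! r"
    using words_length[OF x] words_length[OF y] by (metis nth_equalityI)
  hence "diag_mat_of m c $$ (x ! r, y ! r) = 0"
    using words_nth[OF x] words_nth[OF y] by (simp add: diag_mat_of_def)
  hence "wact (diag_mat_of m c) x y = 0" using r words_length[OF x] unfolding wact_def by (intro prod_zero) auto
  thus ?thesis using False by simp
qed

lemma wact_dilation:
  assumes "x \<in> words m K" "y \<in> words m K"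
  shows "wact (dilation m a) x y = (if x = y then 2 ^ ct x K a else 0)"
proof -
  have "dilation m a = diag_mat_of m (\<lambda>i. if i = a then 2 else 1)" by (simp add: dilation_def diag_mat_of_def)
  moreover have "(\<Prod>r<K. if x ! r = a then 2 else 1) = (2 :: complex) ^ ct x K a"
    by (simp add: prod.If_cases ct_def Int_def conj_commute)
  ultimately show ?thesis using wact_diag[OF assms, of "\<lambda>i. if i = a then 2 else 1"]
    by (cases "x = y") auto
qed

text \<open>The dilation of the letter \<open>a\<close> multiplies \<open>F x\<close> by 2 to the
  number of its occurrences, while its determinant contributes \<open>2 ^ N\<close>.\<close>

lemma inv_fun_content:
  assumes F: "inv_fun m ks N F" and x: "x \<in> words m (sum_list ks)" "F x \<noteq> 0" and a: "a < m"
  shows "ct x (sum_list ks) a = N"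
proof -
  let ?K = "sum_list ks"
  have "(\<Sum>y\<in>words m ?K. wact (dilation m a) x y * F y) = det (dilation m a) ^ N * F x"
    using F dilation_GL[OF a] x(1) unfolding inv_fun_def by blast
  moreover have "(\<Sum>y\<in>words m ?K. wact (dilation m a) x y * F y) = (\<Sum>y\<in>words m ?K. if x = y then 2 ^ ct x ?K a * F x else 0)"
    by (rule sum.cong) (auto simp: wact_dilation[OF x(1)])
  ultimately have "(2 :: complex) ^ ct x ?K a = 2 ^ N" using x by (simp add: det_dilation[OF a])
  hence "of_nat (2 ^ ct x ?K a) = (of_nat (2 ^ N) :: complex)" by simp
  hence "(2 :: nat) ^ ct x ?K a = 2 ^ N" by (rule of_nat_eq_iff[THEN iffD1])
  thus ?thesis by simp
qed

section \<open>Root subgroups and a Hermitian form on functions of words\<close>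

definition lowr :: "nat \<Rightarrow> nat \<Rightarrow> complex \<Rightarrow> complex mat" where
  "lowr m a s = mat m m (\<lambda>(i, j). if i = j then 1 else if i = Suc a \<and> j = a then s else 0)"

definition uppr :: "nat \<Rightarrow> nat \<Rightarrow> complex \<Rightarrow> complex mat" where
  "uppr m a s = mat m m (\<lambda>(i, j). if i = j then 1 else if i = a \<and> j = Suc a then s else 0)"

lemma lowr_carrier [simp]: "lowr m a s \<in> carrier_mat m m"
  and uppr_carrier [simp]: "uppr m a s \<in> carrier_mat m m"
  and diag_mat_of_carrier [simp]: "diag_mat_of m c \<in> carrier_mat m m"
  by (simp_all add: lowr_def uppr_def diag_mat_of_def)

lemma det_lowr: "det (lowr m a s) = 1"
  by (rule det_lower_unitriangular[of m]) (auto simp: lower_unitriangular_def lowr_def)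

lemma lowr_mult:
  assumes "B \<in> carrier_mat m m" "i < m" "j < m" "Suc a < m"
  shows "(lowr m a s * B) $$ (i, j) = B $$ (i, j) + (if i = Suc a then s * B $$ (a, j) else 0)"
proof -
  have "(lowr m a s * B) $$ (i, j) = (\<Sum>k<m. (if k = i then B $$ (i, j) else 0) +
      (if k = a then (if i = Suc a then s * B $$ (a, j) else 0) else 0))"
    unfolding mult_mat_nth[OF lowr_carrier assms(1-3)] using assms
    by (intro sum.cong) (auto simp: lowr_def)
  thus ?thesis using assms by (simp add: sum.distrib)
qed

lemma uppr_mult:
  assumes "B \<in> carrier_mat m m" "i < m" "j < m" "Suc a < m"
  shows "(uppr m a s * B) $$ (i, j) = B $$ (i, j) + (if i = a then s * B $$ (Suc a, j) else 0)"
proof -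
  have "(uppr m a s * B) $$ (i, j) = (\<Sum>k<m. (if k = i then B $$ (i, j) else 0) +
      (if k = Suc a then (if i = a then s * B $$ (Suc a, j) else 0) else 0))"
    unfolding mult_mat_nth[OF uppr_carrier assms(1-3)] using assms
    by (intro sum.cong) (auto simp: uppr_def)
  thus ?thesis using assms by (simp add: sum.distrib)
qed

lemma diag_mult:
  assumes "B \<in> carrier_mat m m" "i < m" "j < m"
  shows "(diag_mat_of m c * B) $$ (i, j) = c i * B $$ (i, j)"
proof -
  have "(diag_mat_of m c * B) $$ (i, j) = (\<Sum>k<m. if k = i then c i * B $$ (i, j) else 0)"
    unfolding mult_mat_nth[OF diag_mat_of_carrier assms] using assms
    by (intro sum.cong) (auto simp: diag_mat_of_def)
  thus ?thesis using assms by simp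
qed

text \<open>In the plane of \<open>a\<close> and \<open>Suc a\<close> both sides are the matrix with
  rows \<open>(1, 1)\<close> and \<open>(1, 2)\<close>, on the right factored from its lower right
  entry 2; hence 2 and, by determinant 1, also 1/2 on the diagonal.\<close>

lemma lowr_uppr:
  assumes a: "Suc a < m"
  shows "lowr m a 1 * uppr m a 1 = uppr m a (1/2) * (diag_mat_of m (\<lambda>i. if i = a then 1/2 else if i = Suc a then 2 else 1) * lowr m a (1/2))"
    (is "_ = _ * (?D * _)")
proof (rule eq_matI)
  have c: "?D * lowr m a (1/2) \<in> carrier_mat m m" by (rule mult_carrier_mat[OF diag_mat_of_carrier lowr_carrier])
  fix i j assume "i < dim_row (uppr m a (1/2) * (?D * lowr m a (1/2)))" "j < dim_col (uppr m a (1/2) * (?D * lowr m a (1/2)))"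
  hence ij: "i < m" "j < m" by (simp_all add: uppr_def lowr_def)
  show "(lowr m a 1 * uppr m a 1) $$ (i, j) = (uppr m a (1/2) * (?D * lowr m a (1/2))) $$ (i, j)"
    unfolding lowr_mult[OF uppr_carrier ij a] uppr_mult[OF c ij a]
      diag_mult[OF lowr_carrier ij] diag_mult[OF lowr_carrier a ij(2)]
    using ij a by (auto simp: lowr_def uppr_def)
qed (simp_all add: uppr_def lowr_def)

definition wop :: "nat \<Rightarrow> nat \<Rightarrow> complex mat \<Rightarrow> (nat list \<Rightarrow> complex) \<Rightarrow> nat list \<Rightarrow> complex" where
  "wop m l g w z = (\<Sum>z'\<in>words m l. wact g z z' * w z')"

definition wip :: "nat \<Rightarrow> nat \<Rightarrow> (nat list \<Rightarrow> complex) \<Rightarrow> (nat list \<Rightarrow> complex) \<Rightarrow> complex" where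
  "wip m l f h = (\<Sum>z\<in>words m l. f z * cnj (h z))"

lemma wop_mult:
  assumes "g \<in> carrier_mat m m" "h \<in> carrier_mat m m" "z \<in> words m l"
  shows "wop m l (g * h) w z = wop m l g (wop m l h w) z"
proof -
  have "wop m l (g * h) w z = (\<Sum>z'\<in>words m l. \<Sum>y\<in>words m l. wact g z y * wact h y z' * w z')"
    unfolding wop_def by (intro sum.cong) (auto simp: wact_mult[OF assms] sum_distrib_right)
  also have "\<dots> = wop m l g (wop m l h w) z"
    unfolding wop_def by (subst sum.swap) (simp add: sum_distrib_left mult.assoc)
  finally show ?thesis .
qed

text \<open>The adjoint of a tensor power is the tensor power of the conjugate transpose; for real
  parameters this exchanges \<open>lowr\<close> and \<open>uppr\<close>.\<close>

lemma wip_adjoint: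
  assumes "\<And>i j. i < m \<Longrightarrow> j < m \<Longrightarrow> A $$ (i, j) = cnj (B $$ (j, i))"
  shows "wip m l (wop m l A f) h = wip m l f (wop m l B h)"
proof -
  have "wact A z z' = cnj (wact B z' z)" if "z \<in> words m l" "z' \<in> words m l" for z z'
    using assms words_nth[OF that(1)] words_nth[OF that(2)] that
    by (auto simp: wact_def words_length intro!: prod.cong)
  hence "wip m l (wop m l A f) h = (\<Sum>z\<in>words m l. \<Sum>z'\<in>words m l. f z' * (cnj (wact B z' z) * cnj (h z)))"
    unfolding wip_def wop_def by (intro sum.cong refl) (auto simp: sum_distrib_left sum_distrib_right ac_simps intro!: sum.cong)
  also have "\<dots> = wip m l f (wop m l B h)"
    unfolding wip_def wop_def by (subst sum.swap) (simp add: sum_distrib_left)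
  finally show ?thesis .
qed

lemma wip_cong: "(\<And>z. z \<in> words m l \<Longrightarrow> f z = f' z) \<Longrightarrow> (\<And>z. z \<in> words m l \<Longrightarrow> h z = h' z) \<Longrightarrow> wip m l f h = wip m l f' h'"
  by (auto simp: wip_def intro!: sum.cong)

lemma wip_self: "wip m l f f = complex_of_real (\<Sum>z\<in>words m l. (cmod (f z))\<^sup>2)"
  by (simp only: wip_def of_real_sum complex_norm_square)

text \<open>With \<open>u = uppr m a 1\<close>, unitarity and \<open>lowr_uppr\<close> give
  \<open>\<bar>u w - w\<bar>\<^sup>2 = (2 ^ q / 2 ^ p - 1) \<bar>w\<bar>\<^sup>2\<close>.\<close>

lemma lowest_weight_antidominant:
  assumes a: "Suc a < m"
    and fix1: "\<And>s z. z \<in> words m l \<Longrightarrow> wop m l (lowr m a s) w z = w z"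
    and wt: "\<And>z. z \<in> words m l \<Longrightarrow> w z \<noteq> 0 \<Longrightarrow> ct z l a = p \<and> ct z l (Suc a) = q"
    and z0: "z0 \<in> words m l" "w z0 \<noteq> 0"
  shows "p \<le> q"
proof -
  define D where "D = diag_mat_of m (\<lambda>i. if i = a then 1/2 else if i = Suc a then 2 else (1 :: complex))"
  define c where "c = (1/2 :: complex) ^ p * 2 ^ q"
  define u where "u = wop m l (uppr m a 1) w"
  let ?W = "wip m l w w"
  have adj: "wip m l (wop m l (uppr m a s) f) h = wip m l f (wop m l (lowr m a s) h)"
    "wip m l (wop m l (lowr m a s) f) h = wip m l f (wop m l (uppr m a s) h)" if "s \<in> \<real>" for s f h
    using that by (intro wip_adjoint; auto simp: uppr_def lowr_def Reals_cnj_iff)+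
  have half: "(1/2 :: complex) \<in> \<real>" by simp
  have Dw: "wop m l D w z = c * w z" if z: "z \<in> words m l" for z
  proof -
    have "wop m l D w z = (\<Sum>z'\<in>words m l. if z = z' then (\<Prod>r<l. if z ! r = a then 1/2 else if z ! r = Suc a then 2 else 1) * w z else 0)"
      unfolding wop_def D_def by (intro sum.cong) (auto simp: wact_diag[OF z])
    hence 1: "wop m l D w z = (\<Prod>r<l. if z ! r = a then 1/2 else if z ! r = Suc a then 2 else 1) * w z"
      using z by simp
    show ?thesis
    proof (cases "w z = 0")
      case False
      have "(\<Prod>r<l. if z ! r = a then 1/2 else if z ! r = Suc a then 2 else 1) =
          (\<Prod>r<l. (if z ! r = a then 1/2 else 1) * (if z ! r = Suc a then 2 else 1 :: complex))"
        by (rule prod.cong) auto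
      also have "\<dots> = (1/2) ^ ct z l a * 2 ^ ct z l (Suc a)"
        by (simp add: prod.distrib prod.If_cases ct_def Int_def conj_commute)
      finally show ?thesis using 1 wt[OF z False] by (simp add: c_def)
    qed (simp add: 1)
  qed
  \<comment> \<open>Move one \<open>uppr\<close> across as \<open>lowr\<close>, rewrite the product
    by \<open>lowr_uppr\<close>, and move the new \<open>uppr\<close> back as \<open>lowr\<close>.
    Since \<open>lowr\<close> fixes \<open>w\<close>, only the diagonal factor remains.\<close>
  have uu: "wip m l u u = c * ?W"
  proof -
    have "wip m l u u = wip m l u (wop m l (uppr m a 1) w)" by (simp add: u_def)
    also have "\<dots> = wip m l (wop m l (lowr m a 1) u) w" by (rule adj(2)[symmetric]) simp
    also have "\<dots> = wip m l (wop m l (uppr m a (1/2)) (wop m l D (wop m l (lowr m a (1/2)) w))) w"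
    proof (rule wip_cong)
      fix z assume z: "z \<in> words m l"
      have "wop m l (lowr m a 1) u z = wop m l (lowr m a 1 * uppr m a 1) w z"
        unfolding u_def by (rule wop_mult[symmetric, OF lowr_carrier uppr_carrier z])
      also have "\<dots> = wop m l (uppr m a (1/2)) (wop m l (D * lowr m a (1/2)) w) z"
        unfolding lowr_uppr[OF a] D_def[symmetric]
        unfolding D_def by (rule wop_mult[OF uppr_carrier mult_carrier_mat[OF diag_mat_of_carrier lowr_carrier] z])
      also have "\<dots> = wop m l (uppr m a (1/2)) (wop m l D (wop m l (lowr m a (1/2)) w)) z"
        unfolding wop_def[of m l "uppr m a (1/2)"]
        by (intro sum.cong) (auto simp: wop_mult[OF _ lowr_carrier] D_def)
      finally show "wop m l (lowr m a 1) u z = \<dots>" .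
    qed simp
    also have "\<dots> = wip m l (wop m l D (wop m l (lowr m a (1/2)) w)) (wop m l (lowr m a (1/2)) w)"
      by (rule adj(1)[OF half])
    also have "\<dots> = wip m l (wop m l D w) w"
    proof (rule wip_cong)
      fix z assume z: "z \<in> words m l"
      show "wop m l D (wop m l (lowr m a (1/2)) w) z = wop m l D w z"
        unfolding wop_def[of m l D] by (intro sum.cong) (auto simp: fix1)
    qed (rule fix1)
    also have "\<dots> = wip m l (\<lambda>z. c * w z) w" by (rule wip_cong) (auto simp: Dw)
    finally show ?thesis by (simp add: wip_def sum_distrib_left mult.assoc)
  qed
  have uw: "wip m l u w = ?W"
  proof -
    have "wip m l u w = wip m l w (wop m l (lowr m a 1) w)" unfolding u_def by (rule adj(1)) simp
    also have "\<dots> = ?W" by (rule wip_cong) (auto simp: fix1)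
    finally show ?thesis .
  qed
  have wu: "wip m l w u = ?W"
  proof -
    have "wip m l w u = wip m l (wop m l (lowr m a 1) w) w" unfolding u_def by (rule adj(2)[symmetric]) simp
    also have "\<dots> = ?W" by (rule wip_cong) (auto simp: fix1)
    finally show ?thesis .
  qed
  have "wip m l (\<lambda>z. u z - w z) (\<lambda>z. u z - w z) = wip m l u u - wip m l u w - wip m l w u + ?W"
    by (simp add: wip_def algebra_simps sum.distrib sum_subtractf)
  hence "wip m l (\<lambda>z. u z - w z) (\<lambda>z. u z - w z) = (c - 1) * ?W"
    by (simp add: uu uw wu algebra_simps)
  moreover define cr where "cr = (1/2 :: real) ^ p * 2 ^ q"
  have "c = complex_of_real cr" by (simp add: c_def cr_def)
  ultimately have "complex_of_real (\<Sum>z\<in>words m l. (cmod (u z - w z))\<^sup>2) =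
      complex_of_real ((cr - 1) * (\<Sum>z\<in>words m l. (cmod (w z))\<^sup>2))"
    by (simp add: wip_self)
  hence "(cr - 1) * (\<Sum>z\<in>words m l. (cmod (w z))\<^sup>2) = (\<Sum>z\<in>words m l. (cmod (u z - w z))\<^sup>2)"
    by (simp only: of_real_eq_iff)
  also have "\<dots> \<ge> 0" by (rule sum_nonneg) simp
  finally have "(cr - 1) * (\<Sum>z\<in>words m l. (cmod (w z))\<^sup>2) \<ge> 0" .
  moreover have "(\<Sum>z\<in>words m l. (cmod (w z))\<^sup>2) > 0"
    by (rule sum_pos2[OF finite_words z0(1)]) (use z0 in auto)
  \<comment> \<open>If \<open>cr < 1\<close>, the squared length of \<open>u - w\<close> would be
    negative, as \<open>w\<close> is nonzero.\<close>
  ultimately have "cr \<ge> 1" by (simp add: zero_le_mult_iff)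
  hence "2 ^ q \<ge> (2 :: real) ^ p" by (simp add: cr_def power_divide field_simps)
  thus ?thesis by simp
qed

lemma lexn_pointwise:
  fixes u v :: "nat list"
  assumes "length u = t" "length v = t" "u \<noteq> v" "\<And>r. r < t \<Longrightarrow> u ! r \<le> v ! r"
    and "length z = l" "length z' = l"
  shows "(u @ z, v @ z') \<in> lexn less_than (t + l)"
proof -
  have "\<exists>r. r < t \<and> u ! r \<noteq> v ! r" using assms(1-3) by (metis nth_equalityI)
  then obtain r where r: "r < t" "u ! r \<noteq> v ! r" and min: "\<And>s. s < r \<Longrightarrow> \<not> (s < t \<and> u ! s \<noteq> v ! s)"
    using exists_least_iff[of "\<lambda>r. r < t \<and> u ! r \<noteq> v ! r"] by blast
  have "take r u = take r v"
    by (rule nth_equalityI) (use assms r min in auto)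
  moreover have "u = take r u @ u ! r # drop (Suc r) u" "v = take r v @ v ! r # drop (Suc r) v"
    using r assms by (auto intro: id_take_nth_drop)
  ultimately have "u @ z = take r u @ u ! r # (drop (Suc r) u @ z)" "v @ z' = take r u @ v ! r # (drop (Suc r) v @ z')"
    by (metis append.assoc append_Cons)+
  moreover have "u ! r < v ! r" using assms(4)[OF r(1)] r(2) by simp
  ultimately show ?thesis using assms unfolding lexn_conv by fastforce
qed

text \<open>\<open>lowr\<close> can only replace a letter \<open>Suc a\<close> by \<open>a\<close>,
  so it connects the prefix \<open>P\<close> with itself and with prefixes that are pointwise, hence
  lexicographically, smaller, where \<open>F\<close> vanishes. So the suffix function
  \<open>w\<close> is fixed by every \<open>lowr m a s\<close>, and its weight is \<open>N\<close>
  minus the content of \<open>P\<close>: antidominance of the former is dominance of the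
  latter.\<close>

theorem lex_min_good:
  assumes F: "inv_fun m ks N F" and x: "x \<in> words m (sum_list ks)" "F x \<noteq> 0"
    and min: "\<And>y. y \<in> words m (sum_list ks) \<Longrightarrow> (y, x) \<in> lexn less_than (sum_list ks) \<Longrightarrow> F y = 0"
  shows "lattice_block_word m ks N x"
proof -
  define K where "K = sum_list ks"
  have alt: "block_alt m ks F" using F by (simp add: inv_fun_def)
  have "ct x t (Suc a) \<le> ct x t a" if t: "t \<le> K" and a: "Suc a < m" for t a
  proof -
    define P l where "P = take t x" and "l = K - t"
    have K: "K = t + l" using t by (simp add: l_def)
    have xK: "x \<in> words m (t + l)" using x(1) by (simp add: K_def[symmetric] K)
    have P: "P \<in> words m t" and d: "drop t x \<in> words m l"
      using words_take[OF xK] words_drop[OF xK] by (simp_all add: P_def)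
    have xP: "x = P @ drop t x" by (simp add: P_def)
    define w where "w z = F (P @ z)" for z
    have fix1: "wop m l (lowr m a s) w z = w z" if z: "z \<in> words m l" for s z
    proof -
      have g: "lowr m a s \<in> carrier (GL m)" by (simp add: carrier_GL det_lowr)
      have "(\<Sum>y\<in>words m (t + l). wact (lowr m a s) (P @ z) y * F y) = F (P @ z)"
        using F g words_append[OF P z] det_lowr[of m a s] K unfolding inv_fun_def K_def by auto
      moreover have "(\<Sum>y\<in>words m (t + l). wact (lowr m a s) (P @ z) y * F y) =
          (\<Sum>P'\<in>words m t. \<Sum>z'\<in>words m l. if P' = P then wact (lowr m a s) z z' * F (P @ z') else 0)"
        unfolding sum_words_append
      proof (intro sum.cong refl)
        fix P' z' assume P': "P' \<in> words m t" and z': "z' \<in> words m l"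
        have ap: "wact (lowr m a s) (P @ z) (P' @ z') = wact (lowr m a s) P P' * wact (lowr m a s) z z'"
          by (rule wact_append) (simp add: words_length[OF P] words_length[OF P'])
        show "wact (lowr m a s) (P @ z) (P' @ z') * F (P' @ z') =
            (if P' = P then wact (lowr m a s) z z' * F (P @ z') else 0)"
        proof (cases "P' = P")
          case True
          have "wact (lowr m a s) P P = 1"
            unfolding wact_def using words_nth[OF P] words_length[OF P] by (intro prod.neutral) (auto simp: lowr_def)
          thus ?thesis using True ap by simp
        next
          case False
          show ?thesis
          proof (cases "wact (lowr m a s) P P' = 0")
            case nz: False
            have "P' ! r \<le> P ! r" if r: "r < t" for r
            proof (rule ccontr)
              assume "\<not> ?thesis"
              hence "lowr m a s $$ (P ! r, P' ! r) = 0"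
                using words_nth[OF P r] words_nth[OF P' r] by (auto simp: lowr_def)
              hence "wact (lowr m a s) P P' = 0"
                unfolding wact_def using r words_length[OF P] by (intro prod_zero) auto
              thus False using nz by simp
            qed
            hence "(P' @ z', P @ drop t x) \<in> lexn less_than (t + l)"
              using False words_length[OF P] words_length[OF P'] words_length[OF z'] words_length[OF d]
              by (intro lexn_pointwise) auto
            hence "(P' @ z', x) \<in> lexn less_than (sum_list ks)" using xP K by (simp add: K_def)
            hence "F (P' @ z') = 0" using min words_append[OF P' z'] K by (simp add: K_def)
            thus ?thesis using False by simp
          qed (use False ap in simp)
        qed
      qed
      moreover have "(\<Sum>P'\<in>words m t. \<Sum>z'\<in>words m l. if P' = P then wact (lowr m a s) z z' * F (P @ z') else 0) =
          (\<Sum>P'\<in>words m t. if P' = P then wop m l (lowr m a s) w z else 0)"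
        by (rule sum.cong) (auto simp: wop_def w_def)
      ultimately show ?thesis using P by (simp add: w_def)
    qed
    have cN: "ct (P @ z) K b = N" if "z \<in> words m l" "w z \<noteq> 0" "b < m" for z b
      using inv_fun_content[OF F, of "P @ z" b] words_append[OF P that(1)] that K by (simp add: K_def w_def)
    have ctz: "ct P t b + ct z l b = N" if "z \<in> words m l" "w z \<noteq> 0" "b < m" for z b
      using cN[OF that] ct_append[OF words_length[OF P], of z l b] by (simp add: K)
    have wx: "w (drop t x) \<noteq> 0" using x(2) xP by (simp add: w_def)
    have "N - ct P t a \<le> N - ct P t (Suc a)"
    proof (rule lowest_weight_antidominant[OF a fix1 _ d wx])
      fix z assume "z \<in> words m l" "w z \<noteq> 0"
      from ctz[OF this, of a] ctz[OF this, of "Suc a"] a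
      show "ct z l a = N - ct P t a \<and> ct z l (Suc a) = N - ct P t (Suc a)" by auto
    qed
    moreover have "ct P t a \<le> N" "ct P t (Suc a) \<le> N" using ctz[OF d wx] a by (metis Suc_lessD le_add1)+
    ultimately have "ct P t (Suc a) \<le> ct P t a" by simp
    thus ?thesis using ct_take[of t x] words_length[OF xK] by (simp add: P_def)
  qed
  moreover have "block_inc ks x" by (rule lex_min_block_inc[OF alt x min])
  ultimately show ?thesis using x inv_fun_content[OF F x] by (simp add: lattice_block_word_def K_def)
qed

text \<open>The upper bound on the dimension: an invariant is determined by its values at the
  lattice words.\<close>

corollary inv_fun_zero:
  assumes F: "inv_fun m ks N F" and zero: "\<And>x. lattice_block_word m ks N x \<Longrightarrow> F x = 0" and x: "x \<in> words m (sum_list ks)"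
  shows "F x = 0"
proof (rule ccontr)
  assume "F x \<noteq> 0"
  from ex_lex_min[of x m "sum_list ks" F, OF x this]
  obtain y where "y \<in> words m (sum_list ks)" "F y \<noteq> 0"
    "\<And>z. z \<in> words m (sum_list ks) \<Longrightarrow> (z, y) \<in> lexn less_than (sum_list ks) \<Longrightarrow> F z = 0" by blast
  thus False using lex_min_good[OF F] zero by blast
qed

section \<open>Invariants with a prescribed leading word\<close>

lemma ct_Suc: "ct x (Suc t) a = ct x t a + (if x ! t = a then 1 else 0)"
proof -
  have "{r. r < Suc t \<and> x ! r = a} = {r. r < t \<and> x ! r = a} \<union> (if x ! t = a then {t} else {})"
    by (auto simp: less_Suc_eq)
  thus ?thesis by (simp add: ct_def)
qed

lemma ct_0 [simp]: "ct x 0 a = 0"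
  by (simp add: ct_def)

lemma ct_mono: "s \<le> t \<Longrightarrow> ct x s a \<le> ct x t a"
  unfolding ct_def by (rule card_mono) auto

lemma block_of_mono: "r \<le> s \<Longrightarrow> s < sum_list ks \<Longrightarrow> block_of ks r \<le> block_of ks s"
  by (induction ks arbitrary: r s) auto

lemma block_of_less: "r < sum_list ks \<Longrightarrow> block_of ks r < length ks"
  by (induction ks arbitrary: r) auto

locale lattice_word =
  fixes m :: nat and ks :: "nat list" and N :: nat and x :: "nat list"
  assumes lattice_block_word: "lattice_block_word m ks N x"
begin

abbreviation "K \<equiv> sum_list ks"

text \<open>Letter number \<open>r\<close> of \<open>x\<close> fills the box in row
  \<open>x ! r\<close> and column \<open>col r\<close> of the rectangle.\<close>

definition col :: "nat \<Rightarrow> nat" where "col r = ct x r (x ! r)"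

lemma x_words: "x \<in> words m K" and x_inc: "block_inc ks x" and ct_K: "a < m \<Longrightarrow> ct x K a = N"
  using lattice_block_word by (auto simp: lattice_block_word_def)

lemma x_less: "r < K \<Longrightarrow> x ! r < m"
  using words_nth[OF x_words] .

lemma ct_antimono:
  assumes "t \<le> K" "a \<le> b" "b < m"
  shows "ct x t b \<le> ct x t a"
  using assms(2,3)
proof (induction b rule: dec_induct)
  case (step b)
  have "ct x t (Suc b) \<le> ct x t b" using lattice_block_word assms(1) step.prems unfolding lattice_block_word_def by blast
  thus ?case using step by simp
qed simp

lemma col_less: "r < K \<Longrightarrow> col r < N"
  using ct_mono[of "Suc r" K x "x ! r"] ct_K[OF x_less, of r] by (simp add: col_def ct_Suc)

lemma same_letter_col: "r < s \<Longrightarrow> x ! r = x ! s \<Longrightarrow> col r < col s"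
  using ct_mono[of "Suc r" s x "x ! r"] by (simp add: col_def ct_Suc)

text \<open>Columns fill downwards: when a letter has been read, every smaller letter has occurred
  at least as often, so in its column the smaller letters came before it.\<close>

lemma same_col_letter:
  assumes "r < s" "s < K" "col r = col s"
  shows "x ! r < x ! s"
proof (rule ccontr)
  assume "\<not> ?thesis"
  moreover have "x ! r \<noteq> x ! s" using same_letter_col[OF assms(1)] assms(3) by auto
  ultimately have lt: "x ! s < x ! r" by simp
  have "Suc (col r) = ct x (Suc r) (x ! r)" by (simp add: ct_Suc col_def)
  also have "\<dots> \<le> ct x (Suc r) (x ! s)" using assms lt x_less[of r] by (intro ct_antimono) auto
  also have "\<dots> \<le> ct x s (x ! s)" using assms by (intro ct_mono) simp
  finally show False using assms(3) by (simp add: col_def)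
qed

lemma box_exists:
  assumes "a < m" "j < N"
  shows "\<exists>r<K. x ! r = a \<and> col r = j"
proof -
  \<comment> \<open>The shortest prefix with more than \<open>j\<close> letters \<open>a\<close>
    ends in the box sought.\<close>
  define t where "t = (LEAST t. j < ct x t a)"
  have ex: "j < ct x K a" using assms by (simp add: ct_K)
  have t: "j < ct x t a" unfolding t_def using ex by (rule LeastI)
  have tK: "t \<le> K" unfolding t_def using ex by (rule Least_le)
  obtain r where r: "t = Suc r" using t by (cases t) auto
  have "\<not> j < ct x r a" using not_less_Least[of r "\<lambda>t. j < ct x t a"] r by (simp add: t_def)
  thus ?thesis using t tK unfolding r ct_Suc by (intro exI[of _ r]) (auto simp: col_def split: if_splits)
qed

text \<open>Inverse of the filling: the position at which a box of the rectangle is filled, unique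
  by \<open>box_inj\<close>.\<close>

definition pos :: "nat \<Rightarrow> nat \<Rightarrow> nat" where
  "pos a j = (SOME r. r < K \<and> x ! r = a \<and> col r = j)"

lemma pos:
  assumes "a < m" "j < N"
  shows "pos a j < K" "x ! pos a j = a" "col (pos a j) = j"
  using someI_ex[of "\<lambda>r. r < K \<and> x ! r = a \<and> col r = j"] box_exists[OF assms] by (auto simp: pos_def)

lemma box_inj: "x ! r = x ! s \<Longrightarrow> col r = col s \<Longrightarrow> r = s"
  using same_letter_col[of r s] same_letter_col[of s r] by (cases r s rule: linorder_cases) auto

lemma pos_box: "r < K \<Longrightarrow> pos (x ! r) (col r) = r"
  by (rule box_inj) (simp_all add: pos x_less col_less)

lemma prod_boxes: "(\<Prod>r<K. f r) = (\<Prod>j<N. \<Prod>a<m. (f (pos a j) :: complex))"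
proof -
  have "(\<Prod>j<N. \<Prod>a<m. f (pos a j)) = (\<Prod>(j, a)\<in>{..<N} \<times> {..<m}. f (pos a j))"
    by (simp add: prod.cartesian_product)
  also have "\<dots> = (\<Prod>r<K. f r)"
    by (rule prod.reindex_bij_witness[of _ "\<lambda>r. (col r, x ! r)" "\<lambda>(j, a). pos a j"])
      (auto simp: pos pos_box x_less col_less)
  finally show ?thesis ..
qed

definition colw :: "nat \<Rightarrow> nat list \<Rightarrow> nat list" where
  "colw j y = map (\<lambda>a. y ! pos a j) [0..<m]"

lemma colw_nth: "a < m \<Longrightarrow> colw j y ! a = y ! pos a j"
  and colw_length [simp]: "length (colw j y) = m"
  by (simp_all add: colw_def)

lemma colw_words: "y \<in> words m K \<Longrightarrow> j < N \<Longrightarrow> colw j y \<in> words m m"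
  by (rule wordsI) (auto simp: colw_nth pos words_nth)

text \<open>Each factor is the sign of the column word as a permutation of the letters, or 0 when a
  letter repeats.\<close>

definition col_det :: "nat list \<Rightarrow> complex" where
  "col_det y = (\<Prod>j<N. minor (1\<^sub>m m) (colw j y) [0..<m])"

text \<open>Selecting the rows of \<open>g\<close> listed in \<open>v\<close> is multiplication from
  the left by a matrix of zeros and ones.\<close>

lemma minor_full:
  assumes g: "g \<in> carrier_mat m m" and v: "v \<in> words m m"
  shows "minor g v [0..<m] = det g * minor (1\<^sub>m m) v [0..<m]"
proof -
  let ?E = "mat m m (\<lambda>(r, s). (1\<^sub>m m :: complex mat) $$ (v ! r, [0..<m] ! s))"
  have E: "?E \<in> carrier_mat m m" by simp
  have "mat m m (\<lambda>(r, s). g $$ (v ! r, [0..<m] ! s)) = ?E * g"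
  proof (rule eq_matI)
    fix i j assume "i < dim_row (?E * g)" "j < dim_col (?E * g)"
    hence ij: "i < m" "j < m" using g by auto
    have "(?E * g) $$ (i, j) = (\<Sum>k<m. if k = v ! i then g $$ (v ! i, j) else 0)"
      unfolding mult_mat_nth[OF E g ij] using ij words_nth[OF v ij(1)] by (intro sum.cong) auto
    thus "mat m m (\<lambda>(r, s). g $$ (v ! r, [0..<m] ! s)) $$ (i, j) = (?E * g) $$ (i, j)"
      using ij words_nth[OF v ij(1)] by simp
  qed (use g in auto)
  thus ?thesis using det_mult[OF E g] words_length[OF v] by (simp add: minor_def)
qed

text \<open>The columns partition the positions, so the sum over words factors into sums over column
  words, each contributing one \<open>det g\<close>.\<close>

lemma col_det_equivariant:
  assumes g: "g \<in> carrier_mat m m" and y: "y \<in> words m K"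
  shows "(\<Sum>z\<in>words m K. wact g y z * col_det z) = det g ^ N * col_det y"
proof -
  let ?W = "words m m"
  define \<Phi> where "\<Phi> j v = wact g (colw j y) v * minor (1\<^sub>m m) v [0..<m]" for j v
  have "wact g y z * col_det z = (\<Prod>j<N. \<Phi> j (colw j z))" for z
  proof -
    have "wact g y z = (\<Prod>j<N. wact g (colw j y) (colw j z))"
      unfolding wact_def words_length[OF y] prod_boxes[of "\<lambda>r. g $$ (y ! r, z ! r)"]
      by (intro prod.cong refl) (simp_all add: colw_nth)
    thus ?thesis by (simp add: col_det_def \<Phi>_def prod.distrib)
  qed
  hence "(\<Sum>z\<in>words m K. wact g y z * col_det z) = (\<Sum>z\<in>words m K. \<Prod>j<N. \<Phi> j (colw j z))" by simp
  also have "\<dots> = (\<Sum>p\<in>{..<N} \<rightarrow>\<^sub>E ?W. \<Prod>j<N. \<Phi> j (p j))"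
  \<comment> \<open>A word amounts to a family of column words: its letter at position
    \<open>r\<close> is entry \<open>x ! r\<close> of the word of column
    \<open>col r\<close>.\<close>
  proof (rule sum.reindex_bij_witness[of _ "\<lambda>p. map (\<lambda>r. p (col r) ! (x ! r)) [0..<K]" "\<lambda>z. \<lambda>j\<in>{..<N}. colw j z"])
    fix z assume z: "z \<in> words m K"
    show "map (\<lambda>r. (\<lambda>j\<in>{..<N}. colw j z) (col r) ! (x ! r)) [0..<K] = z"
      by (rule nth_equalityI) (auto simp: words_length[OF z] col_less x_less colw_nth pos_box)
    show "(\<lambda>j\<in>{..<N}. colw j z) \<in> {..<N} \<rightarrow>\<^sub>E ?W" using colw_words[OF z] by auto
    show "(\<Prod>j<N. \<Phi> j ((\<lambda>j\<in>{..<N}. colw j z) j)) = (\<Prod>j<N. \<Phi> j (colw j z))" by simp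
  next
    fix p assume p: "p \<in> {..<N} \<rightarrow>\<^sub>E ?W"
    have pj: "p j \<in> ?W" if "j < N" for j using p that by auto
    show "map (\<lambda>r. p (col r) ! (x ! r)) [0..<K] \<in> words m K"
      by (rule wordsI) (auto simp: words_nth[OF pj] col_less x_less)
    show "(\<lambda>j\<in>{..<N}. colw j (map (\<lambda>r. p (col r) ! (x ! r)) [0..<K])) = p"
    proof
      fix j
      show "(\<lambda>j\<in>{..<N}. colw j (map (\<lambda>r. p (col r) ! (x ! r)) [0..<K])) j = p j"
      proof (cases "j < N")
        case True
        have "colw j (map (\<lambda>r. p (col r) ! (x ! r)) [0..<K]) = p j"
          by (rule nth_equalityI) (auto simp: colw_nth words_length[OF pj[OF True]] pos True)
        thus ?thesis using True by simp
      next
        case False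
        thus ?thesis using p by (auto simp: PiE_iff extensional_def)
      qed
    qed
  qed
  also have "\<dots> = (\<Prod>j<N. \<Sum>v\<in>?W. \<Phi> j v)" by (rule prod_sum_PiE[symmetric]) auto
  also have "\<dots> = (\<Prod>j<N. det g * minor (1\<^sub>m m) (colw j y) [0..<m])"
  proof (rule prod.cong)
    fix j assume "j \<in> {..<N}"
    hence c: "colw j y \<in> ?W" using colw_words[OF y] by simp
    have u: "[0..<m] \<in> ?W" by (rule wordsI) auto
    show "(\<Sum>v\<in>?W. \<Phi> j v) = det g * minor (1\<^sub>m m) (colw j y) [0..<m]"
      unfolding \<Phi>_def using wact_minor[OF g one_carrier_mat c u] minor_full[OF g c] g by simp
  qed simp
  also have "\<dots> = det g ^ N * col_det y" by (simp add: prod.distrib col_det_def)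
  finally show ?thesis .
qed

section \<open>Permuting positions and antisymmetrising over the blocks\<close>

definition papp :: "(nat \<Rightarrow> nat) \<Rightarrow> nat list \<Rightarrow> nat list" where
  "papp \<sigma> y = map (\<lambda>r. y ! \<sigma> r) [0..<K]"

lemma perm_less: "\<sigma> permutes {..<K} \<Longrightarrow> r < K \<Longrightarrow> \<sigma> r < K"
  using permutes_in_image[of \<sigma> "{..<K}" r] by simp

lemma papp_nth: "r < K \<Longrightarrow> papp \<sigma> y ! r = y ! \<sigma> r"
  by (simp add: papp_def)

lemma papp_words: "\<sigma> permutes {..<K} \<Longrightarrow> y \<in> words m K \<Longrightarrow> papp \<sigma> y \<in> words m K"
  by (rule wordsI) (auto simp: papp_def words_nth perm_less)

lemma papp_comp:
  assumes "\<sigma> permutes {..<K}"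
  shows "papp \<sigma> (papp \<tau> y) = papp (\<tau> \<circ> \<sigma>) y"
  by (rule nth_equalityI) (use assms in \<open>auto simp: papp_def perm_less\<close>)

lemma papp_id: "y \<in> words m K \<Longrightarrow> papp id y = y"
  by (rule nth_equalityI) (auto simp: papp_def words_length)

lemma swap_eq_papp:
  assumes "y \<in> words m K" "r < K" "s < K"
  shows "swap r s y = papp (Transposition.transpose r s) y"
  by (rule nth_equalityI)
    (use assms in \<open>auto simp: papp_def swap_def words_length nth_list_update Transposition.transpose_def\<close>)

text \<open>The Young subgroup of the block lengths.\<close>

definition blk_perms :: "(nat \<Rightarrow> nat) set" where
  "blk_perms = {\<sigma>. \<sigma> permutes {..<K} \<and> (\<forall>r<K. block_of ks (\<sigma> r) = block_of ks r)}"

lemma blk_permsD: "\<sigma> \<in> blk_perms \<Longrightarrow> \<sigma> permutes {..<K}" "\<sigma> \<in> blk_perms \<Longrightarrow> r < K \<Longrightarrow> block_of ks (\<sigma> r) = block_of ks r"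
  by (auto simp: blk_perms_def)

lemma finite_blk_perms: "finite blk_perms"
  by (rule finite_subset[OF _ finite_permutations[of "{..<K}"]]) (auto simp: blk_perms_def)

definition lead_inv :: "nat list \<Rightarrow> complex" where
  "lead_inv y = (\<Sum>\<sigma>\<in>blk_perms. of_int (sign \<sigma>) * col_det (papp \<sigma> y))"

text \<open>Composition with the transposition reindexes \<open>blk_perms\<close> and reverses every
  sign.\<close>

lemma lead_inv_alt: "block_alt m ks lead_inv"
  unfolding block_alt_def
proof (intro ballI allI impI)
  fix y r s assume y: "y \<in> words m K" and rs: "r < s" "s < K" "block_of ks r = block_of ks s"
  let ?t = "Transposition.transpose r s"
  have t: "?t permutes {..<K}" using rs by (intro permutes_swap_id) auto
  have tt: "?t \<circ> (?t \<circ> \<sigma>) = \<sigma>" for \<sigma> :: "nat \<Rightarrow> nat" by (simp add: o_assoc)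
  have blk: "?t \<circ> \<sigma> \<in> blk_perms" if "\<sigma> \<in> blk_perms" for \<sigma>
    using that rs permutes_compose[OF _ t] by (auto simp: blk_perms_def Transposition.transpose_def)
  have sgn: "sign (?t \<circ> \<sigma>) = - sign \<sigma>" if "\<sigma> \<in> blk_perms" for \<sigma>
    using rs permutation_permutes[of \<sigma>] permutation_permutes[of ?t] t blk_permsD(1)[OF that] finite_lessThan
    by (subst sign_compose) (auto simp: sign_swap_id permutation_swap_id)
  have "lead_inv (swap r s y) = (\<Sum>\<sigma>\<in>blk_perms. of_int (sign \<sigma>) * col_det (papp (?t \<circ> \<sigma>) y))"
    unfolding lead_inv_def using y rs by (intro sum.cong) (auto simp: swap_eq_papp papp_comp blk_permsD)
  also have "\<dots> = (\<Sum>\<sigma>\<in>blk_perms. - (of_int (sign \<sigma>) * col_det (papp \<sigma> y)))"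
    by (rule sum.reindex_bij_witness[of _ "(\<circ>) ?t" "(\<circ>) ?t"]) (auto simp: tt blk sgn)
  finally show "lead_inv (swap r s y) = - lead_inv y" by (simp add: lead_inv_def sum_negf)
qed

text \<open>Permuting positions commutes with the group action, so each summand inherits the
  equivariance of \<open>col_det\<close>.\<close>

lemma lead_inv_invariant: "inv_fun m ks N lead_inv"
  unfolding inv_fun_def
proof (intro conjI ballI lead_inv_alt)
  fix g y assume g: "g \<in> carrier (GL m)" and y: "y \<in> words m K"
  note gc = GL_carrier_mat[OF g]
  have "(\<Sum>z\<in>words m K. wact g y z * lead_inv z) =
      (\<Sum>\<sigma>\<in>blk_perms. of_int (sign \<sigma>) * (\<Sum>z\<in>words m K. wact g y z * col_det (papp \<sigma> z)))"
    unfolding lead_inv_def sum_distrib_left by (subst sum.swap) (simp add: ac_simps)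
  also have "\<dots> = (\<Sum>\<sigma>\<in>blk_perms. of_int (sign \<sigma>) * (det g ^ N * col_det (papp \<sigma> y)))"
  proof (intro sum.cong refl arg_cong2[where f = "(*)"])
    fix \<sigma> assume "\<sigma> \<in> blk_perms"
    hence \<sigma>: "\<sigma> permutes {..<K}" by (rule blk_permsD)
    define \<iota> where "\<iota> = inv_into UNIV \<sigma>"
    have \<iota>: "\<iota> permutes {..<K}" unfolding \<iota>_def by (rule permutes_inv[OF \<sigma>])
    have inv: "\<sigma> \<circ> \<iota> = id" "\<iota> \<circ> \<sigma> = id" using permutes_inv_o[OF \<sigma>] by (simp_all add: \<iota>_def)
    have wa: "wact g y z = wact g (papp \<sigma> y) (papp \<sigma> z)" if "z \<in> words m K" for z
    proof -
      have "bij_betw \<sigma> {..<K} {..<K}" by (rule permutes_imp_bij[OF \<sigma>])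
      from prod.reindex_bij_betw[OF this, of "\<lambda>r. g $$ (y ! r, z ! r)"]
      show ?thesis by (simp add: wact_def words_length[OF y] papp_def)
    qed
    have "(\<Sum>z\<in>words m K. wact g y z * col_det (papp \<sigma> z)) = (\<Sum>z\<in>words m K. wact g (papp \<sigma> y) z * col_det z)"
      by (rule sum.reindex_bij_witness[of _ "papp \<iota>" "papp \<sigma>"])
        (auto simp: papp_comp[OF \<sigma>] papp_comp[OF \<iota>] inv papp_id papp_words[OF \<sigma>] papp_words[OF \<iota>] wa)
    thus "(\<Sum>z\<in>words m K. wact g y z * col_det (papp \<sigma> z)) = det g ^ N * col_det (papp \<sigma> y)"
      using col_det_equivariant[OF gc papp_words[OF \<sigma> y]] by simp
  qed
  finally show "(\<Sum>z\<in>words m K. wact g y z * lead_inv z) = det g ^ N * lead_inv y"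
    by (simp add: lead_inv_def sum_distrib_left ac_simps)
qed

text \<open>Two positions of one column are two rows of one determinant, and the other determinants
  do not see the exchange.\<close>

lemma col_det_swap:
  assumes y: "y \<in> words m K" and rs: "r < K" "s < K" "r \<noteq> s" "col r = col s"
  shows "col_det (papp (Transposition.transpose r s) y) = - col_det y"
proof -
  have *: "col_det (swap r s y) = - col_det y" if rs: "r < s" "s < K" "col r = col s" for r s
  proof -
    let ?j = "col r"
    have j: "?j < N" using rs by (intro col_less) simp
    have xr: "x ! r < x ! s" "x ! s < m" using same_col_letter[OF rs] x_less[OF rs(2)] by auto
    have len: "length y = K" by (rule words_length[OF y])
    have pr: "pos a i = r \<longleftrightarrow> a = x ! r \<and> i = ?j" "pos a i = s \<longleftrightarrow> a = x ! s \<and> i = ?j" if "a < m" "i < N" for a i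
      using pos[OF that] pos_box[of r] pos_box[of s] rs by auto
    have "colw i (swap r s y) = (if i = ?j then swap (x ! r) (x ! s) (colw i y) else colw i y)" if "i < N" for i
    proof (rule nth_equalityI)
      fix a assume "a < length (colw i (swap r s y))"
      hence a: "a < m" by simp
      show "colw i (swap r s y) ! a = (if i = ?j then swap (x ! r) (x ! s) (colw i y) else colw i y) ! a"
        using a that rs xr len pos[OF a that] pr[OF a that] pos_box[of r] pos_box[of s]
        by (auto simp: colw_nth swap_def nth_list_update)
    qed (simp add: swap_def)
    hence "minor (1\<^sub>m m) (colw i (swap r s y)) [0..<m] = (if i = ?j then -1 else 1) * minor (1\<^sub>m m) (colw i y) [0..<m]"
      if "i < N" for i using that xr minor_swap[OF colw_length, of "x ! r" "x ! s" "1\<^sub>m m" i y] by auto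
    hence "col_det (swap r s y) = (\<Prod>i<N. if i = ?j then -1 else 1) * col_det y"
      by (simp add: col_det_def prod.distrib)
    thus ?thesis using j by simp
  qed
  have "swap r s y = swap s r y" unfolding swap_def by (rule list_update_swap[OF rs(3)])
  thus ?thesis
    using *[of r s] *[of s r] rs swap_eq_papp[OF y rs(1,2)] by (cases r s rule: linorder_cases) auto
qed

text \<open>Transpositions within a column are split off one at a time, each costing a sign and
  lowering the number of moved points.\<close>

lemma col_det_papp:
  assumes "\<sigma> permutes {..<K}" "\<forall>r<K. col (\<sigma> r) = col r" "y \<in> words m K"
  shows "col_det (papp \<sigma> y) = of_int (sign \<sigma>) * col_det y"
  using assms
proof (induction "card {r. \<sigma> r \<noteq> r}" arbitrary: \<sigma> y rule: less_induct)
  case less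
  show ?case
  proof (cases "\<sigma> = id")
    case True
    thus ?thesis using less.prems papp_id by simp
  next
    case False
    then obtain r where r: "\<sigma> r \<noteq> r" by (auto simp: fun_eq_iff)
    define s where "s = \<sigma> r"
    have rK: "r < K" using less.prems(1) r by (metis lessThan_iff permutes_not_in)
    have sK: "s < K" using perm_less[OF less.prems(1) rK] by (simp add: s_def)
    have cs: "col s = col r" using less.prems(2) rK by (simp add: s_def)
    let ?t = "Transposition.transpose r s"
    have t: "?t permutes {..<K}" using rK sK by (intro permutes_swap_id) auto
    define \<sigma>' where "\<sigma>' = ?t \<circ> \<sigma>"
    have \<sigma>': "\<sigma>' permutes {..<K}" unfolding \<sigma>'_def by (rule permutes_compose[OF less.prems(1) t])
    have eq: "\<sigma> = ?t \<circ> \<sigma>'" by (simp add: \<sigma>'_def o_assoc)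
    have inj: "inj \<sigma>" using permutes_inj[OF less.prems(1)] .
    have sub: "{q. \<sigma>' q \<noteq> q} \<subset> {q. \<sigma> q \<noteq> q}"
    proof
      show "{q. \<sigma>' q \<noteq> q} \<subseteq> {q. \<sigma> q \<noteq> q}"
      proof safe
        fix q assume q: "\<sigma>' q \<noteq> q" "\<sigma> q = q"
        have "q \<noteq> r" using r q by auto
        moreover have "q \<noteq> s" using q r inj by (metis injD s_def)
        ultimately show False using q by (simp add: \<sigma>'_def)
      qed
      have "\<sigma>' r = r" by (simp add: \<sigma>'_def s_def)
      thus "{q. \<sigma>' q \<noteq> q} \<noteq> {q. \<sigma> q \<noteq> q}" using r by auto
    qed
    have fin: "finite {q. \<sigma> q \<noteq> q}"
      by (rule finite_subset[of _ "{..<K}"]) (use less.prems(1) permutes_not_in in fastforce, simp)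
    have col': "\<forall>q<K. col (\<sigma>' q) = col q"
      using less.prems(2) cs by (auto simp: \<sigma>'_def Transposition.transpose_def)
    have "col_det (papp \<sigma> y) = col_det (papp \<sigma>' (papp ?t y))"
      by (subst eq) (simp add: papp_comp[OF \<sigma>'])
    also have "\<dots> = of_int (sign \<sigma>') * col_det (papp ?t y)"
      by (rule less.hyps[OF psubset_card_mono[OF fin sub] \<sigma>' col' papp_words[OF t less.prems(3)]])
    also have "\<dots> = - of_int (sign \<sigma>') * col_det y"
      using col_det_swap[OF less.prems(3) rK sK] r cs by (simp add: s_def)
    also have "sign \<sigma>' = - sign \<sigma>"
      unfolding \<sigma>'_def using r permutation_permutes[of \<sigma>] less.prems(1) finite_lessThan
      by (subst sign_compose) (auto simp: sign_swap_id permutation_swap_id s_def)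
    finally show ?thesis by simp
  qed
qed

lemma col_det_nonzero_inj:
  assumes y: "y \<in> words m K" "col_det y \<noteq> 0" and rs: "r < K" "s < K" "r \<noteq> s" "col r = col s"
  shows "y ! r \<noteq> y ! s"
proof
  assume eq: "y ! r = y ! s"
  have "papp (Transposition.transpose r s) y = y"
    by (rule nth_equalityI) (use y eq in \<open>auto simp: papp_def words_length Transposition.transpose_def\<close>)
  thus False using col_det_swap[OF y(1) rs] y(2) by simp
qed

text \<open>If a rearrangement of \<open>x\<close> within the blocks still has distinct letters in every column, then
  it moves no letter to another column: argue by induction on the position that a letter starts from.\<close>

lemma blk_perm_preserves_col:
  assumes \<sigma>: "\<sigma> \<in> blk_perms" and nz: "col_det (papp \<sigma> x) \<noteq> 0" and r: "r < K"
  shows "col (\<sigma> r) = col r"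
proof -
  note \<sigma>p = blk_permsD(1)[OF \<sigma>]
  define \<iota> where "\<iota> = inv_into UNIV \<sigma>"
  have \<iota>: "\<iota> permutes {..<K}" unfolding \<iota>_def by (rule permutes_inv[OF \<sigma>p])
  have \<sigma>\<iota>: "\<sigma> (\<iota> q) = q" and \<iota>\<sigma>: "\<iota> (\<sigma> q) = q" for q
    using permutes_inverses[OF \<sigma>p] by (simp_all add: \<iota>_def)
  have \<iota>K: "\<iota> q < K" if "q < K" for q using perm_less[OF \<iota> that] .
  have blk: "block_of ks (\<iota> q) = block_of ks q" if "q < K" for q
    using blk_permsD(2)[OF \<sigma> \<iota>K[OF that]] \<sigma>\<iota> by simp
  have distinct: "x ! q \<noteq> x ! q'" if "q < K" "q' < K" "q \<noteq> q'" "col (\<iota> q) = col (\<iota> q')" for q q'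
    using col_det_nonzero_inj[OF papp_words[OF \<sigma>p x_words] nz \<iota>K[OF that(1)] \<iota>K[OF that(2)] _ that(4)] that(3) \<sigma>\<iota> \<iota>K that
    by (metis papp_nth)
  have inc: "x ! q < x ! q' \<longleftrightarrow> q < q'" if "q < K" "q' < K" "block_of ks q = block_of ks q'" for q q'
    using x_inc that unfolding block_inc_def by (metis linorder_cases less_asym less_irrefl)
  have main: "q < K \<Longrightarrow> col (\<iota> q) = col q" for q
  proof (induction q rule: less_induct)
    case (less r)
    show ?case
    proof (rule ccontr)
      assume ne: "col (\<iota> r) \<noteq> col r"
      define s a where "s = \<iota> r" and "a = x ! r"
      have s: "s < K" using \<iota>K[OF less.prems] by (simp add: s_def)
      have a: "a < m" using x_less[OF less.prems] by (simp add: a_def)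
      \<comment> \<open>If the letter \<open>a\<close> at \<open>r\<close> ends in a different
        column, that column has its own box for \<open>a\<close>, filled at position
        \<open>r'\<close>.\<close>
      define r' where "r' = pos a (col s)"
      have r': "r' < K" "x ! r' = a" "col r' = col s" using pos[OF a col_less[OF s]] by (simp_all add: r'_def)
      have ne': "r' \<noteq> r" using r' ne by (auto simp: s_def)
      show False
      proof (cases "r' < r")
        case True
        hence "col (\<iota> r') = col (\<iota> r)" using less.IH[OF True r'(1)] r' by (simp add: s_def)
        thus False using distinct[OF r'(1) less.prems ne'] r' by (simp add: a_def)
      next
        case False
        hence gt: "r < r'" using ne' by simp
        have "block_of ks r \<noteq> block_of ks r'" using inc[OF less.prems r'(1)] gt r' by (auto simp: a_def)
        hence blt: "block_of ks r < block_of ks r'"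
          using block_of_mono[of r r' ks] gt r' by simp
        have key: "q < r \<or> q = r" if "q < K" "col q = col s" "block_of ks q = block_of ks r" for q
        proof -
          have "q < r'" using blt block_of_mono[of r' q ks] that by (metis leD le_less_linear)
          hence "x ! q < a" using same_col_letter[of q r'] that r' by simp
          thus ?thesis using inc[OF that(1) less.prems that(3)] by (simp add: a_def)
        qed
        \<comment> \<open>The positions of the target column within the block of \<open>r\<close>
          all precede \<open>r\<close>. By induction the letters starting there stay among them and
          fill all these places, leaving none for the letter of \<open>r\<close>.\<close>
        define B where "B = {q. q < r \<and> col q = col s \<and> block_of ks q = block_of ks r}"
        have fin: "finite B" by (rule finite_subset[of _ "{..<r}"]) (auto simp: B_def)
        have sB: "s \<in> B"
          using key[OF s] blk[OF less.prems] ne by (auto simp: B_def s_def)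
        have "\<iota> ` B \<subseteq> B"
        proof
          fix p assume "p \<in> \<iota> ` B"
          then obtain q where q: "p = \<iota> q" "q < r" "col q = col s" "block_of ks q = block_of ks r"
            by (auto simp: B_def)
          have qK: "q < K" using q less.prems by simp
          have c: "col p = col s" using less.IH[OF q(2) qK] q by simp
          have b: "block_of ks p = block_of ks r" using blk[OF qK] q by simp
          have "p \<noteq> r" using c ne by (auto simp: s_def)
          thus "p \<in> B" using key[OF _ c b] \<iota>K[OF qK] c b by (auto simp: B_def q(1))
        qed
        moreover have "inj_on \<iota> B" using permutes_inj[OF \<iota>] by (rule inj_on_subset) simp
        ultimately have "\<iota> ` B = B" using fin by (metis card_image card_subset_eq)
        then obtain q where "q \<in> B" "\<iota> q = \<iota> r" using sB by (metis imageE s_def)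
        hence "r \<in> B" using permutes_inj[OF \<iota>] by (metis injD)
        thus False by (simp add: B_def)
      qed
    qed
  qed
  show ?thesis using main[OF perm_less[OF \<sigma>p r]] \<iota>\<sigma> by simp
qed

lemma col_det_x: "col_det x = 1"
proof -
  have "colw j x = [0..<m]" if "j < N" for j
    by (rule nth_equalityI) (use that pos in \<open>auto simp: colw_nth\<close>)
  moreover have "minor (1\<^sub>m m) [0..<m] [0..<m] = 1"
    using minor_one[OF upt_in_incs upt_in_incs, of m m] by simp
  ultimately show ?thesis by (simp add: col_det_def)
qed

text \<open>No cancellation occurs: a nonzero summand comes from a permutation preserving the
  columns, whose sign then occurs twice. The identity contributes, so the sum is a positive
  integer.\<close>

lemma lead_inv_lead: "lead_inv x \<noteq> 0"
proof -
  have "of_int (sign \<sigma>) * col_det (papp \<sigma> x) = (if col_det (papp \<sigma> x) = 0 then 0 else 1)"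
    if \<sigma>: "\<sigma> \<in> blk_perms" for \<sigma>
  proof (cases "col_det (papp \<sigma> x) = 0")
    case False
    have "col_det (papp \<sigma> x) = of_int (sign \<sigma>) * col_det x"
      using blk_perm_preserves_col[OF \<sigma> False] by (intro col_det_papp blk_permsD(1)[OF \<sigma>] x_words) blast
    moreover have "of_int (sign \<sigma>) * of_int (sign \<sigma>) = (1 :: complex)"
      by (cases \<sigma> rule: sign_cases) auto
    ultimately show ?thesis using False by (simp add: col_det_x)
  qed simp
  hence "lead_inv x = (\<Sum>\<sigma>\<in>blk_perms. if col_det (papp \<sigma> x) = 0 then 0 else 1)"
    unfolding lead_inv_def by (intro sum.cong) auto
  also have "\<dots> = of_nat (card {\<sigma> \<in> blk_perms. col_det (papp \<sigma> x) \<noteq> 0})"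
    using finite_blk_perms by (simp add: sum.If_cases Int_def)
  finally have eq: "lead_inv x = \<dots>" .
  have "id \<in> {\<sigma> \<in> blk_perms. col_det (papp \<sigma> x) \<noteq> 0}"
    using x_words by (simp add: blk_perms_def papp_id col_det_x permutes_id)
  hence "card {\<sigma> \<in> blk_perms. col_det (papp \<sigma> x) \<noteq> 0} \<noteq> 0"
    using finite_blk_perms by (auto simp: card_eq_0_iff)
  thus ?thesis using eq by simp
qed

end

section \<open>Dominance order on block contents, and triangularity\<close>

definition cum :: "nat list \<Rightarrow> nat list \<Rightarrow> nat \<Rightarrow> nat \<Rightarrow> nat" where
  "cum ks y i a = card {r. r < sum_list ks \<and> block_of ks r < i \<and> y ! r \<le> a}"

context lattice_word
begin

lemma cum_papp:
  assumes "\<sigma> \<in> blk_perms"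
  shows "cum ks (papp \<sigma> y) i a = cum ks y i a"
proof -
  note \<sigma> = blk_permsD[OF assms]
  have "bij_betw \<sigma> {r. r < K \<and> block_of ks r < i \<and> papp \<sigma> y ! r \<le> a} {r. r < K \<and> block_of ks r < i \<and> y ! r \<le> a}"
  proof (rule bij_betw_imageI)
    show "inj_on \<sigma> {r. r < K \<and> block_of ks r < i \<and> papp \<sigma> y ! r \<le> a}"
      using permutes_inj[OF \<sigma>(1)] by (rule inj_on_subset) simp
    show "\<sigma> ` {r. r < K \<and> block_of ks r < i \<and> papp \<sigma> y ! r \<le> a} = {r. r < K \<and> block_of ks r < i \<and> y ! r \<le> a}"
    proof (intro equalityI subsetI)
      fix q assume q: "q \<in> {r. r < K \<and> block_of ks r < i \<and> y ! r \<le> a}"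
      obtain r where r: "q = \<sigma> r" using permutes_surj[OF \<sigma>(1)] by (metis surjD)
      have "r < K" using q r permutes_in_image[OF \<sigma>(1), of r] by simp
      thus "q \<in> \<sigma> ` {r. r < K \<and> block_of ks r < i \<and> papp \<sigma> y ! r \<le> a}"
        using q r \<sigma>(2)[of r] by (intro image_eqI[of q \<sigma> r]) (auto simp: papp_nth r)
    qed (use \<sigma> perm_less[OF \<sigma>(1)] in \<open>auto simp: papp_nth\<close>)
  qed
  thus ?thesis unfolding cum_def by (rule bij_betw_same_card)
qed

text \<open>Compare column by column. Within the first \<open>i\<close> blocks a column of
  \<open>x\<close> holds an initial run of the letters \<open>0, 1, ...\<close>, whereas
  \<open>y\<close> has distinct letters there; so \<open>y\<close> has no more letters up to
  \<open>a\<close>.\<close>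

lemma cum_le:
  assumes y: "y \<in> words m K" "col_det y \<noteq> 0"
  shows "cum ks y i a \<le> cum ks x i a"
proof -
  define S where "S j = {r. r < K \<and> col r = j \<and> block_of ks r < i}" for j
  have finS: "finite (S j)" for j by (simp add: S_def)
  have split: "cum ks z i a = (\<Sum>j<N. card {r \<in> S j. z ! r \<le> a})" for z
  proof -
    have "{r. r < K \<and> block_of ks r < i \<and> z ! r \<le> a} = (\<Union>j<N. {r \<in> S j. z ! r \<le> a})"
      using col_less by (auto simp: S_def)
    moreover have "card (\<Union>j<N. {r \<in> S j. z ! r \<le> a}) = (\<Sum>j<N. card {r \<in> S j. z ! r \<le> a})"
      using finS by (intro card_UN_disjoint) (auto simp: S_def)
    ultimately show ?thesis by (simp add: cum_def)
  qed
  have "card {r \<in> S j. y ! r \<le> a} \<le> card {r \<in> S j. x ! r \<le> a}" if j: "j < N" for j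
  proof -
    have injy: "inj_on ((!) y) (S j)"
    proof (rule inj_onI, rule ccontr)
      fix r s assume "r \<in> S j" "s \<in> S j" "y ! r = y ! s" "r \<noteq> s"
      thus False using col_det_nonzero_inj[OF y, of r s] by (simp add: S_def)
    qed
    have injx: "inj_on ((!) x) (S j)"
      using box_inj by (intro inj_onI) (auto simp: S_def)
    have down: "pos b j \<in> S j \<and> x ! pos b j = b" if r: "r \<in> S j" "b \<le> x ! r" for r b
    proof -
      have rK: "r < K" "col r = j" using r by (auto simp: S_def)
      have b: "b < m" using r x_less[OF rK(1)] by simp
      note p = pos[OF b j]
      have "pos b j \<le> r"
      proof (rule ccontr)
        assume "\<not> ?thesis"
        hence "x ! r < x ! pos b j" using same_col_letter[of r "pos b j"] p rK by simp
        thus False using p r by simp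
      qed
      hence "block_of ks (pos b j) \<le> block_of ks r" using rK by (intro block_of_mono)
      thus ?thesis using p r by (auto simp: S_def)
    qed
    have cy: "card {r \<in> S j. y ! r \<le> a} \<le> Suc a"
    proof -
      have "card {r \<in> S j. y ! r \<le> a} = card ((!) y ` {r \<in> S j. y ! r \<le> a})"
        by (rule card_image[symmetric]) (rule inj_on_subset[OF injy], auto)
      also have "\<dots> \<le> card {..a}" by (rule card_mono) auto
      finally show ?thesis by simp
    qed
    show ?thesis
    \<comment> \<open>If \<open>x\<close> has a letter beyond \<open>a\<close> in this part of the
      column, it has all of \<open>0..a\<close> there; otherwise all its letters there
      count.\<close>
    proof (cases "\<exists>r\<in>S j. a < x ! r")
      case True
      then obtain r where r: "r \<in> S j" "a < x ! r" by blast
      have "{..a} \<subseteq> (!) x ` {r \<in> S j. x ! r \<le> a}"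
      proof
        fix b assume "b \<in> {..a}"
        thus "b \<in> (!) x ` {r \<in> S j. x ! r \<le> a}"
          using down[OF r(1), of b] r(2) by (intro image_eqI[of _ _ "pos b j"]) auto
      qed
      hence "card {..a} \<le> card ((!) x ` {r \<in> S j. x ! r \<le> a})" using finS by (intro card_mono) auto
      also have "\<dots> \<le> card {r \<in> S j. x ! r \<le> a}" using finS by (intro card_image_le) auto
      finally show ?thesis using cy by simp
    next
      case False
      hence "{r \<in> S j. x ! r \<le> a} = S j" by (auto simp: not_less)
      thus ?thesis using finS[of j] by (auto intro: card_mono)
    qed
  qed
  thus ?thesis unfolding split by (intro sum_mono) simp
qed

lemma lead_inv_cum:
  assumes p: "p \<in> words m K" "lead_inv p \<noteq> 0"
  shows "cum ks p i a \<le> cum ks x i a"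
proof -
  have "\<exists>\<sigma>\<in>blk_perms. col_det (papp \<sigma> p) \<noteq> 0"
  proof (rule ccontr)
    assume "\<not> ?thesis"
    hence "lead_inv p = 0" unfolding lead_inv_def by (intro sum.neutral) simp
    thus False using p(2) by simp
  qed
  then obtain \<sigma> where \<sigma>: "\<sigma> \<in> blk_perms" "col_det (papp \<sigma> p) \<noteq> 0" by blast
  show ?thesis using cum_le[OF papp_words[OF blk_permsD(1)[OF \<sigma>(1)] p(1)] \<sigma>(2), of i a] cum_papp[OF \<sigma>(1)] by simp
qed

end

lemma cum_block_count:
  "cum ks y (Suc i) a = cum ks y i a + card {r. r < sum_list ks \<and> block_of ks r = i \<and> y ! r \<le> a}"
proof -
  have "{r. r < sum_list ks \<and> block_of ks r < Suc i \<and> y ! r \<le> a} =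
      {r. r < sum_list ks \<and> block_of ks r < i \<and> y ! r \<le> a} \<union> {r. r < sum_list ks \<and> block_of ks r = i \<and> y ! r \<le> a}"
    by (auto simp: less_Suc_eq)
  thus ?thesis unfolding cum_def by (simp only:) (rule card_Un_disjoint, auto)
qed

text \<open>Differences of \<open>cum\<close> in \<open>i\<close> give the content of each block,
  and the letters of a block are recovered from it in increasing order.\<close>

lemma cum_determines:
  assumes p: "p \<in> words m (sum_list ks)" "block_inc ks p" and x: "x \<in> words m (sum_list ks)" "block_inc ks x"
    and eq: "\<And>i a. i \<le> length ks \<Longrightarrow> a < m \<Longrightarrow> cum ks p i a = cum ks x i a"
  shows "p = x"
proof (rule nth_equalityI)
  show "length p = length x" using p x by (simp add: words_length)
  let ?K = "sum_list ks"
  fix r assume "r < length p"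
  hence r: "r < ?K" using p by (simp add: words_length)
  define i where "i = block_of ks r"
  define c where "c y a = card {s. s < ?K \<and> block_of ks s = i \<and> y ! s \<le> a}" for y :: "nat list" and a
  have i: "Suc i \<le> length ks" using block_of_less[OF r] by (simp add: i_def)
  have ceq: "c p a = c x a" if "a < m" for a
    using cum_block_count[of ks p i a] cum_block_count[of ks x i a] eq[of i a] eq[of "Suc i" a] i that by (simp add: c_def)
  define J where "J = {s. s < r \<and> block_of ks s = i}"
  have J: "finite J" by (rule finite_subset[of _ "{..<r}"]) (auto simp: J_def)
  have inc: "y ! s < y ! t \<longleftrightarrow> s < t" if "block_inc ks y" "s < ?K" "t < ?K" "block_of ks s = block_of ks t" for y s t
    using that unfolding block_inc_def by (metis linorder_cases less_asym less_irrefl)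
  have at: "c y (y ! r) = Suc (card J)" if y: "block_inc ks y" for y
  proof -
    have "{s. s < ?K \<and> block_of ks s = i \<and> y ! s \<le> y ! r} = insert r J"
      using inc[OF y _ r] inc[OF y r] r by (auto simp: J_def i_def not_less[symmetric] simp del: not_less)
    thus ?thesis using J by (simp add: c_def J_def)
  qed
  have below: "c y a \<le> card J" if y: "block_inc ks y" and a: "a < y ! r" for y a
    unfolding c_def using inc[OF y _ r] r J by (intro card_mono) (auto simp: J_def i_def intro: le_less_trans[OF _ a])
  have pm: "p ! r < m" "x ! r < m" using words_nth[OF p(1) r] words_nth[OF x(1) r] .
  show "p ! r = x ! r"
  proof (cases "p ! r" "x ! r" rule: linorder_cases)
    case less
    thus ?thesis using at[OF p(2)] below[OF x(2) less] ceq[OF pm(1)] by simp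
  next
    case greater
    thus ?thesis using at[OF x(2)] below[OF p(2) greater] ceq[OF pm(2)] by simp
  qed
qed

text \<open>A numerical rank compatible with the dominance order, turning strict domination into the
  strict inequality asked for by \<open>triangular_solve\<close>.\<close>

definition potential :: "nat \<Rightarrow> nat list \<Rightarrow> nat list \<Rightarrow> nat" where
  "potential m ks y = (\<Sum>i\<le>length ks. \<Sum>a<m. cum ks y i a)"

lemma lead_inv_triangular:
  assumes x: "lattice_block_word m ks N x" and p: "lattice_block_word m ks N p" and nz: "lattice_word.lead_inv m ks N x p \<noteq> 0" and ne: "p \<noteq> x"
  shows "potential m ks p < potential m ks x"
proof -
  interpret lattice_word m ks N x by unfold_locales (rule x)
  have le: "cum ks p i a \<le> cum ks x i a" for i a
    using lead_inv_cum[OF _ nz] p by (simp add: lattice_block_word_def)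
  have "\<exists>i\<le>length ks. \<exists>a<m. cum ks p i a \<noteq> cum ks x i a"
    using cum_determines[of p m ks x] p x ne unfolding lattice_block_word_def by blast
  then obtain i a where ia: "i \<le> length ks" "a < m" "cum ks p i a < cum ks x i a"
    using le by (metis le_neq_implies_less)
  have "(\<Sum>a<m. cum ks p i a) < (\<Sum>a<m. cum ks x i a)"
    by (rule sum_strict_mono_ex1) (use le ia in auto)
  thus ?thesis unfolding potential_def
    by (intro sum_strict_mono_ex1) (use le ia in \<open>auto intro: sum_mono\<close>)
qed

section \<open>The dimension of the space of invariants\<close>

text \<open>Existence and uniqueness together, by removing an index \<open>x0\<close> of maximal
  \<open>\<Phi>\<close>: in the equation at \<open>p = x0\<close> only \<open>x0\<close> has a
  nonzero entry, which determines its coefficient.\<close>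

lemma triangular_solve:
  fixes \<Phi> :: "'a \<Rightarrow> nat" and M :: "'a \<Rightarrow> 'a \<Rightarrow> complex"
  assumes "finite S" and diag: "\<And>x. x \<in> S \<Longrightarrow> M x x \<noteq> 0"
    and tri: "\<And>x p. x \<in> S \<Longrightarrow> p \<in> S \<Longrightarrow> M x p \<noteq> 0 \<Longrightarrow> p \<noteq> x \<Longrightarrow> \<Phi> p < \<Phi> x"
  shows "(\<exists>c. \<forall>p\<in>S. (\<Sum>x\<in>S. c x * M x p) = u p) \<and>
    (\<forall>c. (\<forall>p\<in>S. (\<Sum>x\<in>S. c x * M x p) = 0) \<longrightarrow> (\<forall>x\<in>S. c x = 0))"
  using assms
proof (induction "card S" arbitrary: S u)
  case 0
  thus ?case by simp
next
  case (Suc n)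
  have ne: "S \<noteq> {}" using Suc.hyps(2) by auto
  have "Max (\<Phi> ` S) \<in> \<Phi> ` S" by (rule Max_in) (use Suc.prems(1) ne in auto)
  then obtain x0 where x0: "x0 \<in> S" "\<Phi> x0 = Max (\<Phi> ` S)" by auto
  have max: "\<Phi> x \<le> \<Phi> x0" if "x \<in> S" for x using that Suc.prems(1) by (simp add: x0(2))
  define S' where "S' = S - {x0}"
  have S': "finite S'" "S = insert x0 S'" "x0 \<notin> S'" "n = card S'"
    using Suc.prems(1) Suc.hyps(2) x0 by (auto simp: S'_def)
  have M0: "M x x0 = 0" if "x \<in> S'" for x
  proof (rule ccontr)
    assume "M x x0 \<noteq> 0"
    hence "\<Phi> x0 < \<Phi> x" using Suc.prems(3)[of x x0] that x0(1) by (auto simp: S'_def)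
    thus False using max[of x] that by (auto simp: S'_def)
  qed
  have IH: "(\<exists>c. \<forall>p\<in>S'. (\<Sum>x\<in>S'. c x * M x p) = v p) \<and>
      (\<forall>c. (\<forall>p\<in>S'. (\<Sum>x\<in>S'. c x * M x p) = 0) \<longrightarrow> (\<forall>x\<in>S'. c x = 0))" for v
    by (rule Suc.hyps(1)[OF S'(4) S'(1)]) (use Suc.prems S' in auto)
  have d0: "M x0 x0 \<noteq> 0" using Suc.prems(2) x0 by blast
  show ?case
  proof (intro conjI allI impI)
    define k where "k = u x0 / M x0 x0"
    obtain c where c: "\<And>p. p \<in> S' \<Longrightarrow> (\<Sum>x\<in>S'. c x * M x p) = u p - k * M x0 p"
      using IH[of "\<lambda>p. u p - k * M x0 p"] by blast
    have "(\<Sum>x\<in>S. (c(x0 := k)) x * M x p) = k * M x0 p + (\<Sum>x\<in>S'. c x * M x p)" for p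
    proof -
      have "(\<Sum>x\<in>S'. (c(x0 := k)) x * M x p) = (\<Sum>x\<in>S'. c x * M x p)"
        by (rule sum.cong) (use S'(3) in auto)
      thus ?thesis using S' by simp
    qed
    moreover have "(\<Sum>x\<in>S'. c x * M x x0) = 0" by (rule sum.neutral) (simp add: M0)
    ultimately have "\<forall>p\<in>S. (\<Sum>x\<in>S. (c(x0 := k)) x * M x p) = u p"
      using c d0 S'(2) by (auto simp: k_def)
    thus "\<exists>c. \<forall>p\<in>S. (\<Sum>x\<in>S. c x * M x p) = u p" by blast
  next
    fix c assume z: "\<forall>p\<in>S. (\<Sum>x\<in>S. c x * M x p) = 0"
    have sp: "(\<Sum>x\<in>S. c x * M x p) = c x0 * M x0 p + (\<Sum>x\<in>S'. c x * M x p)" for p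
      using S' by simp
    have "(\<Sum>x\<in>S'. c x * M x x0) = 0" by (rule sum.neutral) (simp add: M0)
    hence c0: "c x0 = 0" using z x0(1) sp[of x0] d0 by simp
    hence "\<forall>p\<in>S'. (\<Sum>x\<in>S'. c x * M x p) = 0" using z sp S'(2) by auto
    hence "\<forall>x\<in>S'. c x = 0" using IH by blast
    thus "\<forall>x\<in>S. c x = 0" using c0 S'(2) by auto
  qed
qed

lemma inv_fun_lin:
  assumes "\<And>i. i \<in> S \<Longrightarrow> inv_fun m ks N (F i)"
  shows "inv_fun m ks N (\<lambda>x. \<Sum>i\<in>S. F i x * c i)"
  unfolding inv_fun_def
proof (intro conjI ballI)
  show "block_alt m ks (\<lambda>x. \<Sum>i\<in>S. F i x * c i)"
    using assms by (intro block_alt_lin) (simp add: inv_fun_def)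
  fix g x assume g: "g \<in> carrier (GL m)" and x: "x \<in> words m (sum_list ks)"
  have "(\<Sum>y\<in>words m (sum_list ks). wact g x y * (\<Sum>i\<in>S. F i y * c i)) =
      (\<Sum>i\<in>S. (\<Sum>y\<in>words m (sum_list ks). wact g x y * F i y) * c i)"
    unfolding sum_distrib_left sum_distrib_right by (subst sum.swap) (simp add: mult.assoc)
  also have "\<dots> = (\<Sum>i\<in>S. det g ^ N * F i x * c i)"
    using assms g x by (intro sum.cong) (auto simp: inv_fun_def)
  finally show "(\<Sum>y\<in>words m (sum_list ks). wact g x y * (\<Sum>i\<in>S. F i y * c i)) = det g ^ N * (\<Sum>i\<in>S. F i x * c i)"
    by (simp add: sum_distrib_left mult.assoc)
qed

lemma finite_good: "finite {x. lattice_block_word m ks N x}"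
  by (rule finite_subset[OF _ finite_words[of m "sum_list ks"]]) (auto simp: lattice_block_word_def)

text \<open>Lattice words index both the unknown coefficients and the points of evaluation.\<close>

lemma good_solve:
  "(\<exists>c. \<forall>p\<in>{x. lattice_block_word m ks N x}. (\<Sum>x | lattice_block_word m ks N x. c x * lattice_word.lead_inv m ks N x p) = u p) \<and>
    (\<forall>c. (\<forall>p\<in>{x. lattice_block_word m ks N x}. (\<Sum>x | lattice_block_word m ks N x. c x * lattice_word.lead_inv m ks N x p) = 0) \<longrightarrow>
      (\<forall>x\<in>{x. lattice_block_word m ks N x}. c x = 0))"
proof (rule triangular_solve[OF finite_good, where \<Phi> = "potential m ks"])
  fix x assume "x \<in> {x. lattice_block_word m ks N x}"
  thus "lattice_word.lead_inv m ks N x x \<noteq> 0"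
    by (intro lattice_word.lead_inv_lead lattice_word.intro) simp
qed (auto intro: lead_inv_triangular)

section \<open>From functions on words back to vectors\<close>

context
  fixes m ks N D R A B
  assumes M: "word_model m ks N (D, R) A B"
begin

abbreviation "Ws \<equiv> words m (sum_list ks)"

definition to_fun :: "complex vec \<Rightarrow> nat list \<Rightarrow> complex" where
  "to_fun v x = (\<Sum>i<D. A x i * v $ i)"

definition of_fun :: "(nat list \<Rightarrow> complex) \<Rightarrow> complex vec" where
  "of_fun F = vec D (\<lambda>i. \<Sum>y\<in>Ws. B i y * F y)"

lemma of_fun_carrier [simp]: "of_fun F \<in> carrier_vec D"
  by (simp add: of_fun_def)

lemma of_fun_cong: "(\<And>x. x \<in> Ws \<Longrightarrow> F x = G x) \<Longrightarrow> of_fun F = of_fun G"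
  by (simp add: of_fun_def)

lemma to_fun_alt: "block_alt m ks (to_fun v)"
  unfolding to_fun_def using word_modelD(1)[OF M] by (intro block_alt_lin) simp

lemma to_of_fun: "block_alt m ks F \<Longrightarrow> x \<in> Ws \<Longrightarrow> to_fun (of_fun F) x = F x"
  using word_modelD(3)[OF M] by (simp add: to_fun_def of_fun_def)

lemma of_to_fun:
  assumes v: "v \<in> carrier_vec D"
  shows "of_fun (to_fun v) = v"
proof (rule eq_vecI)
  fix i assume "i < dim_vec v"
  hence i: "i < D" using v by simp
  have "(\<Sum>y\<in>Ws. B i y * (\<Sum>j<D. A y j * v $ j)) = (\<Sum>j<D. (\<Sum>y\<in>Ws. B i y * A y j) * v $ j)"
    unfolding sum_distrib_left sum_distrib_right by (subst sum.swap) (simp add: mult.assoc)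
  also have "\<dots> = (\<Sum>j<D. if j = i then v $ i else 0)"
    using word_modelD(2)[OF M i] by (intro sum.cong) auto
  finally show "of_fun (to_fun v) $ i = v $ i" using i by (simp add: of_fun_def to_fun_def)
qed (use v in \<open>simp add: of_fun_def\<close>)

lemma to_fun_action:
  assumes g: "g \<in> carrier (GL m)" and v: "v \<in> carrier_vec D" and x: "x \<in> Ws"
  shows "(\<Sum>y\<in>Ws. wact g x y * to_fun v y) = det g ^ N * to_fun (R g *\<^sub>v v) x"
proof -
  note Rc = word_modelD(4)[OF M g]
  have "(\<Sum>y\<in>Ws. wact g x y * to_fun v y) = (\<Sum>j<D. (\<Sum>y\<in>Ws. wact g x y * A y j) * v $ j)"
    unfolding to_fun_def sum_distrib_left sum_distrib_right by (subst sum.swap) (simp add: mult.assoc)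
  also have "\<dots> = (\<Sum>j<D. det g ^ N * (\<Sum>i<D. A x i * R g $$ (i, j)) * v $ j)"
    by (intro sum.cong) (auto simp: word_modelD(5)[OF M g x])
  also have "\<dots> = det g ^ N * (\<Sum>i<D. A x i * (\<Sum>j<D. R g $$ (i, j) * v $ j))"
    unfolding sum_distrib_left sum_distrib_right by (subst sum.swap) (simp add: mult.assoc)
  also have "\<dots> = det g ^ N * to_fun (R g *\<^sub>v v) x"
    by (simp add: to_fun_def mult_mat_vec_nth[OF Rc v])
  finally show ?thesis .
qed

text \<open>The factor \<open>det g ^ N\<close> cancels, and \<open>of_fun\<close> inverts
  \<open>to_fun\<close> on vectors.\<close>

lemma invariant_iff:
  assumes v: "v \<in> carrier_vec D"
  shows "v \<in> invariants m (D, R) \<longleftrightarrow> inv_fun m ks N (to_fun v)"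
proof
  assume "v \<in> invariants m (D, R)"
  hence "R g *\<^sub>v v = v" if "g \<in> carrier (GL m)" for g using that by (simp add: invariants_def)
  thus "inv_fun m ks N (to_fun v)" using to_fun_action[OF _ v] to_fun_alt by (simp add: inv_fun_def)
next
  assume F: "inv_fun m ks N (to_fun v)"
  have "R g *\<^sub>v v = v" if g: "g \<in> carrier (GL m)" for g
  proof -
    have "to_fun (R g *\<^sub>v v) x = to_fun v x" if x: "x \<in> Ws" for x
    proof -
      have "det g ^ N * to_fun (R g *\<^sub>v v) x = det g ^ N * to_fun v x"
        using F to_fun_action[OF g v x] g x unfolding inv_fun_def by metis
      moreover have "det g ^ N \<noteq> 0" using g by (simp add: carrier_GL)
      ultimately show ?thesis by (metis mult_left_cancel)
    qed
    hence "of_fun (to_fun (R g *\<^sub>v v)) = of_fun (to_fun v)" by (rule of_fun_cong)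
    moreover have "R g *\<^sub>v v \<in> carrier_vec D" using word_modelD(4)[OF M g] v by auto
    ultimately show ?thesis using of_to_fun v by simp
  qed
  thus "v \<in> invariants m (D, R)" using v by (simp add: invariants_def)
qed

text \<open>\<open>T\<close> sends coefficients to the corresponding combination of the
  \<open>lead_inv\<close>. Uniqueness in \<open>good_solve\<close> makes it injective. It is onto
  because some combination agrees with a given invariant on the lattice words, and then everywhere
  by \<open>inv_fun_zero\<close>.\<close>

theorem dim_invariants_word_model: "dim_invariants m (D, R) = card {x. lattice_block_word m ks N x}"
proof -
  define S where "S = {x. lattice_block_word m ks N x}"
  define q where "q = card S"
  define f where "f = lattice_word.lead_inv m ks N"
  have f: "inv_fun m ks N (f p)" if "p \<in> S" for p
    unfolding f_def using that by (intro lattice_word.lead_inv_invariant lattice_word.intro) (simp add: S_def)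
  obtain e where e: "bij_betw e {..<q} S"
    using ex_bij_betw_nat_finite[OF finite_good[of m ks N]] by (auto simp: S_def q_def atLeast0LessThan)
  have eS: "e k \<in> S" if "k < q" for k using e that by (auto simp: bij_betw_def)
  define Fc where "Fc c x = (\<Sum>k<q. f (e k) x * c $ k)" for c :: "complex vec" and x
  have Fc_inv: "inv_fun m ks N (Fc c)" for c
    unfolding Fc_def by (rule inv_fun_lin) (simp add: f eS)
  have Fc_sum: "Fc c p = (\<Sum>x\<in>S. c $ inv_into {..<q} e x * f x p)" for c p
  proof -
    have "(\<Sum>x\<in>S. c $ inv_into {..<q} e x * f x p) = (\<Sum>k<q. c $ inv_into {..<q} e (e k) * f (e k) p)"
      by (rule sum.reindex_bij_betw[OF e, symmetric])
    also have "\<dots> = Fc c p"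
      unfolding Fc_def by (intro sum.cong) (auto simp: bij_betw_inv_into_left[OF e])
    finally show ?thesis ..
  qed
  define T where "T c = of_fun (Fc c)" for c
  have to_T: "to_fun (T c) x = Fc c x" if "x \<in> Ws" for c x
    unfolding T_def using Fc_inv[of c] that by (intro to_of_fun) (simp_all add: inv_fun_def)
  have TI: "T c \<in> invariants m (D, R)" for c
  proof -
    have "block_alt m ks (Fc c)" using Fc_inv by (simp add: inv_fun_def)
    hence "inv_fun m ks N (to_fun (T c))"
      using Fc_inv[of c] to_T to_fun_alt[of "T c"] unfolding inv_fun_def by (simp cong: sum.cong)
    thus ?thesis by (subst invariant_iff) (simp_all add: T_def)
  qed
  define V where "V = module_vec TYPE(complex) q"
  define W where "W = (module_vec TYPE(complex) D)\<lparr>carrier := invariants m (D, R)\<rparr>"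
  have Ic: "invariants m (D, R) \<subseteq> carrier_vec D" by (auto simp: invariants_def)
  have Rc: "R g \<in> carrier_mat D D" if "g \<in> carrier (GL m)" for g by (rule word_modelD(4)[OF M that])
  have sub: "VectorSpace.subspace class_ring (invariants m (D, R)) (module_vec TYPE(complex) D)"
    unfolding VectorSpace.subspace_def
  proof (intro conjI vec_vs submodule.intro vec_module)
    show "invariants m (D, R) \<subseteq> carrier (module_vec TYPE(complex) D)" using Ic by (simp add: module_vec_simps)
    show "v \<oplus>\<^bsub>module_vec TYPE(complex) D\<^esub> w \<in> invariants m (D, R)"
      if "v \<in> invariants m (D, R)" "w \<in> invariants m (D, R)" for v w
      using that Rc by (auto simp: invariants_def module_vec_simps mult_add_distrib_mat_vec[of _ D D])
    show "\<zero>\<^bsub>module_vec TYPE(complex) D\<^esub> \<in> invariants m (D, R)"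
      using mult_mat_vec_zero[OF Rc] by (auto simp: invariants_def module_vec_simps)
    show "c \<odot>\<^bsub>module_vec TYPE(complex) D\<^esub> v \<in> invariants m (D, R)"
      if "v \<in> invariants m (D, R)" for c v
      using that Rc by (auto simp: invariants_def module_vec_simps mult_mat_vec[of _ D D])
  qed
  have vsD: "vectorspace class_ring (module_vec TYPE(complex) D)" by (rule vec_vs)
  have vsV: "vectorspace class_ring V" unfolding V_def by (rule vec_vs)
  have vsW: "vectorspace class_ring W" unfolding W_def by (rule vectorspace.subspace_is_vs[OF vsD sub])
  have T_nth: "T c $ i = (\<Sum>y\<in>Ws. B i y * Fc c y)" if "i < D" for c i
    using that by (simp add: T_def of_fun_def)
  have T_add: "T (c + c') = T c + T c'" if "c \<in> carrier_vec q" "c' \<in> carrier_vec q" for c c'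
  proof (rule eq_vecI)
    fix i assume "i < dim_vec (T c + T c')"
    hence i: "i < D" by (simp add: T_def of_fun_def)
    have "Fc (c + c') y = Fc c y + Fc c' y" for y
      using that by (simp add: Fc_def algebra_simps sum.distrib)
    thus "T (c + c') $ i = (T c + T c') $ i" using i T_nth
      by (simp add: T_def of_fun_def algebra_simps sum.distrib)
  qed (simp add: T_def of_fun_def)
  have T_smult: "T (a \<cdot>\<^sub>v c) = a \<cdot>\<^sub>v T c" if "c \<in> carrier_vec q" for a c
  proof (rule eq_vecI)
    fix i assume "i < dim_vec (a \<cdot>\<^sub>v T c)"
    hence i: "i < D" by (simp add: T_def of_fun_def)
    have "Fc (a \<cdot>\<^sub>v c) y = a * Fc c y" for y
      using that by (simp add: Fc_def sum_distrib_left ac_simps)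
    thus "T (a \<cdot>\<^sub>v c) $ i = (a \<cdot>\<^sub>v T c) $ i" using i
      by (simp add: T_def of_fun_def sum_distrib_left ac_simps)
  qed (simp add: T_def of_fun_def)
  have "T \<in> LinearCombinations.module_hom class_ring V W"
    using TI T_add T_smult unfolding LinearCombinations.module_hom_def V_def W_def
    by (auto simp: module_vec_simps)
  hence lin: "linear_map class_ring V W T"
    using vsV vsW by (simp add: linear_map_def mod_hom_def mod_hom_axioms_def vectorspace_def)
  have fin: "vectorspace.fin_dim class_ring V" unfolding V_def by (rule vec_space.fin_dim)
  have Fc_good: "Fc c p = Fc c' p" if "T c = T c'" "p \<in> S" for c c' p
  proof -
    have "p \<in> Ws" using that(2) by (simp add: S_def lattice_block_word_def)
    thus ?thesis using to_T that(1) by metis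
  qed
  have "inj_on T (carrier V)"
  proof (rule inj_onI)
    fix c c' assume c: "c \<in> carrier V" "c' \<in> carrier V" and eq: "T c = T c'"
    hence cq: "c \<in> carrier_vec q" "c' \<in> carrier_vec q" by (simp_all add: V_def module_vec_simps)
    define h where "h x = c $ inv_into {..<q} e x - c' $ inv_into {..<q} e x" for x
    have "(\<Sum>x\<in>S. h x * f x p) = 0" if p: "p \<in> S" for p
      using Fc_good[OF eq p] by (simp add: Fc_sum h_def algebra_simps sum_subtractf)
    hence h0: "h x = 0" if "x \<in> S" for x
      using good_solve[of m ks N] that unfolding S_def f_def by blast
    show "c = c'"
    proof (rule eq_vecI)
      fix k assume "k < dim_vec c'"
      hence k: "k < q" using cq by simp
      thus "c $ k = c' $ k" using h0[OF eS[OF k]] bij_betw_inv_into_left[OF e] by (simp add: h_def)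
    qed (use cq in simp)
  qed
  moreover have "T ` carrier V = carrier W"
  proof
    show "T ` carrier V \<subseteq> carrier W" using TI by (auto simp: W_def)
    show "carrier W \<subseteq> T ` carrier V"
    proof
      fix v assume "v \<in> carrier W"
      hence v: "v \<in> invariants m (D, R)" by (simp add: W_def)
      hence vc: "v \<in> carrier_vec D" using Ic by blast
      obtain c where c: "\<And>p. p \<in> S \<Longrightarrow> (\<Sum>x\<in>S. c x * f x p) = to_fun v p"
        using good_solve[of m ks N "to_fun v"] unfolding S_def f_def by blast
      define cv where "cv = vec q (\<lambda>k. c (e k))"
      have cvx: "cv $ inv_into {..<q} e x = c x" if "x \<in> S" for x
      proof -
        have "inv_into {..<q} e x \<in> {..<q}" using e that by (metis bij_betw_def inv_into_into)
        thus ?thesis using bij_betw_inv_into_right[OF e that] by (simp add: cv_def)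
      qed
      have eqS: "Fc cv p = to_fun v p" if "p \<in> S" for p
        using c[OF that] cvx by (simp add: Fc_sum)
      have "Fc cv x - to_fun v x = 0" if x: "x \<in> Ws" for x
      proof -
        \<comment> \<open>The difference is written as a sum over booleans so that
          \<open>inv_fun_lin\<close> applies.\<close>
        have "inv_fun m ks N (\<lambda>x. \<Sum>b\<in>{True, False}. (if b then Fc cv else to_fun v) x * (if b then 1 else -1))"
          using Fc_inv v invariant_iff[OF vc] by (intro inv_fun_lin) auto
        hence "inv_fun m ks N (\<lambda>x. Fc cv x - to_fun v x)" by simp
        thus ?thesis by (rule inv_fun_zero[OF _ _ x]) (use eqS in \<open>simp add: S_def\<close>)
      qed
      hence "T cv = of_fun (to_fun v)" unfolding T_def by (intro of_fun_cong) simp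
      hence "T cv = v" using of_to_fun[OF vc] by simp
      moreover have "cv \<in> carrier V" by (simp add: cv_def V_def module_vec_simps)
      ultimately show "v \<in> T ` carrier V" by blast
    qed
  qed
  ultimately have "vectorspace.dim class_ring V = vectorspace.dim class_ring W"
    by (rule linear_map.dim_eq[OF lin fin])
  moreover have "vectorspace.dim class_ring V = q" unfolding V_def by (rule vec_space.dim_is_n)
  ultimately show ?thesis by (simp add: dim_invariants_def W_def q_def S_def)
qed

end

section \<open>Lattice words and rows of growth diagrams\<close>

lemma block_of_range:
  assumes "j < length ks" "sum_list (take j ks) \<le> r" "r < sum_list (take (Suc j) ks)"
  shows "block_of ks r = j"
  using assms
proof (induction ks arbitrary: j r)
  case (Cons k ks)
  thus ?case by (cases j) auto
qed simp

lemma block_of_bounds: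
  assumes "r < sum_list ks"
  shows "sum_list (take (block_of ks r) ks) \<le> r" "r < sum_list (take (Suc (block_of ks r)) ks)"
  using assms
proof (induction ks arbitrary: r)
  case (Cons k ks)
  { case 1
    have "sum_list (take (block_of ks (r - k)) ks) \<le> r - k" if "\<not> r < k"
      using Cons.IH(1)[of "r - k"] 1 that by auto
    thus ?case by (cases "r < k") (simp_all add: le_diff_conv2 add.commute)
  next
    case 2
    have "r - k < sum_list (take (Suc (block_of ks (r - k))) ks)" if "\<not> r < k"
      using Cons.IH(2)[of "r - k"] 2 that by auto
    thus ?case by (cases "r < k") (simp_all add: less_diff_conv2 add.commute)
  }
qed simp_all

lemma sum_list_take_mono: "i \<le> j \<Longrightarrow> sum_list (take i ks) \<le> (sum_list (take j ks) :: nat)"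
proof -
  assume "i \<le> j"
  hence "take i ks = take i (take j ks)" by (simp add: min_def)
  thus ?thesis by (metis append_take_drop_id le_add1 sum_list_append)
qed

lemma sum_list_take_le: "sum_list (take i ks) \<le> (sum_list ks :: nat)"
  by (metis append_take_drop_id le_add1 sum_list_append)

lemma block_of_less_iff:
  assumes "r < sum_list ks" "i \<le> length ks"
  shows "block_of ks r < i \<longleftrightarrow> r < sum_list (take i ks)"
proof
  assume "block_of ks r < i"
  thus "r < sum_list (take i ks)"
    using block_of_bounds(2)[OF assms(1)] sum_list_take_mono[of "Suc (block_of ks r)" i ks] by simp
next
  assume "r < sum_list (take i ks)"
  thus "block_of ks r < i"
    using block_of_bounds(1)[OF assms(1)] sum_list_take_mono[of i "block_of ks r" ks] by (meson leD le_trans not_le_imp_less)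
qed

lemma sum_ct:
  assumes x: "x \<in> words m word_len" and t: "t \<le> word_len"
  shows "(\<Sum>a<m. ct x t a) = t"
  using t
proof (induction t)
  case (Suc t)
  have "(\<Sum>a<m. ct x (Suc t) a) = (\<Sum>a<m. ct x t a) + (\<Sum>a<m. if a = x ! t then 1 else 0)"
    unfolding ct_Suc sum.distrib by (intro arg_cong2[where f = "(+)"] sum.cong refl) auto
  also have "(\<Sum>a<m. if a = x ! t then 1 else 0) = (1 :: nat)"
    using words_nth[OF x, of t] Suc.prems by (simp add: sum.delta)
  also have "(\<Sum>a<m. ct x t a) = t" using Suc by simp
  finally show ?case by simp
qed simp

lemma cum_ct:
  assumes "i \<le> length ks"
  shows "cum ks y i a = (\<Sum>b\<le>a. ct y (sum_list (take i ks)) b)"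
proof -
  have "r < sum_list ks \<and> block_of ks r < i \<longleftrightarrow> r < sum_list (take i ks)" for r
    using block_of_less_iff[of r ks i] assms sum_list_take_le[of i ks] by linarith
  hence "{r. r < sum_list ks \<and> block_of ks r < i \<and> y ! r \<le> a} = (\<Union>b\<le>a. {r. r < sum_list (take i ks) \<and> y ! r = b})"
    by blast
  moreover have "card (\<Union>b\<le>a. {r. r < sum_list (take i ks) \<and> y ! r = b}) = (\<Sum>b\<le>a. ct y (sum_list (take i ks)) b)"
    unfolding ct_def by (intro card_UN_disjoint) auto
  ultimately show ?thesis by (simp add: cum_def)
qed

lemma ct_distinct:
  assumes "distinct S" "t \<le> length S"
  shows "ct S t a = (if a \<in> set (take t S) then 1 else 0)"
proof (cases "a \<in> set (take t S)")
  case True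
  then obtain p where p: "p < t" "S ! p = a" using assms(2) by (auto simp: in_set_conv_nth)
  have "{r. r < t \<and> S ! r = a} = {p}" using p assms by (auto simp: nth_eq_iff_index_eq)
  thus ?thesis using True by (simp add: ct_def)
next
  case False
  hence "{r. r < t \<and> S ! r = a} = {}" using assms(2) by (auto simp: in_set_conv_nth)
  thus ?thesis using False by (simp add: ct_def)
qed

text \<open>Each type is written as \<open>omega m k\<close> minus \<open>e\<close> in every entry,
  with the pair \<open>(k, e)\<close> in \<open>ps\<close>. The list counts from 0 and the types
  from 1, hence \<open>Suc j\<close>.\<close>

locale growth_types = growth +
  fixes ps :: "(nat \<times> nat) list"
  assumes length_ps: "length ps = n" and fst_le: "\<And>j. j < n \<Longrightarrow> fst (ps ! j) \<le> m"
    and lam_ps: "\<And>j. j < n \<Longrightarrow> lam (Suc j) = map (\<lambda>a. a - int (snd (ps ! j))) (omega m (fst (ps ! j)))"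
begin

definition ks where "ks = map fst ps"
definition es where "es = map snd ps"
text \<open>\<open>Tk j\<close> is the position at which block \<open>j\<close> begins,
  \<open>Te j\<close> the twist accumulated before it.\<close>

definition Tk where "Tk j = sum_list (take j ks)"
definition Te where "Te j = sum_list (take j es)"

abbreviation "word_len \<equiv> sum_list ks"
abbreviation "N \<equiv> sum_list es"

lemma lens: "length ks = n" "length es = n"
  by (simp_all add: ks_def es_def length_ps)

lemma Tk_simps: "Tk 0 = 0" "j < n \<Longrightarrow> Tk (Suc j) = Tk j + ks ! j" "Tk n = word_len"
  and Te_simps: "Te 0 = 0" "j < n \<Longrightarrow> Te (Suc j) = Te j + es ! j" "Te n = N"
  by (simp_all add: Tk_def Te_def lens take_Suc_conv_app_nth)

lemma Tk_mono: "i \<le> j \<Longrightarrow> Tk i \<le> Tk j" and Tk_le: "Tk j \<le> word_len"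
  unfolding Tk_def by (rule sum_list_take_mono sum_list_take_le; assumption?)+

lemma lam_nth:
  assumes "j < n" "a < m"
  shows "lam (Suc j) ! a = (if a < ks ! j then 1 else 0) - int (es ! j)"
  using assms fst_le[OF assms(1)] by (auto simp: lam_ps omega_def nth_append ks_def es_def length_ps)

lemma length_lam: "j < n \<Longrightarrow> length (lam (Suc j)) = m"
  using fst_le by (simp add: lam_ps omega_def)

lemma ks_le: "j < n \<Longrightarrow> ks ! j \<le> m"
  using fst_le by (simp add: ks_def length_ps)

lemma lam_two_valued: "j < n \<Longrightarrow> set (lam (Suc j)) \<subseteq> {- int (es ! j), - int (es ! j) + 1}"
proof
  fix v assume j: "j < n" and "v \<in> set (lam (Suc j))"
  then obtain a where "a < m" "v = lam (Suc j) ! a" using length_lam by (metis in_set_conv_nth)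
  thus "v \<in> {- int (es ! j), - int (es ! j) + 1}" using lam_nth[OF j] by simp
qed

lemma tot_lam:
  assumes "j < n"
  shows "tot (lam (Suc j)) = int (ks ! j) - int m * int (es ! j)"
proof -
  have "tot (lam (Suc j)) = (\<Sum>a<m. (if a < ks ! j then 1 else 0) - int (es ! j))"
    unfolding tot_def length_lam[OF assms] by (intro sum.cong) (auto simp: lam_nth[OF assms])
  also have "\<dots> = (\<Sum>a<m. if a < ks ! j then 1 else 0) - int m * int (es ! j)"
    by (simp add: sum_subtractf)
  also have "(\<Sum>a<m. if a < ks ! j then 1 else 0 :: int) = (\<Sum>a<ks ! j. 1)"
    using ks_le[OF assms] by (intro sum.mono_neutral_cong_right) auto
  finally show ?thesis by simp
qed

lemma rows_1:
  "R \<in> rows 1 \<longleftrightarrow> R \<in> {..n} \<rightarrow>\<^sub>E dominant_weights m \<and> R 0 = zero_weight m \<and> R n = zero_weight m \<and>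
    (\<forall>j<n. mset (vsub (R (Suc j)) (R j)) = mset (lam (Suc j)))"
proof -
  have "lam_per (1 + int j) = lam (Suc j)" if "j < n" for j
    by (rule lam_per_cong) (use that in auto)
  thus ?thesis by (simp add: rows_def)
qed

text \<open>Contents at the block boundaries, lowered by the accumulated twist so that the walk
  closes at zero.\<close>

definition word_row :: "nat list \<Rightarrow> nat \<Rightarrow> int list" where
  "word_row x = (\<lambda>j\<in>{..n}. map (\<lambda>a. int (ct x (Tk j) a) - int (Te j)) [0..<m])"

lemma word_row_nth: "j \<le> n \<Longrightarrow> a < m \<Longrightarrow> word_row x j ! a = int (ct x (Tk j) a) - int (Te j)"
  and word_row_length: "j \<le> n \<Longrightarrow> length (word_row x j) = m"
  by (simp_all add: word_row_def)

lemma block_step: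
  assumes x: "lattice_block_word m ks N x" and j: "j < n"
  shows "ct x (Tk (Suc j)) a \<le> ct x (Tk j) a + 1"
proof -
  let ?B = "{r. Tk j \<le> r \<and> r < Tk (Suc j) \<and> x ! r = a}"
  have "{r. r < Tk (Suc j) \<and> x ! r = a} = {r. r < Tk j \<and> x ! r = a} \<union> ?B"
    using Tk_mono[of j "Suc j"] by auto
  hence "ct x (Tk (Suc j)) a \<le> ct x (Tk j) a + card ?B" unfolding ct_def by (simp add: card_Un_le)
  moreover have "card ?B \<le> 1"
  proof (rule card_le_Suc0_iff_eq[THEN iffD2, simplified One_nat_def[symmetric]], simp, safe)
    fix r s assume rs: "Tk j \<le> r" "r < Tk (Suc j)" "Tk j \<le> s" "s < Tk (Suc j)" "x ! s = x ! r"
    have "block_of ks r = j" "block_of ks s = j"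
      using rs j by (auto intro!: block_of_range simp: Tk_def lens)
    moreover have "r < word_len" "s < word_len" using rs Tk_le[of "Suc j"] by auto
    moreover have "block_inc ks x" using x by (simp add: lattice_block_word_def)
    ultimately show "r = s" using rs(5) unfolding block_inc_def by (metis linorder_cases less_irrefl)
  qed
  ultimately show ?thesis by simp
qed

text \<open>A block uses each letter at most once, so the entries of a step are \<open>- e\<close>
  or \<open>1 - e\<close>. Its sum is that of the type, which makes it a rearrangement of the type
  by \<open>two_valued_mset\<close>.\<close>

lemma word_row_in_rows:
  assumes x: "lattice_block_word m ks N x"
  shows "word_row x \<in> rows 1"
proof -
  interpret lattice_word m ks N x by unfold_locales (rule x)
  have dom: "word_row x j \<in> dominant_weights m" if j: "j \<le> n" for j
    using ct_antimono[OF Tk_le] j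
    by (auto simp: dominant_weights_def sorted_wrt_iff_nth_less word_row_length word_row_nth)
  have "word_row x \<in> {..n} \<rightarrow>\<^sub>E dominant_weights m"
    by (rule PiE_I) (use dom in \<open>auto simp: word_row_def\<close>)
  moreover have "word_row x 0 = zero_weight m"
    by (rule nth_equalityI) (auto simp: word_row_length word_row_nth zero_weight_def Tk_simps Te_simps)
  moreover have "word_row x n = zero_weight m"
    by (rule nth_equalityI) (auto simp: word_row_length word_row_nth zero_weight_def Tk_simps Te_simps ct_K)
  moreover have "mset (vsub (word_row x (Suc j)) (word_row x j)) = mset (lam (Suc j))" if j: "j < n" for j
  proof (rule two_valued_mset)
    have d: "vsub (word_row x (Suc j)) (word_row x j) ! a =
        int (ct x (Tk (Suc j)) a) - int (ct x (Tk j) a) - int (es ! j)" if "a < m" for a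
      using that j by (simp add: word_row_length word_row_nth Te_simps)
    have len: "length (vsub (word_row x (Suc j)) (word_row x j)) = m" using j by (simp add: word_row_length)
    show "length (vsub (word_row x (Suc j)) (word_row x j)) = length (lam (Suc j))" using len length_lam j by simp
    show "set (lam (Suc j)) \<subseteq> {- int (es ! j), - int (es ! j) + 1}" using lam_two_valued j .
    have "ct x (Tk j) a \<le> ct x (Tk (Suc j)) a" "ct x (Tk (Suc j)) a \<le> ct x (Tk j) a + 1" for a
      using block_step[OF x j] Tk_mono[of j "Suc j"] by (auto intro: ct_mono)
    hence "int (ct x (Tk (Suc j)) a) - int (ct x (Tk j) a) \<in> {0, 1}" for a
      by (metis add.commute insertCI le_antisym not_less_eq_eq plus_1_eq_Suc cancel_comm_monoid_add_class.diff_cancel of_nat_Suc add_diff_cancel_right')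
    thus "set (vsub (word_row x (Suc j)) (word_row x j)) \<subseteq> {- int (es ! j), - int (es ! j) + 1}"
      using d len by (fastforce simp: in_set_conv_nth)
    have "tot (vsub (word_row x (Suc j)) (word_row x j)) =
        (\<Sum>a<m. int (ct x (Tk (Suc j)) a) - int (ct x (Tk j) a) - int (es ! j))"
      unfolding tot_def len by (intro sum.cong) (auto simp: d)
    also have "\<dots> = int (\<Sum>a<m. ct x (Tk (Suc j)) a) - int (\<Sum>a<m. ct x (Tk j) a) - int m * int (es ! j)"
      by (simp add: sum_subtractf)
    also have "\<dots> = int (ks ! j) - int m * int (es ! j)"
      unfolding sum_ct[OF x_words Tk_le] using j by (simp add: Tk_simps)
    finally show "tot (vsub (word_row x (Suc j)) (word_row x j)) = tot (lam (Suc j))" by (simp add: tot_lam[OF j])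
  qed
  ultimately show ?thesis by (simp add: rows_1)
qed

text \<open>A row records the contents at all block boundaries, and these are what
  \<open>cum\<close> is computed from.\<close>

lemma word_row_inj: "inj_on word_row {x. lattice_block_word m ks N x}"
proof (rule inj_onI, clarify)
  fix x y assume x: "lattice_block_word m ks N x" and y: "lattice_block_word m ks N y" and eq: "word_row x = word_row y"
  have ct: "ct x (Tk j) a = ct y (Tk j) a" if "j \<le> n" "a < m" for j a
    using word_row_nth[OF that, of x] word_row_nth[OF that, of y] eq by simp
  show "x = y"
  proof (rule cum_determines)
    fix i a assume i: "i \<le> length ks" and a: "a < m"
    show "cum ks x i a = cum ks y i a"
      unfolding cum_ct[OF i] by (intro sum.cong refl) (use ct i a in \<open>simp add: Tk_def lens\<close>)
  qed (use x y in \<open>auto simp: lattice_block_word_def\<close>)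
qed

lemma word_row_surj:
  assumes R: "R \<in> rows 1"
  shows "R \<in> word_row ` {x. lattice_block_word m ks N x}"
proof -
  have dom: "R j \<in> dominant_weights m" if "j \<le> n" for j using R that by (auto simp: rows_1)
  note len = dominant_length[OF dom]
  have st: "mset (vsub (R (Suc j)) (R j)) = mset (lam (Suc j))" if "j < n" for j using R that by (simp add: rows_1)
  \<comment> \<open>The letters raised in step \<open>j\<close>. Filtering \<open>[0..<m]\<close>
    lists them in increasing order, as a block requires.\<close>
  define S where "S j = filter (\<lambda>a. R (Suc j) ! a - R j ! a = 1 - int (es ! j)) [0..<m]" for j
  have S_set: "a \<in> set (S j) \<longleftrightarrow> a < m \<and> R (Suc j) ! a - R j ! a = 1 - int (es ! j)" for a j
    by (auto simp: S_def)
  have S_sorted: "sorted_wrt (<) (S j)" for j by (simp add: S_def sorted_wrt_filter)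
  have S_dist: "distinct (S j)" for j by (simp add: S_def)
  have vals: "R (Suc j) ! a = R j ! a + (if a \<in> set (S j) then 1 else 0) - int (es ! j)" if j: "j < n" and a: "a < m" for j a
  proof -
    have "R (Suc j) ! a - R j ! a \<in> set (vsub (R (Suc j)) (R j))"
      using a len[of j] len[of "Suc j"] j nth_mem[of a "vsub (R (Suc j)) (R j)"] by simp
    hence "R (Suc j) ! a - R j ! a \<in> {- int (es ! j), - int (es ! j) + 1}"
      using mset_eq_setD[OF st[OF j]] lam_two_valued[OF j] by blast
    thus ?thesis using a by (auto simp: S_set)
  qed
  have S_len: "length (S j) = ks ! j" if j: "j < n" for j
  proof -
    have "tot (vsub (R (Suc j)) (R j)) = int (ks ! j) - int m * int (es ! j)"
      using tot_mset[OF st[OF j]] tot_lam[OF j] by simp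
    moreover have "tot (vsub (R (Suc j)) (R j)) = (\<Sum>a<m. (if a \<in> set (S j) then 1 else 0) - int (es ! j))"
      unfolding tot_def using len[of j] len[of "Suc j"] j by (intro sum.cong) (auto simp: vals)
    moreover have "\<dots> = (\<Sum>a<m. if a \<in> set (S j) then 1 else 0) - int m * int (es ! j)"
      by (simp add: sum_subtractf)
    moreover have "(\<Sum>a<m. if a \<in> set (S j) then 1 else 0 :: int) = int (card (set (S j)))"
    proof -
      have "{..<m} \<inter> {a. a \<in> set (S j)} = set (S j)" by (auto simp: S_set)
      thus ?thesis by (simp add: sum.If_cases)
    qed
    ultimately show ?thesis using distinct_card[OF S_dist[of j]] by simp
  qed
  define X where "X j = concat (map S [0..<j])" for j
  have X0: "X 0 = []" and XS: "X (Suc j) = X j @ S j" for j by (simp_all add: X_def)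
  have X_len: "length (X j) = Tk j" if "j \<le> n" for j
    using that by (induction j) (auto simp: X0 XS Tk_simps S_len)
  have X_pre: "\<exists>z. X n = X j @ z" if "j \<le> n" for j
    using that
  proof (induction j rule: inc_induct)
    case base
    show ?case by simp
  next
    case (step j)
    then obtain z where "X n = X (Suc j) @ z" by blast
    thus ?case by (simp add: XS)
  qed
  define x where "x = X n"
  have x_len: "length x = word_len" by (simp add: x_def X_len Tk_simps)
  have x_split: "\<exists>z. x = X j @ S j @ z" if "j < n" for j
    using X_pre[of "Suc j"] that by (auto simp: x_def XS)
  have x_nth: "x ! (Tk j + p) = S j ! p" if j: "j < n" and p: "p < ks ! j" for j p
  proof -
    obtain z where "x = X j @ S j @ z" using x_split[OF j] by blast
    thus ?thesis using X_len[of j] j p S_len[OF j] by (simp add: nth_append)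
  qed
  have blk: "\<exists>j p. j < n \<and> p < ks ! j \<and> r = Tk j + p \<and> block_of ks r = j" if r: "r < word_len" for r
  proof -
    define j where "j = block_of ks r"
    have j: "j < n" using block_of_less[OF r] by (simp add: j_def lens)
    have "Tk j \<le> r" "r < Tk (Suc j)" using block_of_bounds[OF r] by (simp_all add: j_def Tk_def)
    thus ?thesis using j Tk_simps(2)[OF j] by (intro exI[of _ j] exI[of _ "r - Tk j"]) (auto simp: j_def)
  qed
  have x_words: "x \<in> words m word_len"
  proof (rule wordsI[OF x_len])
    fix r assume "r < word_len"
    then obtain j p where jp: "j < n" "p < ks ! j" "r = Tk j + p" using blk by blast
    hence "S j ! p \<in> set (S j)" by (simp add: S_len)
    thus "x ! r < m" using jp x_nth by (simp add: S_set)
  qed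
  have x_inc: "block_inc ks x"
    unfolding block_inc_def
  proof (intro allI impI)
    fix r s assume rs: "r < s" "s < word_len" "block_of ks r = block_of ks s"
    obtain j p where p: "j < n" "p < ks ! j" "r = Tk j + p" "block_of ks r = j" using blk[of r] rs by auto
    obtain j' p' where p': "j' < n" "p' < ks ! j'" "s = Tk j' + p'" "block_of ks s = j'" using blk[of s] rs by auto
    have jj: "j' = j" using p p' rs by simp
    have "S j ! p < S j ! p'"
      using S_sorted[of j] p p' rs S_len[OF p(1)] unfolding sorted_wrt_iff_nth_less jj by simp
    thus "x ! r < x ! s" using p p' x_nth jj by simp
  qed
  have ct_part: "ct x (Tk j + t) a = ct (X j) (Tk j) a + ct (S j) t a" if j: "j < n" and t: "t \<le> ks ! j" for j t a
  proof -
    obtain z where z: "x = X j @ S j @ z" using x_split[OF j] by blast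
    have Xl: "length (X j) = Tk j" using j by (simp add: X_len)
    have "ct x (Tk j + t) a = ct (X j) (Tk j) a + ct (S j @ z) t a"
      unfolding z by (rule ct_append[OF Xl])
    also have "ct (S j @ z) t a = ct (S j) t a"
      using t S_len[OF j] ct_take[of t "S j @ z" a] ct_take[of t "S j" a] by simp
    finally show ?thesis .
  qed
  have ct_X: "ct x (Tk j) a = ct (X j) (Tk j) a" if "j < n" for j a
    using ct_part[OF that, of 0 a] by simp
  have ct_R: "int (ct x (Tk j) a) = R j ! a + int (Te j)" if "j \<le> n" "a < m" for j a
    using that
  proof (induction j)
    case 0
    thus ?case using R by (simp add: rows_1 Tk_simps Te_simps zero_weight_def)
  next
    case (Suc j)
    hence j: "j < n" by simp
    have "ct (S j) (ks ! j) a = (if a \<in> set (S j) then 1 else 0)"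
      using ct_distinct[OF S_dist, of "ks ! j" j a] S_len[OF j] by simp
    hence "int (ct x (Tk (Suc j)) a) = int (ct x (Tk j) a) + (if a \<in> set (S j) then 1 else 0)"
      using ct_part[OF j order.refl, of a] ct_X[OF j] j by (simp add: Tk_simps)
    thus ?case using Suc vals[OF j] j by (simp add: Te_simps)
  qed
  have domj: "ct x (Tk j) (Suc a) \<le> ct x (Tk j) a" if "j \<le> n" "Suc a < m" for j a
  proof -
    have "R j ! Suc a \<le> R j ! a"
      using dominant_sorted[OF dom[OF that(1)]] that len[OF that(1)] by (simp add: sorted_wrt_iff_nth_less)
    thus ?thesis using ct_R[OF that(1), of a] ct_R[OF that] that(2) by linarith
  qed
  \<comment> \<open>Inside a block \<open>Suc a\<close> could overtake \<open>a\<close> only if it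
    has been read and \<open>a\<close> has not. If \<open>a\<close> occurs in the block it comes
    earlier; if it does not, the inequality at the end of the block already suffices.\<close>
  have lat: "ct x t (Suc a) \<le> ct x t a" if t: "t \<le> word_len" and a: "Suc a < m" for t a
  proof (cases "t = word_len")
    case True
    thus ?thesis using domj[of n a] a by (simp add: Tk_simps)
  next
    case False
    then obtain j p where jp: "j < n" "p < ks ! j" "t = Tk j + p" using blk[of t] t by auto
    have ctp: "ct x t b = ct x (Tk j) b + ct (S j) p b" for b
      using ct_part[OF jp(1), of p b] ct_X[OF jp(1)] jp by simp
    have full: "ct x (Tk (Suc j)) b = ct x (Tk j) b + (if b \<in> set (S j) then 1 else 0)" for b
      using ct_part[OF jp(1) order.refl, of b] ct_X[OF jp(1)] jp(1) ct_distinct[OF S_dist, of "ks ! j" j b] S_len[OF jp(1)]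
      by (simp add: Tk_simps)
    have cS: "ct (S j) p b = (if b \<in> set (take p (S j)) then 1 else 0)" for b
      using ct_distinct[OF S_dist, of p j b] S_len[OF jp(1)] jp(2) by simp
    show ?thesis
    proof (cases "Suc a \<in> set (take p (S j))")
      case False
      thus ?thesis using domj[of j a] jp a unfolding ctp cS by simp
    next
      case True
      hence in1: "Suc a \<in> set (S j)" by (rule in_set_takeD)
      show ?thesis
      proof (cases "a \<in> set (S j)")
        case False
        thus ?thesis using domj[of "Suc j" a] jp a in1 True full[of a] full[of "Suc a"] unfolding ctp cS by simp
      next
        case inS: True
        obtain i where i: "i < p" "S j ! i = Suc a" using True S_len[OF jp(1)] jp(2) by (auto simp: in_set_conv_nth)
        obtain i' where i': "i' < length (S j)" "S j ! i' = a" using inS by (auto simp: in_set_conv_nth)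
        have "i' < i"
        proof (rule ccontr)
          assume "\<not> i' < i"
          moreover have "i' \<noteq> i" using i i' by auto
          ultimately have "S j ! i < S j ! i'"
            using S_sorted[of j] i'(1) unfolding sorted_wrt_iff_nth_less by simp
          thus False using i i' by simp
        qed
        hence "a \<in> set (take p (S j))"
          using i i' by (auto simp: in_set_conv_nth intro!: exI[of _ i'])
        thus ?thesis using domj[of j a] jp a True unfolding ctp cS by simp
      qed
    qed
  qed
  have "ct x word_len a = N" if "a < m" for a
  proof -
    have "int (ct x word_len a) = int N"
      using ct_R[of n a] that R by (simp add: Tk_simps Te_simps rows_1 zero_weight_def)
    thus ?thesis by simp
  qed
  hence "lattice_block_word m ks N x" using x_words x_inc lat by (simp add: lattice_block_word_def)
  moreover have "word_row x = R"
  proof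
    fix j show "word_row x j = R j"
    proof (cases "j \<le> n")
      case True
      show ?thesis
        by (rule nth_equalityI) (use True ct_R len in \<open>auto simp: word_row_length word_row_nth\<close>)
    next
      case False
      thus ?thesis using R by (auto simp: word_row_def rows_1 PiE_iff extensional_def)
    qed
  qed
  ultimately show ?thesis by blast
qed

theorem card_rows: "card (rows 1) = card {x. lattice_block_word m ks N x}"
proof -
  have "bij_betw word_row {x. lattice_block_word m ks N x} (rows 1)"
    unfolding bij_betw_def using word_row_inj word_row_in_rows word_row_surj by blast
  thus ?thesis by (simp add: bij_betw_same_card)
qed

end

text \<open>The dual of \<open>omega m i\<close> is \<open>omega m (m - i)\<close> lowered by 1 in
  every entry; \<open>k = 0\<close> arises from \<open>i = m\<close>.\<close>

lemma minuscule_twisted_omega: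
  assumes "minuscule m \<mu>"
  obtains k e where "k \<le> m" "\<mu> = map (\<lambda>a. a - int e) (omega m k)"
proof -
  obtain i where i: "i \<in> {1..m}" and \<mu>: "\<mu> = omega m i \<or> \<mu> = dual_weight (omega m i)"
    using assms by (auto simp: minuscule_def)
  from \<mu> show ?thesis
  proof
    assume "\<mu> = omega m i"
    hence "\<mu> = map (\<lambda>a. a - int 0) (omega m i)" by simp
    thus ?thesis using that[of i 0] i by simp
  next
    assume "\<mu> = dual_weight (omega m i)"
    hence "\<mu> = map (\<lambda>a. a - int 1) (omega m (m - i))"
      using i by (simp add: dual_weight_def omega_def)
    thus ?thesis using that[of "m - i" 1] by simp
  qed
qed

theorem theorem1p2:
  fixes m n :: nat and lam :: "nat \<Rightarrow> int list"
  assumes "m \<ge> 1" and "n \<ge> 1"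
    and "\<forall>k\<in>{1..n}. minuscule m (lam k)"
  shows "finite (affine_growth_diagrams m n lam) \<and>
    card (affine_growth_diagrams m n lam) = LR_coefficient m n lam"
proof -
  have "\<exists>p. fst p \<le> m \<and> lam (Suc j) = map (\<lambda>a. a - int (snd p)) (omega m (fst p))" if "j < n" for j
    using minuscule_twisted_omega[of m "lam (Suc j)"] assms(3) that by (metis Suc_leI atLeastAtMost_iff fst_conv le_add1 plus_1_eq_Suc snd_conv)
  then obtain P where P: "\<And>j. j < n \<Longrightarrow> fst (P j) \<le> m"
    "\<And>j. j < n \<Longrightarrow> lam (Suc j) = map (\<lambda>a. a - int (snd (P j))) (omega m (fst (P j)))" by metis
  define ps where "ps = map P [0..<n]"
  interpret growth_types m n lam ps
    by unfold_locales (use assms P in \<open>auto simp: ps_def\<close>)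
  define V where "V = tensor_reps (map (\<lambda>(k, e). irrep m (map (\<lambda>a. a - int e) (omega m k))) ps)"
  have "map (\<lambda>k. irrep m (lam k)) [1..<Suc n] = map (\<lambda>(k, e). irrep m (map (\<lambda>a. a - int e) (omega m k))) ps"
    by (rule nth_equalityI) (auto simp: ps_def P(2) case_prod_beta simp del: upt_Suc)
  hence LR: "LR_coefficient m n lam = dim_invariants m V"
    unfolding LR_coefficient_def V_def by (rule arg_cong)
  have "\<forall>p\<in>set ps. fst p \<le> m" using P by (auto simp: ps_def)
  from word_model_tensor_reps[OF this] obtain A B where "word_model m ks N V A B"
    unfolding V_def ks_def es_def by blast
  moreover obtain D R where "V = (D, R)" by (cases V)
  ultimately have "dim_invariants m V = card {x. lattice_block_word m ks N x}"
    using dim_invariants_word_model by blast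
  thus ?thesis using card_affine_growth_diagrams card_rows LR by simp
qed

end
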